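(* The constant term of $E_\beta(g,\nu,1)$ along the Jacobi parabolic $P_\beta$ is (as meromorphic functions of $\nu\in\mathbb C$) $$C_\beta(g,\nu,1)=C_{\beta,\mathrm{id}}(g,\nu,1)+C_{\beta,s_\alpha s_\beta}(g,\nu,1)+C_{\beta,s_\alpha s_\beta s_\alpha}(g,\nu,1),$$ where $$\begin{aligned} C_{\beta,\mathrm{id}}(g,\nu,1)&=y_1^{\nu+2},\\ C_{\beta,s_\alpha s_\beta}(g,\nu,1)&=\frac{\Lambda(\nu+1)}{\Lambda(\nu+2)}E\Bigl(-n_5+y_2^2i,\ \tfrac\nu2\Bigr)y_1,\\ C_{\beta,s_\alpha s_\beta s_\alpha}(g,\nu,1)&=\frac{\Lambda(\nu-1)}{\Lambda(\nu)}\frac{\Lambda(\nu)}{\Lambda(\nu+1)}\frac{\Lambda(\nu+1)}{\Lambda(\nu+2)}y_1^{-\nu+2}. \end{aligned}$$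
   Context: Let $J=\begin{pmatrix}0&I_2\\-I_2&0\end{pmatrix}$, $G=\mathrm{Sp}(4,\mathbb R)=\{g\in\mathrm{GL}(4,\mathbb R): g^\top Jg=J\}$, $\Gamma=\mathrm{Sp}(4,\mathbb Z)$, $K=\left\{\begin{pmatrix}A&B\\-B&A\end{pmatrix}: A+iB\in U(2)\right\}$. Every $g\in G/K$ has a unique (Iwasawa) representative $\begin{pmatrix}1&n_1&n_2&n_3\\0&1&n_4&n_5\\0&0&1&0\\0&0&-n_1&1\end{pmatrix}\mathrm{diag}(y_1,y_2,y_1^{-1},y_2^{-1})$ with $n_3=n_1n_5+n_4$, $y_1,y_2>0$; $n_5,y_1,y_2$ in the claim are these coordinates. Let $P_\beta=\begin{pmatrix}*&*&*&*\\0&*&*&*\\0&0&*&0\\0&*&*&*\end{pmatrix}\cap G$ be the Jacobi parabolic, with unipotent radical $N_\beta=\left\{\begin{pmatrix}1&n_1&n_2&n_3\\0&1&n_3&0\\0&0&1&0\\0&0&-n_1&1\end{pmatrix}\right\}$, $d\eta=dn_1\,dn_2\,dn_3$. Let $I_\beta(g,\nu)=y_1^{\nu+2}$ and $E_\beta(g,\nu,1)=\sum_{\gamma\in(P_\beta\cap\Gamma)\backslash\Gamma}I_\beta(\gamma g,\nu)$, continued meromorphically in $\nu\in\mathbb C$. The constant term is $C_\beta(g,\nu,1)=\int_{N_\beta(\mathbb Z)\backslash N_\beta(\mathbb R)}E_\beta(\eta g,\nu,1)\,d\eta$. The subscripts (Weyl group elements) are labels for the terms. $E(z,s)=\frac12\sum_{\delta\in\Gamma_{\infty,2}\backslash\mathrm{SL}(2,\mathbb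 Z)}\mathrm{Im}(\delta z)^{s+1/2}$, $\Gamma_{\infty,2}=\{\begin{pmatrix}1&b\\0&1\end{pmatrix}:b\in\mathbb Z\}$, meromorphically continued in $s$. $\Lambda(s)=\pi^{-s/2}\Gamma(s/2)\zeta(s)$. *)

theory Defs
  imports "HOL-Complex_Analysis.Complex_Analysis"
begin

no_notation fps_nth (infixl "$" 75)

section \<open>Groups\<close>

definition symp_J :: "real^4^4" where
  "symp_J = vector [vector [0, 0, 1, 0],
                    vector [0, 0, 0, 1],
                    vector [-1, 0, 0, 0],
                    vector [0, -1, 0, 0]]"

definition Sp4_R :: "(real^4^4) set" where
  "Sp4_R = {g. invertible g \<and> transpose g ** symp_J ** g = symp_J}"

definition Sp4_Z :: "(real^4^4) set" where
  "Sp4_Z = {g \<in> Sp4_R. \<forall>i j. g$i$j \<in> \<int>}"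

definition unitary2 :: "(complex^2^2) set" where
  "unitary2 = {U. (\<chi> i j. cnj (U$j$i)) ** U = mat 1}"

definition K_block :: "real^2^2 \<Rightarrow> real^2^2 \<Rightarrow> real^4^4" where
  "K_block A B = vector [vector [ A$1$1,  A$1$2, B$1$1, B$1$2],
                         vector [ A$2$1,  A$2$2, B$2$1, B$2$2],
                         vector [-B$1$1, -B$1$2, A$1$1, A$1$2],
                         vector [-B$2$1, -B$2$2, A$2$1, A$2$2]]"

definition K_max :: "(real^4^4) set" where
  "K_max = {K_block A B |A B. (\<chi> i j. Complex (A$i$j) (B$i$j)) \<in> unitary2}"

definition P_beta :: "(real^4^4) set" where
  "P_beta = {g \<in> Sp4_R. g$2$1 = 0 \<and> g$3$1 = 0 \<and> g$3$2 = 0 \<and> g$3$4 = 0 \<and> g$4$1 = 0}"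

definition n_beta :: "real \<Rightarrow> real \<Rightarrow> real \<Rightarrow> real^4^4" where
  "n_beta n1 n2 n3 = vector [vector [1, n1, n2, n3],
                             vector [0, 1, n3, 0],
                             vector [0, 0, 1, 0],
                             vector [0, 0, -n1, 1]]"

section \<open>Iwasawa coordinates\<close>

definition iwasawa_n :: "real \<Rightarrow> real \<Rightarrow> real \<Rightarrow> real \<Rightarrow> real^4^4" where
  "iwasawa_n n1 n2 n4 n5 = vector [vector [1, n1, n2, n1 * n5 + n4],
                                   vector [0, 1, n4, n5],
                                   vector [0, 0, 1, 0],
                                   vector [0, 0, -n1, 1]]"

definition iwasawa_a :: "real \<Rightarrow> real \<Rightarrow> real^4^4" where
  "iwasawa_a y1 y2 = vector [vector [y1, 0, 0, 0],
                             vector [0, y2, 0, 0],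
                             vector [0, 0, inverse y1, 0],
                             vector [0, 0, 0, inverse y2]]"

definition iwasawa_coords ::
    "real^4^4 \<Rightarrow> real \<Rightarrow> real \<Rightarrow> real \<Rightarrow> real \<Rightarrow> real \<Rightarrow> real \<Rightarrow> bool" where
  "iwasawa_coords g n1 n2 n4 n5 y1 y2 \<longleftrightarrow>
     y1 > 0 \<and> y2 > 0 \<and> (\<exists>k\<in>K_max. g = iwasawa_n n1 n2 n4 n5 ** iwasawa_a y1 y2 ** k)"

definition iw_y1 :: "real^4^4 \<Rightarrow> real" where
  "iw_y1 g = (THE y1. \<exists>n1 n2 n4 n5 y2. iwasawa_coords g n1 n2 n4 n5 y1 y2)"

definition iw_y2 :: "real^4^4 \<Rightarrow> real" where
  "iw_y2 g = (THE y2. \<exists>n1 n2 n4 n5 y1. iwasawa_coords g n1 n2 n4 n5 y1 y2)"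

definition iw_n5 :: "real^4^4 \<Rightarrow> real" where
  "iw_n5 g = (THE n5. \<exists>n1 n2 n4 y1 y2. iwasawa_coords g n1 n2 n4 n5 y1 y2)"

section \<open>Sums over cosets and meromorphic continuation\<close>

definition coset_space ::
    "(('a::semiring_1)^'n::finite^'n) set \<Rightarrow> ('a^'n^'n) set \<Rightarrow> ('a^'n^'n) set set" where
  "coset_space H S = S // {(x, y). x \<in> S \<and> y \<in> S \<and> (\<exists>h\<in>H. y = h ** x)}"

text \<open>
  The sum of \<open>f\<close> over the cosets \<open>H x\<close> in \<open>S\<close>, for \<open>f\<close> left invariant under \<open>H\<close>; the
  value of \<open>f\<close> on a coset is taken at a chosen representative.
\<close>
definition coset_sum ::
    "(('a::semiring_1)^'n::finite^'n) set \<Rightarrow> ('a^'n^'n) set \<Rightarrow> ('a^'n^'n \<Rightarrow> complex) \<Rightarrow> complex"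
    where
  "coset_sum H S f = (\<Sum>\<^sub>\<infinity>C\<in>coset_space H S. f (SOME x. x \<in> C))"

text \<open>
  The meromorphic continuation to the whole plane of a function given on the half-plane
  \<open>Re s > \<sigma>\<close>. The requirement \<open>nicely_meromorphic_on\<close> (continuous away from the poles, value
  \<open>0\<close> at the poles) makes the continuation unique as a total function. In each use below,
  \<open>\<sigma>\<close> is the abscissa of absolute convergence of the series being continued.
\<close>
definition mero_continuation :: "real \<Rightarrow> (complex \<Rightarrow> complex) \<Rightarrow> complex \<Rightarrow> complex" where
  "mero_continuation \<sigma> f =
     (THE F. F nicely_meromorphic_on UNIV \<and> (\<forall>s. Re s > \<sigma> \<longrightarrow> F s = f s))"

section \<open>The completed zeta function\<close>

definition zeta :: "complex \<Rightarrow> complex" where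
  "zeta = mero_continuation 1 (\<lambda>s. \<Sum>n. 1 / of_nat (Suc n) powr s)"

definition Lambda :: "complex \<Rightarrow> complex" where
  "Lambda s = of_real pi powr (- s / 2) * Gamma (s / 2) * zeta s"

section \<open>Eisenstein series\<close>

definition SL2_Z :: "(int^2^2) set" where
  "SL2_Z = {d. det d = 1}"

definition Gamma_inf2 :: "(int^2^2) set" where
  "Gamma_inf2 = {vector [vector [1, b], vector [0, 1]] |b. True}"

definition sl2_act :: "int^2^2 \<Rightarrow> complex \<Rightarrow> complex" where
  "sl2_act d z = moebius (of_int (d$1$1)) (of_int (d$1$2)) (of_int (d$2$1)) (of_int (d$2$2)) z"

definition E_SL2 :: "complex \<Rightarrow> complex \<Rightarrow> complex" where
  "E_SL2 z = mero_continuation (1/2) (\<lambda>s.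
     1/2 * coset_sum Gamma_inf2 SL2_Z (\<lambda>d. of_real (Im (sl2_act d z)) powr (s + 1/2)))"

definition I_beta :: "real^4^4 \<Rightarrow> complex \<Rightarrow> complex" where
  "I_beta g \<nu> = of_real (iw_y1 g) powr (\<nu> + 2)"

definition E_beta :: "real^4^4 \<Rightarrow> complex \<Rightarrow> complex" where
  "E_beta g = mero_continuation 2 (\<lambda>\<nu>.
     coset_sum (P_beta \<inter> Sp4_Z) Sp4_Z (\<lambda>\<gamma>. I_beta (\<gamma> ** g) \<nu>))"

text \<open>
  The integral over the quotient of \<open>N\<^sub>\<beta>(\<real>)\<close> by \<open>N\<^sub>\<beta>(\<int>)\<close>, acting on the left, is written
  out over the half-open unit cube in the coordinates \<open>(n\<^sub>1, n\<^sub>2, n\<^sub>3)\<close>, which is a strict fundamental domain by the following lemma.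
\<close>
definition unit_cube :: "(real \<times> real \<times> real) set" where
  "unit_cube = {0..<1} \<times> {0..<1} \<times> {0..<1}"

definition C_beta :: "real^4^4 \<Rightarrow> complex \<Rightarrow> complex" where
  "C_beta g \<nu> =
     set_lebesgue_integral lborel unit_cube (\<lambda>(n1, n2, n3). E_beta (n_beta n1 n2 n3 ** g) \<nu>)"

lemma vector_4:
  fixes a b c d :: "'a::zero"
  shows "(vector [a, b, c, d] :: 'a^4)$1 = a"
    and "(vector [a, b, c, d] :: 'a^4)$2 = b"
    and "(vector [a, b, c, d] :: 'a^4)$3 = c"
    and "(vector [a, b, c, d] :: 'a^4)$4 = d"
  by (simp_all add: vector_def)

lemma n_beta_mult:
  "n_beta m1 m2 m3 ** n_beta n1 n2 n3 =
   n_beta (m1 + n1) (m2 + n2 + m1 * n3 - m3 * n1) (m3 + n3)"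
  by (simp add: n_beta_def vec_eq_iff forall_4 matrix_matrix_mult_def sum_4 vector_4 algebra_simps)

lemma n_beta_eq_iff:
  "n_beta m1 m2 m3 = n_beta n1 n2 n3 \<longleftrightarrow> m1 = n1 \<and> m2 = n2 \<and> m3 = n3"
  by (auto simp: n_beta_def vec_eq_iff forall_4 vector_4)

lemma unit_cube_fundamental_domain:
  "\<exists>!(n, m). n \<in> unit_cube \<and> m \<in> \<int> \<times> \<int> \<times> \<int> \<and>
     n_beta x1 x2 x3 = (case m of (m1, m2, m3) \<Rightarrow> n_beta m1 m2 m3)
                       ** (case n of (n1, n2, n3) \<Rightarrow> n_beta n1 n2 n3)"
proof -
  have frac_unique: "n = frac x \<and> m = of_int \<lfloor>x\<rfloor>"
    if "x = m + n" "m \<in> \<int>" "0 \<le> n" "n < 1" for x m n :: real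
  proof -
    from \<open>m \<in> \<int>\<close> obtain k where k: "m = of_int k"
      by (elim Ints_cases)
    with that have "\<lfloor>x\<rfloor> = k"
      by (intro floor_unique) simp_all
    with that k show ?thesis
      by (simp add: frac_def)
  qed
  define t where "t = x2 - of_int \<lfloor>x1\<rfloor> * frac x3 + of_int \<lfloor>x3\<rfloor> * frac x1"
  show ?thesis
  proof (rule ex1I[of _ "((frac x1, frac t, frac x3),
                          (of_int \<lfloor>x1\<rfloor>, of_int \<lfloor>t\<rfloor>, of_int \<lfloor>x3\<rfloor>))"], goal_cases)
    case 1
    have eq: "of_int \<lfloor>x\<rfloor> + frac x = x" for x :: real
      by (simp add: frac_def)
    have "of_int \<lfloor>t\<rfloor> + frac t + of_int \<lfloor>x1\<rfloor> * frac x3 - of_int \<lfloor>x3\<rfloor> * frac x1 = x2"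
      unfolding eq by (simp add: t_def)
    then show ?case
      by (simp add: unit_cube_def frac_lt_1 n_beta_mult n_beta_eq_iff eq)
  next
    case (2 p)
    obtain n1 n2 n3 m1 m2 m3 where p: "p = ((n1, n2, n3), (m1, m2, m3))"
      by (metis surj_pair)
    have 1: "n1 = frac x1 \<and> m1 = of_int \<lfloor>x1\<rfloor>"
      by (rule frac_unique) (use 2 in \<open>simp_all add: p unit_cube_def n_beta_mult n_beta_eq_iff\<close>)
    have 3: "n3 = frac x3 \<and> m3 = of_int \<lfloor>x3\<rfloor>"
      by (rule frac_unique) (use 2 in \<open>simp_all add: p unit_cube_def n_beta_mult n_beta_eq_iff\<close>)
    have "t = m2 + n2"
      using 2 1 3 by (simp add: p t_def n_beta_mult n_beta_eq_iff)
    then have "n2 = frac t \<and> m2 = of_int \<lfloor>t\<rfloor>"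
      by (rule frac_unique) (use 2 in \<open>simp_all add: p unit_cube_def\<close>)
    with 1 3 show ?case
      by (simp add: p)
  qed
qed

end

theory Submission
  imports Defs "HOL-Probability.Distributions" "HOL-Probability.Sinc_Integral"
begin

text \<open>
  The cosets of \<open>P\<^sub>\<beta> \<inter> \<Gamma>\<close> in \<open>\<Gamma>\<close> correspond to the primitive rows \<open>v\<close> in \<open>\<int>\<^sup>4\<close> up to sign, through the
  third row of a matrix, and \<open>y\<^sub>1(\<gamma> g)\<close> is the reciprocal of the length of \<open>v g\<close>.  Hence \<open>E\<^sub>\<beta>(g, \<nu>)\<close> times
  \<open>\<zeta>(\<nu> + 2)\<close> is half the Epstein zeta function of the lattice \<open>\<int>\<^sup>4 g\<close> at \<open>s = \<nu>/2 + 1\<close>, and the rank two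
  series \<open>E(z, s)\<close> is an Epstein zeta function in the same way (\<open>E_beta_series\<close>, \<open>E_SL2_series\<close>,
  \<open>primitive_sum_eq_completed\<close>).

  By Riemann's method an Epstein zeta function, completed by \<open>\<pi>\<^sup>-\<^sup>s \<Gamma>(s)\<close>, is the Mellin transform of a theta
  series \<open>\<theta>(t) = \<Sum>\<^sub>v exp(- \<pi> t q(v))\<close> without its constant term.  It continues to all \<open>s\<close>
  because \<open>\<theta>(t)\<close> equals its leading term \<open>C t\<^sup>-\<^sup>n\<^sup>/\<^sup>2\<close>, where \<open>n\<close> is the rank, up to an error that is
  smaller than any power of \<open>t\<close> as \<open>t \<rightarrow> 0\<close>.  For one variable this holds uniformly in the shift
  \<open>x\<close> of \<open>\<Sum>\<^sub>m exp(- \<pi> t (m + x)\<^sup>2)\<close> (\<open>gauss_approx\<close>): the sum is periodic in \<open>x\<close>, its oscillation is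
  bounded by any of its higher derivatives, and these are small by Cauchy's inequality.  A triangular form is
  summed one variable at a time, and since all terms are positive the relative errors accumulate
  harmlessly (\<open>theta_controlled_extend\<close>).  The resulting bounds depend only on \<open>y\<^sub>1\<close> and \<open>y\<^sub>2\<close>, so they hold
  for all \<open>\<eta>\<close> in \<open>N\<^sub>\<beta>\<close> at once.

  Uniformity makes the integral over \<open>\<eta>\<close> commute with the Mellin transform, also where the latter
  is continued (\<open>completed_average\<close>), so that the constant term may be computed on theta series.
  There all terms are positive and the integral unfolds (\<open>nn_integral_cube_theta\<close>).  Writing
  \<open>v = (a, b, c, d)\<close>, the rows \<open>(0, 0, c, 0)\<close> do not change under \<open>\<eta>\<close> and give \<open>\<theta>(t/y\<^sub>1\<^sup>2)\<close> for the form
  \<open>m\<^sup>2\<close>; for \<open>a = 0\<close>, \<open>(b, d) \<noteq> 0\<close> the sum over \<open>c\<close> becomes an integral and leaves the rank two series of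
  the point \<open>- n\<^sub>5 + y\<^sub>2\<^sup>2 \<i>\<close>; for \<open>a \<noteq> 0\<close> the sums over \<open>b\<close>, \<open>c\<close>, \<open>d\<close> all become integrals and leave a series
  in \<open>a\<close>.  The Mellin transforms of the three parts are the three terms of the formula, first in a
  half-plane and then everywhere by the identity theorem (\<open>completed_constant_term\<close>).
\<close>

section \<open>Meromorphic continuation\<close>

lemma halfplane_not_cosparse_complement:
  fixes P :: "complex \<Rightarrow> bool"
  assumes "\<And>s. Re s > \<sigma> \<Longrightarrow> P s"
  shows "\<not> (\<forall>\<^sub>\<approx>s. \<not> P s)"
proof
  assume ev: "\<forall>\<^sub>\<approx>s. \<not> P s"
  define s0 where "s0 = complex_of_real (\<sigma> + 1)"
  have "eventually (\<lambda>s. \<not> P s) (at s0)"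
    using ev by (rule eventually_cosparse_imp_eventually_at) auto
  moreover have "eventually (\<lambda>s. s \<in> {s. Re s > \<sigma>}) (at s0)"
    by (intro eventually_at_in_open' open_halfspace_Re_gt) (simp add: s0_def)
  ultimately have "eventually (\<lambda>s. False) (at s0)"
    by eventually_elim (use assms in auto)
  then show False by simp
qed

text \<open>
  A meromorphic function is zero almost everywhere or nonzero almost everywhere, and its values on
  a half-plane decide between the two.
\<close>
lemma meromorphic_eq_if_eq_on_halfplane:
  assumes F: "F meromorphic_on UNIV" and G: "G meromorphic_on UNIV"
    and eq: "\<And>s. Re s > \<sigma> \<Longrightarrow> F s = G s"
  shows "\<forall>\<^sub>\<approx>s. F s = G s"
proof -
  have "(\<lambda>s. F s - G s) meromorphic_on UNIV"
    using F G by (intro meromorphic_intros)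
  from meromorphic_imp_constant_or_avoid[OF this, of 0]
    halfplane_not_cosparse_complement[of \<sigma> "\<lambda>s. F s = G s", OF eq]
  show ?thesis by auto
qed

lemma meromorphic_nonzero_cosparse:
  assumes f: "f meromorphic_on UNIV" and nz: "\<And>s. Re s > \<sigma> \<Longrightarrow> f s \<noteq> 0"
  shows "\<forall>\<^sub>\<approx>s. f s \<noteq> 0"
  using meromorphic_imp_constant_or_avoid[OF f, of 0]
    halfplane_not_cosparse_complement[of \<sigma> "\<lambda>s. f s \<noteq> 0", OF nz] by auto

lemma remove_sings_nicely_meromorphic_eq:
  assumes "G nicely_meromorphic_on UNIV"
  shows "remove_sings G = G"
proof
  fix z
  have "is_pole G z \<and> G z = 0 \<or> G \<midarrow>z\<rightarrow> G z"
    using assms by (auto simp: nicely_meromorphic_on_def)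
  then show "remove_sings G z = G z"
    by (auto simp: remove_sings_eqI)
qed

text \<open>
  Removing the singularities of some continuation gives the normalised one, and two normalised
  continuations agree because their difference vanishes off a sparse set.
\<close>
lemma mero_continuation_eq:
  assumes F: "F meromorphic_on UNIV"
    and an: "F analytic_on {s. Re s > \<sigma>}"
    and eq: "\<And>s. Re s > \<sigma> \<Longrightarrow> F s = f s"
  shows "mero_continuation \<sigma> f = remove_sings F"
  unfolding mero_continuation_def
proof (rule the_equality, goal_cases)
  case 1
  have "remove_sings F s = f s" if "Re s > \<sigma>" for s
  proof -
    have "F analytic_on {s}"
      using an by (rule analytic_on_subset) (use that in auto)
    then show ?thesis using eq that by simp
  qed
  then show ?case using remove_sings_nicely_meromorphic[OF F] by auto
next
  case (2 G)
  then have G: "G meromorphic_on UNIV" by (auto simp: nicely_meromorphic_on_def)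
  have ev: "\<forall>\<^sub>\<approx>s. F s = G s"
    by (rule meromorphic_eq_if_eq_on_halfplane[OF F G, of \<sigma>]) (use eq 2 in auto)
  have "remove_sings F = remove_sings G"
    by (intro ext remove_sings_cong refl) (use eventually_cosparse_imp_eventually_at[OF ev] in auto)
  then show ?case using 2 remove_sings_nicely_meromorphic_eq by simp
qed

section \<open>Holomorphic parameter integrals\<close>

text \<open>
  Cauchy's inequality turns a majorant for the integrand on a disc into a majorant for its
  derivative on a smaller disc, so that the difference quotients converge dominatedly.
\<close>
lemma holomorphic_integral:
  fixes f :: "complex \<Rightarrow> 'a \<Rightarrow> complex"
  assumes U: "open U"
    and meas: "\<And>s. s \<in> U \<Longrightarrow> f s \<in> borel_measurable M"
    and hol: "\<And>t. t \<in> space M \<Longrightarrow> (\<lambda>s. f s t) holomorphic_on U"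
    and dom: "\<And>s. s \<in> U \<Longrightarrow> \<exists>r>0. \<exists>g. integrable M g \<and>
                (\<forall>z\<in>ball s r \<inter> U. \<forall>t\<in>space M. norm (f z t) \<le> g t)"
  shows "(\<lambda>s. \<integral>t. f s t \<partial>M) holomorphic_on U"
proof (subst holomorphic_on_open[OF U], intro ballI)
  fix s assume s: "s \<in> U"
  obtain r1 where r1: "r1 > 0" "ball s r1 \<subseteq> U" using U s openE by blast
  obtain r2 g where r2: "r2 > 0" "integrable M g"
    "\<And>z t. z \<in> ball s r2 \<inter> U \<Longrightarrow> t \<in> space M \<Longrightarrow> norm (f z t) \<le> g t"
    using dom[OF s] by metis
  define r where "r = min r1 r2 / 4"
  have r: "r > 0" using r1 r2 by (auto simp: r_def)
  have sub: "ball s (4 * r) \<subseteq> U" using r1 by (auto simp: r_def)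
  have bd: "norm (f z t) \<le> g t" if "z \<in> ball s (4 * r)" "t \<in> space M" for z t
    using r2(3)[of z t] that sub by (auto simp: r_def)
  have int: "integrable M (f z)" if "z \<in> ball s (4 * r)" for z
    by (rule Bochner_Integration.integrable_bound[OF r2(2)])
       (use that sub meas[of z] bd[OF that] in \<open>auto intro!: AE_I2 order.trans[OF _ abs_ge_self]\<close>)
  have deriv_bd: "norm (deriv (\<lambda>s. f s t) z) \<le> g t / r"
    if z: "z \<in> ball s (2 * r)" and t: "t \<in> space M" for z t
  proof -
    have sub': "cball z r \<subseteq> ball s (4 * r)"
    proof
      fix x assume "x \<in> cball z r"
      then show "x \<in> ball s (4 * r)"
        using z r dist_triangle[of s x z] by (auto simp: dist_commute)
    qed
    have "(\<lambda>s. f s t) holomorphic_on cball z r"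
      using hol[OF t] by (rule holomorphic_on_subset) (use sub sub' in auto)
    then have "norm ((deriv ^^ 1) (\<lambda>s. f s t) z) \<le> fact 1 * g t / r ^ 1"
    proof (intro Cauchy_inequality)
      fix x assume "norm (z - x) = r"
      then have "x \<in> cball z r" by (simp add: dist_norm)
      then show "norm (f x t) \<le> g t" using sub' bd t by blast
    qed (use r in \<open>auto intro: holomorphic_on_subset holomorphic_on_imp_continuous_on\<close>)
    then show ?thesis by simp
  qed
  have dq: "norm ((f (s + h) t - f s t) / h) \<le> g t / r"
    if h: "h \<noteq> 0" "norm h < 2 * r" and t: "t \<in> space M" for h t
  proof -
    have "norm (f (s + h) t - f s t) \<le> g t / r * norm (s + h - s)"
    proof (rule field_differentiable_bound[of "ball s (2 * r)" "\<lambda>z. f z t" "\<lambda>z. deriv (\<lambda>z. f z t) z"])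
      fix z assume z: "z \<in> ball s (2 * r)"
      have "z \<in> U" using z sub r by auto
      then have "(\<lambda>z. f z t) field_differentiable at z"
        using hol[OF t] U by (simp add: holomorphic_on_imp_differentiable_at)
      then show "((\<lambda>z. f z t) has_field_derivative deriv (\<lambda>z. f z t) z) (at z within ball s (2*r))"
        by (simp add: DERIV_deriv_iff_field_differentiable has_field_derivative_at_within)
    qed (use deriv_bd h t r in \<open>auto simp: dist_norm\<close>)
    then show ?thesis using h r by (simp add: norm_divide field_simps)
  qed
  have "((\<lambda>s. \<integral>t. f s t \<partial>M) has_field_derivative (\<integral>t. deriv (\<lambda>s. f s t) s \<partial>M)) (at s)"
    unfolding DERIV_def
  proof (subst tendsto_at_iff_sequentially, intro allI impI)
    fix X :: "nat \<Rightarrow> complex"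
    assume X: "\<forall>i. X i \<in> UNIV - {0}" "X \<longlonglongrightarrow> 0"
    then have "eventually (\<lambda>n. norm (X n) < 2 * r) sequentially"
      using r by (simp add: tendsto_iff dist_norm)
    then obtain n0 where n0: "\<And>n. n \<ge> n0 \<Longrightarrow> norm (X n) < 2 * r"
      by (auto simp: eventually_sequentially)
    define Y where "Y n = X (n + n0)" for n
    have Y: "Y n \<noteq> 0" "norm (Y n) < 2 * r" for n using X n0 by (auto simp: Y_def)
    have Yl: "Y \<longlonglongrightarrow> 0" using X(2) unfolding Y_def by (rule LIMSEQ_ignore_initial_segment)
    have in1: "s + Y n \<in> ball s (4 * r)" for n using Y(2)[of n] r by (auto simp: dist_norm)
    have in0: "s \<in> ball s (4 * r)" using r by auto
    have m: "(\<lambda>t. (f (s + Y n) t - f s t) / Y n) \<in> borel_measurable M" for n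
      using subsetD[OF sub in1[of n]] s by (intro borel_measurable_divide borel_measurable_diff meas) auto
    have lim: "(\<lambda>n. (f (s + Y n) t - f s t) / Y n) \<longlonglongrightarrow> deriv (\<lambda>s. f s t) s" if t: "t \<in> space M" for t
    proof -
      have "(\<lambda>z. f z t) field_differentiable at s"
        using hol[OF t] U s by (simp add: holomorphic_on_imp_differentiable_at)
      then have "((\<lambda>h. (f (s + h) t - f s t) / h) \<longlongrightarrow> deriv (\<lambda>z. f z t) s) (at 0)"
        by (simp add: DERIV_deriv_iff_field_differentiable[symmetric] DERIV_def)
      then show ?thesis using Y Yl
        by (auto simp: tendsto_at_iff_sequentially o_def)
    qed
    have "(\<lambda>n. \<integral>t. (f (s + Y n) t - f s t) / Y n \<partial>M) \<longlonglongrightarrow> (\<integral>t. deriv (\<lambda>s. f s t) s \<partial>M)"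
    proof (rule integral_dominated_convergence[where w = "\<lambda>t. g t / r"])
      show "(\<lambda>t. deriv (\<lambda>s. f s t) s) \<in> borel_measurable M"
        by (rule borel_measurable_LIMSEQ_metric[OF m lim])
    qed (use m lim dq Y r2 in auto)
    also have "(\<lambda>n. \<integral>t. (f (s + Y n) t - f s t) / Y n \<partial>M) =
      (\<lambda>n. ((\<integral>t. f (s + Y n) t \<partial>M) - (\<integral>t. f s t \<partial>M)) / Y n)"
      using int[OF in1] int[OF in0] by (intro ext) simp
    finally have "(\<lambda>n. ((\<integral>t. f (s + X (n + n0)) t \<partial>M) - (\<integral>t. f s t \<partial>M)) / X (n + n0))
       \<longlonglongrightarrow> (\<integral>t. deriv (\<lambda>s. f s t) s \<partial>M)" by (simp add: Y_def)
    from LIMSEQ_offset[OF this]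
    show "((\<lambda>h. ((\<integral>t. f (s + h) t \<partial>M) - (\<integral>t. f s t \<partial>M)) / h) \<circ> X) \<longlonglongrightarrow> (\<integral>t. deriv (\<lambda>s. f s t) s \<partial>M)"
      by (simp add: o_def)
  qed
  then show "\<exists>f'. ((\<lambda>s. \<integral>t. f s t \<partial>M) has_field_derivative f') (at s)" by blast
qed

section \<open>Mellin transforms of functions decaying rapidly at both ends\<close>

text \<open>
  The exponents run over all real numbers, so that one condition expresses rapid decay both
  at \<open>0\<close> and at infinity.
\<close>
definition rapid :: "(real \<Rightarrow> real) \<Rightarrow> bool" where
  "rapid R \<longleftrightarrow> R \<in> borel_measurable borel \<and> (\<forall>a. \<exists>K. \<forall>t>0. \<bar>R t\<bar> \<le> K * t powr a)"

definition mellin :: "(real \<Rightarrow> real) \<Rightarrow> complex \<Rightarrow> complex" where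
  "mellin R s = (\<integral>t. of_real (indicator {0<..} t * R t) * of_real t powr (s - 1) \<partial>lborel)"

text \<open>
  Two power bounds for a function combine to one majorant that is integrable at both ends.
\<close>
lemma two_power_bound:
  fixes x t b :: real
  assumes t: "t > 0" and K: "\<bar>x\<bar> \<le> K1 * t powr (- b)" "\<bar>x\<bar> \<le> K2 * t powr (- b - 2)"
  shows "\<bar>x\<bar> * t powr b \<le> (K1 + K2) * inverse (1 + t\<^sup>2)"
proof -
  have "\<bar>x\<bar> * t powr b \<le> K1 * t powr (- b) * t powr b"
    using K(1) by (intro mult_right_mono) auto
  then have 1: "\<bar>x\<bar> * t powr b \<le> K1" using t by (simp add: mult.assoc flip: powr_add)
  have "\<bar>x\<bar> * t powr (b + 2) \<le> K2 * t powr (- b - 2) * t powr (b + 2)"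
    using K(2) by (intro mult_right_mono) auto
  then have 2: "\<bar>x\<bar> * t powr b * t\<^sup>2 \<le> K2" using t
    by (simp add: mult.assoc powr_realpow flip: powr_add) (simp add: powr_add powr_numeral mult.assoc)
  have "\<bar>x\<bar> * t powr b * (1 + t\<^sup>2) \<le> K1 + K2" using 1 2 by (simp add: algebra_simps)
  moreover have "1 + t\<^sup>2 > 0" by (simp add: add_pos_nonneg)
  ultimately show ?thesis by (simp add: field_simps)
qed

lemma integrable_inverse_1_plus_sq: "integrable lborel (\<lambda>t::real. K * inverse (1 + t\<^sup>2))"
  using integrable_inverse_1_plus_square by (simp add: set_integrable_def)

lemma rapid_integrable:
  assumes "rapid R"
  shows "integrable lborel (\<lambda>t. indicator {0<..} t * (\<bar>R t\<bar> * t powr a))"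
proof -
  have meas[measurable]: "R \<in> borel_measurable borel" using assms by (auto simp: rapid_def)
  obtain K1 where K1: "\<And>t. t > 0 \<Longrightarrow> \<bar>R t\<bar> \<le> K1 * t powr (-a)"
    using assms unfolding rapid_def by blast
  obtain K2 where K2: "\<And>t. t > 0 \<Longrightarrow> \<bar>R t\<bar> \<le> K2 * t powr (-a-2)"
    using assms unfolding rapid_def by blast
  from integrable_inverse_1_plus_sq[of "K1 + K2"] show ?thesis
  proof (rule Bochner_Integration.integrable_bound, measurable, intro AE_I2)
    fix t :: real
    show "norm (indicator {0<..} t * (\<bar>R t\<bar> * t powr a)) \<le> norm ((K1 + K2) * inverse (1 + t^2))"
    proof (cases "t > 0")
      case True
      have "\<bar>R t\<bar> * t powr a \<le> (K1 + K2) * inverse (1 + t\<^sup>2)"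
        by (rule two_power_bound[OF True K1[OF True] K2[OF True]])
      also have "\<dots> \<le> norm ((K1 + K2) * inverse (1 + t^2))" by simp
      finally show ?thesis using True by (simp add: abs_mult)
    qed simp
  qed
qed

lemma measurable_of_real_powr [measurable]:
  "(\<lambda>t. complex_of_real t powr s) \<in> borel_measurable borel"
  unfolding powr_def by measurable

lemma norm_of_real_powr:
  "t > 0 \<Longrightarrow> norm (complex_of_real t powr s) = t powr Re s"
  by (simp add: norm_powr_real_powr)

lemma mellin_holomorphic:
  assumes "rapid R"
  shows "mellin R holomorphic_on A"
proof (rule holomorphic_on_subset)
  have meas[measurable]: "R \<in> borel_measurable borel" using assms by (auto simp: rapid_def)
  show "mellin R holomorphic_on UNIV"
    unfolding mellin_def
  proof (rule holomorphic_integral, goal_cases)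
    case (3 t)
    then show ?case by (cases "t > 0") (auto intro!: holomorphic_intros)
  next
    case (4 s)
    define g where "g t = indicator {0<..} t * (\<bar>R t\<bar> * t powr (Re s - 2)) +
       indicator {0<..} t * (\<bar>R t\<bar> * t powr (Re s))" for t
    have "integrable lborel g"
      unfolding g_def by (intro Bochner_Integration.integrable_add rapid_integrable assms)
    moreover have "norm (of_real (indicator {0<..} t * R t) * of_real t powr (z - 1)) \<le> g t"
      if z: "z \<in> ball s 1" for z t
    proof (cases "t > 0")
      case True
      have *: "\<bar>Re s - Re z\<bar> \<le> 1"
        using z abs_Re_le_cmod[of "s - z"] by (auto simp: dist_norm)
      have "t powr (Re z - 1) \<le> t powr (Re s - 2) + t powr Re s"
      proof (cases "t \<le> 1")
        case True
        then have "t powr (Re z - 1) \<le> t powr (Re s - 2)"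
          using * \<open>t > 0\<close> by (intro powr_mono') auto
        then show ?thesis by (simp add: add_increasing2)
      next
        case False
        then have "t powr (Re z - 1) \<le> t powr (Re s)"
          using * \<open>t > 0\<close> by (intro powr_mono) auto
        then show ?thesis by (simp add: add_increasing)
      qed
      then have "\<bar>R t\<bar> * t powr (Re z - 1) \<le> \<bar>R t\<bar> * (t powr (Re s - 2) + t powr Re s)"
        by (intro mult_left_mono) auto
      then show ?thesis using True
        by (simp add: g_def norm_mult norm_of_real_powr algebra_simps)
    qed (auto simp: g_def)
    ultimately show ?case by (intro exI[of _ 1]) auto
  qed measurable
qed auto

section \<open>One-dimensional Gaussian sums\<close>

text \<open>
  Squares of integers dominate absolute values, which leaves a geometric series.
\<close>
lemma integrable_gauss_int:
  assumes c: "c > 0"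
  shows "integrable (count_space UNIV) (\<lambda>m::int. exp (- c * (real_of_int m)\<^sup>2))"
proof -
  have "summable (\<lambda>n. exp (- c) ^ n)"
    using c by (intro summable_geometric) auto
  then have s: "(\<lambda>n::nat. exp (- c * real n)) summable_on UNIV"
    by (subst summable_on_UNIV_nonneg_real_iff) (simp_all add: exp_of_nat_mult[symmetric] mult.commute)
  define f where "f m = exp (- c * \<bar>real_of_int m\<bar>)" for m :: int
  have "f summable_on (range int)" "f summable_on (range (\<lambda>n. - int n))"
    by (subst summable_on_reindex; use s in \<open>simp add: f_def o_def inj_on_def\<close>)+
  then have "f summable_on (range int \<union> range (\<lambda>n. - int n))"
    by (rule summable_on_union)
  moreover have "range int \<union> range (\<lambda>n. - int n) = UNIV"
    by (auto simp: image_iff) (metis int_cases2)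
  ultimately have "f summable_on UNIV" by simp
  moreover have "(\<lambda>m. norm (f m)) = f" by (simp add: f_def fun_eq_iff)
  ultimately have "Infinite_Sum.abs_summable_on f UNIV" by simp
  then have "integrable (count_space UNIV) f"
    using abs_summable_equivalent[of f UNIV] unfolding abs_summable_on_def by blast
  then show ?thesis
  proof (rule Bochner_Integration.integrable_bound, goal_cases)
    case 2
    have "\<bar>real_of_int m\<bar> \<le> (real_of_int m)\<^sup>2" for m
    proof -
      have "\<bar>m\<bar> * 1 \<le> \<bar>m\<bar> * \<bar>m\<bar>" by (cases "m = 0", simp, intro mult_left_mono) auto
      then have "\<bar>m\<bar> \<le> m\<^sup>2" by (simp only: power2_eq_square abs_mult_self_eq mult_1_right)
      then show ?thesis by (metis of_int_abs of_int_le_iff of_int_power)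
    qed
    then show ?case using c by (intro AE_I2) (simp add: f_def)
  qed simp
qed

text \<open>
  The periodised Gaussian, extended to a complex argument so that Cauchy's inequality can be applied
  to it.
\<close>
definition gauss_sum :: "real \<Rightarrow> complex \<Rightarrow> complex" where
  "gauss_sum t z = (\<integral>m. exp (- (of_real (pi * t) * (of_int m + z)\<^sup>2)) \<partial>count_space (UNIV :: int set))"

definition gauss :: "real \<Rightarrow> real \<Rightarrow> real" where
  "gauss t x = (\<integral>m. exp (- (pi * t * (real_of_int m + x)\<^sup>2)) \<partial>count_space UNIV)"

lemma norm_gauss_term:
  "norm (exp (- (complex_of_real (pi * t) * (of_int m + z)\<^sup>2))) =
     exp (pi * t * (Im z)\<^sup>2) * exp (- (pi * t * (real_of_int m + Re z)\<^sup>2))"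
proof -
  have "norm (exp (- (complex_of_real (pi * t) * (of_int m + z)\<^sup>2))) =
      exp (- (pi * t * Re ((of_int m + z)\<^sup>2)))"
    unfolding norm_exp_eq_Re by simp
  also have "Re ((of_int m + z)\<^sup>2) = (real_of_int m + Re z)\<^sup>2 - (Im z)\<^sup>2"
    by (simp add: Re_power2)
  also have "- (pi * t * \<dots>) = pi * t * (Im z)\<^sup>2 + - (pi * t * (real_of_int m + Re z)\<^sup>2)"
    by (simp add: right_diff_distrib)
  finally show ?thesis by (simp only: exp_add)
qed

lemma gauss_term_le:
  assumes "t > 0" "\<bar>x\<bar> \<le> B"
  shows "exp (- (pi * t * (real_of_int m + x)\<^sup>2)) \<le> exp (pi * t * B\<^sup>2) * exp (- (pi * t / 2) * (real_of_int m)\<^sup>2)"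
proof -
  have "x\<^sup>2 \<le> B\<^sup>2" using assms power2_le_iff_abs_le[of B x] by auto
  moreover have "0 \<le> (real_of_int m + 2 * x)\<^sup>2" by simp
  ultimately have "(real_of_int m)\<^sup>2 / 2 - B\<^sup>2 \<le> (real_of_int m + x)\<^sup>2"
    unfolding power2_sum by (simp add: power_mult_distrib)
  then have "pi * t * ((real_of_int m)\<^sup>2 / 2 - B\<^sup>2) \<le> pi * t * (real_of_int m + x)\<^sup>2"
    using assms by (intro mult_left_mono) auto
  then have "- (pi * t * (real_of_int m + x)\<^sup>2) \<le> pi * t * B\<^sup>2 + - (pi * t / 2) * (real_of_int m)\<^sup>2"
    by (simp add: algebra_simps)
  then show ?thesis by (simp only: exp_le_cancel_iff flip: exp_add)
qed

lemma integrable_gauss: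
  assumes "t > 0"
  shows "integrable (count_space UNIV) (\<lambda>m. exp (- (pi * t * (real_of_int m + x)\<^sup>2)))"
proof (rule Bochner_Integration.integrable_bound)
  show "integrable (count_space UNIV) (\<lambda>m. exp (pi * t * \<bar>x\<bar>\<^sup>2) * exp (- (pi * t / 2) * (real_of_int m)\<^sup>2))"
    using assms by (intro integrable_mult_right integrable_gauss_int) auto
qed (use gauss_term_le[OF assms order.refl] in auto)

lemma gauss_sum_of_real: "gauss_sum t (of_real x) = of_real (gauss t x)"
proof -
  have "exp (- (complex_of_real (pi * t) * (of_int m + of_real x)\<^sup>2)) =
        of_real (exp (- (pi * t * (real_of_int m + x)\<^sup>2)))" for m
    by (simp flip: exp_of_real)
  then show ?thesis by (simp add: gauss_sum_def gauss_def)
qed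

lemma gauss_nonneg: "gauss t x \<ge> 0"
  unfolding gauss_def by (rule Bochner_Integration.integral_nonneg) simp

lemma gauss_antimono:
  assumes "0 < s" "s \<le> t"
  shows "gauss t x \<le> gauss s x"
  unfolding gauss_def
proof (intro integral_mono integrable_gauss)
  fix m
  have "pi * s * (real_of_int m + x)\<^sup>2 \<le> pi * t * (real_of_int m + x)\<^sup>2"
    using assms by (intro mult_right_mono mult_left_mono) auto
  then show "exp (- (pi * t * (real_of_int m + x)\<^sup>2)) \<le> exp (- (pi * s * (real_of_int m + x)\<^sup>2))"
    by simp
qed (use assms in auto)

lemma norm_gauss_sum_le:
  assumes "t > 0"
  shows "norm (gauss_sum t z) \<le> exp (pi * t * (Im z)\<^sup>2) * gauss t (Re z)"
proof -
  have "norm (gauss_sum t z) \<le> (\<integral>m. norm (exp (- (complex_of_real (pi * t) * (of_int m + z)\<^sup>2))) \<partial>count_space (UNIV :: int set))"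
    unfolding gauss_sum_def by (rule integral_norm_bound)
  also have "\<dots> = exp (pi * t * (Im z)\<^sup>2) * gauss t (Re z)"
    unfolding norm_gauss_term gauss_def using assms by (simp add: integrable_gauss)
  finally show ?thesis .
qed

lemma gauss_sum_holomorphic:
  assumes "t > 0"
  shows "gauss_sum t holomorphic_on A"
proof (rule holomorphic_on_subset)
  show "gauss_sum t holomorphic_on UNIV"
    unfolding gauss_sum_def
  proof (rule holomorphic_integral, goal_cases)
    case (4 s)
    define B where "B = norm s + 1"
    define g where "g m = exp (pi * t * B\<^sup>2) * (exp (pi * t * B\<^sup>2) * exp (- (pi * t / 2) * (real_of_int m)\<^sup>2))" for m :: int
    have "integrable (count_space UNIV) g"
      unfolding g_def using assms by (intro integrable_mult_right integrable_gauss_int) auto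
    moreover have "norm (exp (- (complex_of_real (pi * t) * (of_int m + z)\<^sup>2))) \<le> g m"
      if z: "z \<in> ball s 1" for z m
    proof -
      have zB: "norm z \<le> B"
        using z norm_triangle_ineq2[of z s] by (auto simp: B_def dist_norm norm_minus_commute)
      have "(Im z)\<^sup>2 \<le> B\<^sup>2"
        using abs_Im_le_cmod[of z] zB power2_le_iff_abs_le[of B "Im z"] by (auto simp: B_def)
      moreover have "\<bar>Re z\<bar> \<le> B" using abs_Re_le_cmod[of z] zB by simp
      ultimately show ?thesis
        unfolding norm_gauss_term g_def using assms
        by (intro mult_mono gauss_term_le) (auto intro!: mult_left_mono)
    qed
    ultimately show ?case by (intro exI[of _ 1]) auto
  qed (auto intro!: holomorphic_intros)
qed auto

lemma gauss_sum_plus_1: "gauss_sum t (z + 1) = gauss_sum t z"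
proof -
  have "gauss_sum t (z + 1) = (\<integral>m. exp (- (complex_of_real (pi * t) * (of_int (m + 1) + z)\<^sup>2)) \<partial>count_space (UNIV :: int set))"
    by (simp add: gauss_sum_def add_ac)
  also have "\<dots> = gauss_sum t z"
    unfolding gauss_sum_def
    by (rule integral_bij_count_space) (auto intro!: bij_betwI[of _ _ _ "\<lambda>m. m - 1"])
  finally show ?thesis .
qed

lemma gauss_periodic: "gauss t (x + of_int m) = gauss t x"
proof -
  interpret periodic_fun_simple' "gauss t"
  proof
    show "gauss t (x + 1) = gauss t x" for x
    proof -
      have "gauss_sum t (of_real (x + 1)) = gauss_sum t (of_real x)"
        using gauss_sum_plus_1[of t "of_real x"] by simp
      then show ?thesis by (simp only: gauss_sum_of_real of_real_eq_iff)
    qed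
  qed
  show ?thesis using plus_of_int by (simp add: add.commute)
qed

section \<open>The mean of a periodised function\<close>

lemma measurable_pair_count_space:
  fixes f :: "'a \<Rightarrow> 'c::countable \<Rightarrow> 'b::topological_space"
  assumes "\<And>m. (\<lambda>u. f u m) \<in> borel_measurable M"
  shows "(\<lambda>(u, m). f u m) \<in> borel_measurable (M \<Otimes>\<^sub>M count_space UNIV)"
proof -
  have "(\<lambda>p. f (fst p) m) \<in> borel_measurable (M \<Otimes>\<^sub>M count_space UNIV)" for m
    by (rule measurable_compose[OF measurable_fst assms])
  from measurable_compose_countable[OF this, of snd]
  show ?thesis by (simp add: case_prod_unfold)
qed

lemma measurable_nn_integral_count_space:
  fixes f :: "'a \<Rightarrow> 'c::countable \<Rightarrow> ennreal"
  assumes "\<And>m. (\<lambda>u. f u m) \<in> borel_measurable M"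
  shows "(\<lambda>u. \<integral>\<^sup>+m. f u m \<partial>count_space UNIV) \<in> borel_measurable M"
  by (intro sigma_finite_measure.borel_measurable_nn_integral
      sigma_finite_measure_count_space_countable measurable_pair_count_space assms) auto

lemma measurable_integral_count_space:
  fixes f :: "'a \<Rightarrow> 'c::countable \<Rightarrow> 'b::{banach, second_countable_topology}"
  assumes "\<And>m. (\<lambda>u. f u m) \<in> borel_measurable M"
  shows "(\<lambda>u. \<integral>m. f u m \<partial>count_space UNIV) \<in> borel_measurable M"
  by (intro sigma_finite_measure.borel_measurable_lebesgue_integral
      sigma_finite_measure_count_space_countable measurable_pair_count_space assms) auto

lemma nn_integral_periodise:
  fixes f :: "real \<Rightarrow> ennreal"
  assumes [measurable]: "f \<in> borel_measurable borel"
  shows "(\<integral>\<^sup>+u. (\<integral>\<^sup>+m. f (real_of_int m + u) \<partial>count_space UNIV) * indicator {0..<1} u \<partial>lborel) = (\<integral>\<^sup>+x. f x \<partial>lborel)"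
proof -
  have "(\<integral>\<^sup>+x. f x \<partial>lborel) = (\<integral>\<^sup>+x. (\<integral>\<^sup>+m. f x * indicator {real_of_int m..<real_of_int m + 1} x \<partial>count_space UNIV) \<partial>lborel)"
  proof (rule nn_integral_cong)
    fix x :: real
    have eq: "indicator {real_of_int m..<real_of_int m + 1} x = (indicator {\<lfloor>x\<rfloor>} m :: ennreal)" for m
    proof -
      have "x \<in> {real_of_int m..<real_of_int m + 1} \<longleftrightarrow> m = \<lfloor>x\<rfloor>"
        using floor_eq_iff[of x m] by auto
      then show ?thesis by (auto simp: indicator_def)
    qed
    show "f x = (\<integral>\<^sup>+m. f x * indicator {real_of_int m..<real_of_int m + 1} x \<partial>count_space UNIV)"
      unfolding eq by (subst nn_integral_indicator_finite) auto
  qed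
  also have "\<dots> = (\<integral>\<^sup>+m. (\<integral>\<^sup>+x. f x * indicator {real_of_int m..<real_of_int m + 1} x \<partial>lborel) \<partial>count_space UNIV)"
    by (rule nn_integral_count_space_nn_integral) auto
  also have "\<dots> = (\<integral>\<^sup>+m. (\<integral>\<^sup>+u. f (real_of_int m + u) * indicator {0..<1} u \<partial>lborel) \<partial>count_space UNIV)"
  proof (rule nn_integral_cong)
    fix m :: int
    have "(\<integral>\<^sup>+x. f x * indicator {real_of_int m..<real_of_int m + 1} x \<partial>lborel) =
      (\<integral>\<^sup>+u. f (real_of_int m + 1 * u) * indicator {real_of_int m..<real_of_int m + 1} (real_of_int m + 1 * u) \<partial>lborel)"
      by (subst nn_integral_real_affine[of _ 1 "real_of_int m"]) auto
    also have "\<dots> = (\<integral>\<^sup>+u. f (real_of_int m + u) * indicator {0..<1} u \<partial>lborel)"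
      by (intro nn_integral_cong) (auto simp: indicator_def)
    finally show "(\<integral>\<^sup>+x. f x * indicator {real_of_int m..<real_of_int m + 1} x \<partial>lborel) =
      (\<integral>\<^sup>+u. f (real_of_int m + u) * indicator {0..<1} u \<partial>lborel)" .
  qed
  also have "\<dots> = (\<integral>\<^sup>+u. (\<integral>\<^sup>+m. f (real_of_int m + u) * indicator {0..<1} u \<partial>count_space UNIV) \<partial>lborel)"
    by (rule nn_integral_count_space_nn_integral[symmetric]) auto
  also have "\<dots> = (\<integral>\<^sup>+u. (\<integral>\<^sup>+m. f (real_of_int m + u) \<partial>count_space UNIV) * indicator {0..<1} u \<partial>lborel)"
    by (subst nn_integral_multc) auto
  finally show ?thesis by simp
qed

lemma bij_betw_div_mod_int:
  fixes a :: int
  assumes a: "a \<noteq> 0"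
  shows "bij_betw (\<lambda>(r, m). a * m + r) ({0..<\<bar>a\<bar>} \<times> UNIV) UNIV"
proof (rule bij_betwI[of _ _ _ "\<lambda>n. (n mod \<bar>a\<bar>, sgn a * (n div \<bar>a\<bar>))"], goal_cases)
  case (3 x)
  obtain r m where x: "x = (r, m)" "0 \<le> r" "r < \<bar>a\<bar>" using 3 by auto
  have "\<bar>a\<bar> * sgn a = a" by (simp add: sgn_if abs_if)
  then have *: "a * m + r = r + \<bar>a\<bar> * (sgn a * m)" by (simp flip: mult.assoc)
  have "(a * m + r) mod \<bar>a\<bar> = r" unfolding * using x by simp
  moreover have "(a * m + r) div \<bar>a\<bar> = sgn a * m" unfolding * using x a by simp
  moreover have "sgn a * (sgn a * m) = m" using a by (simp add: sgn_if)
  ultimately show ?case by (simp add: x)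
next
  case (4 n)
  have "a * (sgn a * (n div \<bar>a\<bar>)) = \<bar>a\<bar> * (n div \<bar>a\<bar>)" by (simp add: sgn_if abs_if)
  then have "a * (sgn a * (n div \<bar>a\<bar>)) + n mod \<bar>a\<bar> = n" by (simp only: mult_div_mod_eq)
  then show ?case by simp
qed (use a in auto)

text \<open>
  A periodic function has the same mean along \<open>u \<mapsto> a u + x\<close> as along \<open>u \<mapsto> u\<close>: the fibres of
  multiplication by \<open>a\<close> on the circle are the residue classes modulo \<open>a\<close>.
\<close>
lemma nn_integral_periodise_affine:
  fixes f :: "real \<Rightarrow> ennreal" and a :: int
  assumes [measurable]: "f \<in> borel_measurable borel" and a: "a \<noteq> 0"
  shows "(\<integral>\<^sup>+u. (\<integral>\<^sup>+m. f (real_of_int m + (of_int a * u + x)) \<partial>count_space UNIV) * indicator {0..<1} u \<partial>lborel)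
       = (\<integral>\<^sup>+x. f x \<partial>lborel)"
proof -
  have split: "(\<integral>\<^sup>+n. F n \<partial>count_space UNIV) = (\<Sum>r\<in>{0..<\<bar>a\<bar>}. \<integral>\<^sup>+m. F (a * m + r) \<partial>count_space UNIV)" for F :: "int \<Rightarrow> ennreal"
  proof -
    have "(\<integral>\<^sup>+n. F n \<partial>count_space UNIV) = (\<integral>\<^sup>+p. F (a * snd p + fst p) \<partial>count_space ({0..<\<bar>a\<bar>} \<times> UNIV))"
      using nn_integral_bij_count_space[OF bij_betw_div_mod_int[OF a], of F] by (simp add: case_prod_unfold)
    also have "\<dots> = (\<integral>\<^sup>+p. F (a * snd p + fst p) \<partial>(count_space {0..<\<bar>a\<bar>} \<Otimes>\<^sub>M count_space UNIV))"
      by (subst pair_measure_countable) auto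
    also have "\<dots> = (\<integral>\<^sup>+r. \<integral>\<^sup>+m. F (a * m + r) \<partial>count_space UNIV \<partial>count_space {0..<\<bar>a\<bar>})"
    proof -
      interpret sigma_finite_measure "count_space (UNIV :: int set)"
        by (rule sigma_finite_measure_count_space_countable) auto
      have "(\<lambda>p. F (a * snd p + fst p)) \<in> borel_measurable (count_space {0..<\<bar>a\<bar>} \<Otimes>\<^sub>M count_space UNIV)"
        by (simp add: pair_measure_countable)
      from nn_integral_fst[OF this] show ?thesis by simp
    qed
    finally show ?thesis by (simp add: nn_integral_count_space_finite)
  qed
  have "(\<integral>\<^sup>+u. (\<integral>\<^sup>+n. f (real_of_int n + (of_int a * u + x)) \<partial>count_space UNIV) * indicator {0..<1} u \<partial>lborel) =
    (\<Sum>r\<in>{0..<\<bar>a\<bar>}. \<integral>\<^sup>+u. (\<integral>\<^sup>+m. f (real_of_int (a * m + r) + (of_int a * u + x)) \<partial>count_space UNIV) * indicator {0..<1} u \<partial>lborel)"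
    unfolding split[of "\<lambda>n. f (real_of_int n + (of_int a * u + x))" for u] sum_distrib_right
    by (subst nn_integral_sum) (auto intro!: borel_measurable_times_ennreal measurable_nn_integral_count_space)
  also have "\<dots> = (\<Sum>r\<in>{0..<\<bar>a\<bar>}. \<integral>\<^sup>+y. f ((real_of_int r + x) + of_int a * y) \<partial>lborel)"
  proof (rule sum.cong[OF refl])
    fix r
    show "(\<integral>\<^sup>+u. (\<integral>\<^sup>+m. f (real_of_int (a * m + r) + (of_int a * u + x)) \<partial>count_space UNIV) * indicator {0..<1} u \<partial>lborel)
      = (\<integral>\<^sup>+y. f ((real_of_int r + x) + of_int a * y) \<partial>lborel)"
      by (subst nn_integral_periodise[symmetric]) (simp_all add: algebra_simps)
  qed
  also have "\<dots> = ennreal \<bar>of_int a\<bar> * (\<integral>\<^sup>+y. f (0 + of_int a * y) \<partial>lborel)"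
  proof -
    have "(\<integral>\<^sup>+y. f (c + of_int a * y) \<partial>lborel) = (\<integral>\<^sup>+y. f (0 + of_int a * y) \<partial>lborel)" for c
    proof -
      have "(\<integral>\<^sup>+y. f (0 + of_int a * y) \<partial>lborel) = ennreal \<bar>1\<bar> * (\<integral>\<^sup>+y. f (0 + of_int a * (c / of_int a + 1 * y)) \<partial>lborel)"
        by (rule nn_integral_real_affine) auto
      then show ?thesis using a by (simp add: distrib_left)
    qed
    then have "(\<Sum>r\<in>{0..<\<bar>a\<bar>}. \<integral>\<^sup>+y. f ((real_of_int r + x) + of_int a * y) \<partial>lborel)
       = of_nat (nat \<bar>a\<bar>) * (\<integral>\<^sup>+y. f (0 + of_int a * y) \<partial>lborel)" by simp
    also have "(of_nat (nat \<bar>a\<bar>) :: ennreal) = ennreal \<bar>of_int a\<bar>"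
      by (simp add: ennreal_of_nat_eq_real_of_nat)
    finally show ?thesis .
  qed
  also have "\<dots> = (\<integral>\<^sup>+x. f x \<partial>lborel)"
    by (rule nn_integral_real_affine[symmetric]) (use a in auto)
  finally show ?thesis .
qed

lemma nn_integral_gauss:
  assumes "t > 0"
  shows "(\<integral>\<^sup>+x. ennreal (exp (- (pi * t * x\<^sup>2))) \<partial>lborel) = ennreal (1 / sqrt t)"
proof -
  define \<sigma> where "\<sigma> = 1 / sqrt (2 * pi * t)"
  have \<sigma>: "\<sigma>\<^sup>2 = 1 / (2 * pi * t)" "\<sigma> > 0" using assms by (auto simp: \<sigma>_def power_divide)
  have eq: "exp (- (pi * t * x\<^sup>2)) = 1 / sqrt t * normal_density 0 \<sigma> x" for x
  proof -
    have "sqrt (2 * pi * \<sigma>\<^sup>2) = 1 / sqrt t" using assms by (simp add: \<sigma> real_sqrt_divide)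
    moreover have "- (x\<^sup>2 / (2 * \<sigma>\<^sup>2)) = - (pi * t * x\<^sup>2)" using assms by (simp add: \<sigma>)
    ultimately show ?thesis using assms by (simp add: normal_density_def)
  qed
  have "(\<integral>\<^sup>+x. ennreal (exp (- (pi * t * x\<^sup>2))) \<partial>lborel) = ennreal (\<integral>x. exp (- (pi * t * x\<^sup>2)) \<partial>lborel)"
    unfolding eq using \<sigma> assms by (intro nn_integral_eq_integral) (auto intro!: AE_I2 divide_nonneg_pos)
  also have "(\<integral>x. exp (- (pi * t * x\<^sup>2)) \<partial>lborel) = 1 / sqrt t"
    unfolding eq using \<sigma> by simp
  finally show ?thesis .
qed

lemma nn_gauss:
  assumes "t > 0"
  shows "(\<integral>\<^sup>+m. ennreal (exp (- (pi * t * (real_of_int m + x)\<^sup>2))) \<partial>count_space UNIV) = ennreal (gauss t x)"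
  unfolding gauss_def using assms
  by (intro nn_integral_eq_integral integrable_gauss) auto

lemma gauss_measurable [measurable]: "gauss t \<in> borel_measurable borel"
  unfolding gauss_def[abs_def] by (rule measurable_integral_count_space) auto

lemma nn_integral_gauss_mean:
  assumes "t > 0" "a \<noteq> 0"
  shows "(\<integral>\<^sup>+u. ennreal (gauss t (of_int a * u + x)) * indicator {0..<1} u \<partial>lborel) = ennreal (1 / sqrt t)"
  using nn_integral_periodise_affine[of "\<lambda>x. ennreal (exp (- (pi * t * x\<^sup>2)))" a x] assms
  by (simp add: nn_integral_gauss nn_gauss)

section \<open>Gaussian sums are nearly constant\<close>

lemma periodic_higher_deriv:
  assumes f: "f holomorphic_on UNIV" and per: "\<And>z. f (z + 1) = f z"
  shows "(deriv ^^ k) f (z + 1) = (deriv ^^ k) f z"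
proof (induction k arbitrary: z)
  case (Suc k)
  let ?g = "(deriv ^^ k) f"
  have "?g holomorphic_on UNIV" by (rule holomorphic_higher_deriv[OF f]) auto
  then have d: "(?g has_field_derivative deriv ?g w) (at w)" for w
    by (simp add: holomorphic_derivI)
  have "((\<lambda>z. ?g (z + 1)) has_field_derivative deriv ?g (z + 1)) (at z)"
    using d[of "z + 1"] by (simp add: DERIV_shift)
  then have "(?g has_field_derivative deriv ?g (z + 1)) (at z)" by (simp add: Suc)
  then show ?case using d[of z] DERIV_unique by auto
qed (simp add: per)

text \<open>
  The derivative of a periodic function vanishes somewhere in each period, so it is bounded
  by the supremum of the next derivative.  Iterating, the oscillation of a periodic function is
  bounded by the supremum of any of its derivatives.
\<close>
lemma periodic_oscillation_le_higher_deriv: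
  fixes D :: "nat \<Rightarrow> real \<Rightarrow> real"
  assumes der: "\<And>j x. (D j has_real_derivative D (Suc j) x) (at x)"
    and per: "\<And>j x n. D j (x + of_int n) = D j x"
    and k: "k \<ge> 1" and bd: "\<And>x. \<bar>D k x\<bar> \<le> B"
  shows "\<bar>D 0 x - D 0 y\<bar> \<le> B"
proof -
  have frac: "D j x = D j (frac x)" for j x
    using per[of j "frac x" "\<lfloor>x\<rfloor>"] by (simp add: frac_def)
  have lip: "\<bar>D j x - D j y\<bar> \<le> C" if C: "\<And>z. \<bar>D (Suc j) z\<bar> \<le> C" and xy: "x \<in> {0..1}" "y \<in> {0..1}" for j x y C
  proof -
    have "norm (D j x - D j y) \<le> C * norm (x - y)"
      by (rule field_differentiable_bound[of "{0..1}" "D j" "D (Suc j)"])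
         (use C xy der in \<open>auto intro: has_field_derivative_at_within\<close>)
    also have "\<dots> \<le> C * 1" using xy order.trans[OF abs_ge_zero C]
      by (intro mult_left_mono) auto
    finally show ?thesis by simp
  qed
  have "\<bar>D 1 z\<bar> \<le> B" for z
    using k bd
  proof (induction k rule: dec_induct)
    case (step j)
    show ?case
    proof (rule step.IH)
      fix x
      obtain i where j: "j = Suc i" using step.hyps by (cases j) auto
      have "\<exists>\<xi>. 0 < \<xi> \<and> \<xi> < 1 \<and> D j \<xi> = 0"
      proof -
        have "D i 1 = D i 0" using per[of i 0 1] by simp
        moreover have "continuous_on {0..1} (D i)"
          using der by (intro DERIV_continuous_on[where D = "D (Suc i)"]) (auto intro: has_field_derivative_at_within)
        ultimately obtain \<xi> where "0 < \<xi>" "\<xi> < 1" "(\<lambda>v. D j \<xi> * v) = (\<lambda>v. 0)"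
          using Rolle_deriv[of 0 1 "D i" "\<lambda>x v. D j x * v"] der[of i]
          by (auto simp: j has_field_derivative_def)
        then show ?thesis by (metis mult_1_right)
      qed
      then obtain \<xi> where \<xi>: "0 < \<xi>" "\<xi> < 1" "D j \<xi> = 0" by blast
      have "\<bar>D j (frac x) - D j \<xi>\<bar> \<le> B"
        by (rule lip) (use step.prems \<xi> frac_lt_1[of x] in \<open>auto intro: less_imp_le\<close>)
      then show "\<bar>D j x\<bar> \<le> B" using \<xi> frac by simp
    qed
  qed auto
  then have "\<bar>D 0 (frac x) - D 0 (frac y)\<bar> \<le> B"
    by (intro lip) (auto intro: less_imp_le frac_lt_1)
  then show ?thesis by (simp flip: frac)
qed

lemma gauss_bounded:
  assumes "t > 0"
  shows "bdd_above (range (gauss t))"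
proof -
  have "gauss t x \<le> (\<integral>m. exp (pi * t * 1\<^sup>2) * exp (- (pi * t / 2) * (real_of_int m)\<^sup>2) \<partial>count_space UNIV)" for x
  proof -
    have "gauss t x = gauss t (frac x)"
      using gauss_periodic[of t "frac x" "\<lfloor>x\<rfloor>"] by (simp add: frac_def)
    also have "\<dots> \<le> (\<integral>m. exp (pi * t * 1\<^sup>2) * exp (- (pi * t / 2) * (real_of_int m)\<^sup>2) \<partial>count_space UNIV)"
      unfolding gauss_def using assms
      by (intro integral_mono integrable_gauss integrable_mult_right integrable_gauss_int gauss_term_le)
         (auto intro: less_imp_le frac_lt_1)
    finally show ?thesis .
  qed
  then show ?thesis by (intro bdd_aboveI2)
qed

text \<open>
  On the circle of radius \<open>1 / sqrt t\<close> around a real point the sum exceeds its real supremum by at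
  most the factor \<open>e\<^sup>\<pi>\<close>, so Cauchy's inequality bounds the \<open>k\<close>-th derivative there.
\<close>
lemma gauss_oscillation:
  assumes t: "t > 0" and k: "k \<ge> 1" and S: "\<And>x. gauss t x \<le> S"
  shows "\<bar>gauss t x - gauss t y\<bar> \<le> fact k * exp pi * S * sqrt t ^ k"
proof -
  let ?F = "gauss_sum t"
  define D where "D j x = Re ((deriv ^^ j) ?F (of_real x))" for j x
  have D0: "D 0 = gauss t" by (simp add: D_def gauss_sum_of_real fun_eq_iff)
  have hol: "(deriv ^^ j) ?F holomorphic_on UNIV" for j
    by (rule holomorphic_higher_deriv[OF gauss_sum_holomorphic[OF t]]) auto
  have "\<bar>D 0 x - D 0 y\<bar> \<le> fact k * exp pi * S * sqrt t ^ k"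
  proof (rule periodic_oscillation_le_higher_deriv[where D = D, OF _ _ k])
    fix j x
    have "((deriv ^^ j) ?F has_field_derivative (deriv ^^ Suc j) ?F (of_real x)) (at (of_real x))"
      using holomorphic_derivI[OF hol open_UNIV] by simp
    from bounded_linear.has_vector_derivative[OF bounded_linear_Re has_vector_derivative_real_field[OF this]]
    show "(D j has_real_derivative D (Suc j) x) (at x)"
      by (simp only: D_def[abs_def] has_real_derivative_iff_has_vector_derivative)
  next
    fix j x n
    interpret periodic_fun_simple' "(deriv ^^ j) ?F"
      by standard (intro periodic_higher_deriv gauss_sum_holomorphic t gauss_sum_plus_1)
    show "D j (x + of_int n) = D j x"
      using plus_of_int[of "of_real x" n] by (simp add: D_def add.commute)
  next
    fix x
    define r where "r = 1 / sqrt t"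
    have r: "r > 0" "pi * t * r\<^sup>2 = pi" using t by (auto simp: r_def power_divide)
    have "norm ((deriv ^^ k) ?F (of_real x)) \<le> fact k * (exp pi * S) / r ^ k"
    proof (rule Cauchy_inequality)
      fix z :: complex assume z: "norm (of_real x - z) = r"
      have "\<bar>Im z\<bar> \<le> r" using abs_Im_le_cmod[of "of_real x - z"] z by simp
      then have "(Im z)\<^sup>2 \<le> r\<^sup>2" using r power2_le_iff_abs_le[of r "Im z"] by simp
      then have "pi * t * (Im z)\<^sup>2 \<le> pi * t * r\<^sup>2" using t by (intro mult_left_mono) auto
      then have "exp (pi * t * (Im z)\<^sup>2) \<le> exp pi" using r by simp
      then have "exp (pi * t * (Im z)\<^sup>2) * gauss t (Re z) \<le> exp pi * S"
        using S gauss_nonneg by (intro mult_mono) auto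
      then show "norm (?F z) \<le> exp pi * S" using norm_gauss_sum_le[OF t, of z] by linarith
    qed (use r t in \<open>auto intro: gauss_sum_holomorphic holomorphic_on_imp_continuous_on\<close>)
    also have "\<dots> = fact k * exp pi * S * sqrt t ^ k" by (simp add: r_def power_divide)
    finally show "\<bar>D k x\<bar> \<le> fact k * exp pi * S * sqrt t ^ k"
      unfolding D_def using abs_Re_le_cmod order.trans by blast
  qed
  then show ?thesis by (simp add: D0)
qed

lemma gauss_minus_mean_le:
  assumes t: "t > 0" and B: "\<And>x y. \<bar>gauss t x - gauss t y\<bar> \<le> B"
  shows "\<bar>gauss t x - 1 / sqrt t\<bar> \<le> B"
proof -
  have mean: "(\<integral>\<^sup>+u. ennreal (gauss t u) * indicator {0..<1} u \<partial>lborel) = ennreal (1 / sqrt t)"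
    using nn_integral_gauss_mean[OF t, of 1 0] by simp
  have c: "(\<integral>\<^sup>+u. ennreal C * indicator {0..<1} u \<partial>(lborel :: real measure)) = ennreal C" for C
    by (subst nn_integral_cmult_indicator) auto
  have "B \<ge> 0" using B[of 0 0] by simp
  have "ennreal (1 / sqrt t) = (\<integral>\<^sup>+u. ennreal (gauss t u) * indicator {0..<1} u \<partial>lborel)"
    by (rule mean[symmetric])
  also have "\<dots> \<le> (\<integral>\<^sup>+u. ennreal (gauss t x + B) * indicator {0..<1} u \<partial>(lborel :: real measure))"
  proof (intro nn_integral_mono mult_right_mono ennreal_leI)
    fix u show "gauss t u \<le> gauss t x + B" using B[of u x] by linarith
  qed auto
  also have "\<dots> = ennreal (gauss t x + B)" by (rule c)
  finally have "ennreal (1 / sqrt t) \<le> ennreal (gauss t x + B)" .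
  then have 1: "1 / sqrt t \<le> gauss t x + B"
    using gauss_nonneg[of t x] \<open>B \<ge> 0\<close> by (subst (asm) ennreal_le_iff) auto
  have "ennreal (gauss t x - B) = (\<integral>\<^sup>+u. ennreal (gauss t x - B) * indicator {0..<1} u \<partial>(lborel :: real measure))"
    by (rule c[symmetric])
  also have "\<dots> \<le> (\<integral>\<^sup>+u. ennreal (gauss t u) * indicator {0..<1} u \<partial>lborel)"
  proof (intro nn_integral_mono mult_right_mono ennreal_leI)
    fix u show "gauss t x - B \<le> gauss t u" using B[of u x] by linarith
  qed auto
  also have "\<dots> = ennreal (1 / sqrt t)" by (rule mean)
  finally have "ennreal (gauss t x - B) \<le> ennreal (1 / sqrt t)" .
  then have 2: "gauss t x - B \<le> 1 / sqrt t" using t by (simp add: ennreal_le_iff2)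
  show ?thesis using 1 2 by linarith
qed

text \<open>
  For small \<open>t\<close> the oscillation bound is a fraction of the supremum, which makes the supremum
  comparable to the mean.  For large \<open>t\<close> the sum is bounded because it decreases in \<open>t\<close>.
\<close>
lemma gauss_approx:
  assumes t: "t > 0" and k: "k \<ge> 1"
  shows "\<bar>sqrt t * gauss t x - 1\<bar> \<le> 6 * (fact k * exp pi) * sqrt t ^ k"
proof -
  define \<kappa> where "\<kappa> = fact k * exp pi"
  have "(1::real) * 1 \<le> \<kappa>" unfolding \<kappa>_def by (intro mult_mono) auto
  then have \<kappa>: "\<kappa> \<ge> 1" by simp
  have small: "gauss s x \<le> 2 / sqrt s \<and> \<bar>sqrt s * gauss s x - 1\<bar> \<le> 2 * \<kappa> * sqrt s ^ k"
    if s: "s > 0" and le: "\<kappa> * sqrt s ^ k \<le> 1 / 2" for s x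
  proof -
    define S where "S = (SUP x. gauss s x)"
    have S: "gauss s x \<le> S" for x
      unfolding S_def by (rule cSUP_upper[OF UNIV_I gauss_bounded[OF s]])
    have "S \<ge> 0" using S[of 0] gauss_nonneg[of s 0] by linarith
    have osc: "\<bar>gauss s x - 1 / sqrt s\<bar> \<le> \<kappa> * sqrt s ^ k * S" for x
      using gauss_minus_mean_le[OF s gauss_oscillation[OF s k S]] by (simp add: \<kappa>_def mult_ac)
    have "\<kappa> * sqrt s ^ k * S \<le> 1 / 2 * S" using le \<open>S \<ge> 0\<close> by (rule mult_right_mono)
    then have "gauss s x \<le> 1 / sqrt s + S / 2" for x using osc[of x] by linarith
    then have "S \<le> 1 / sqrt s + S / 2" unfolding S_def by (intro cSUP_least) auto
    then have S2: "S \<le> 2 / sqrt s" by simp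
    have "sqrt s * gauss s x - 1 = sqrt s * (gauss s x - 1 / sqrt s)"
      using s by (simp add: right_diff_distrib)
    then have "\<bar>sqrt s * gauss s x - 1\<bar> = sqrt s * \<bar>gauss s x - 1 / sqrt s\<bar>"
      using s by (simp add: abs_mult)
    also have "\<dots> \<le> sqrt s * (\<kappa> * sqrt s ^ k * S)" using osc s by (intro mult_left_mono) auto
    also have "\<dots> \<le> sqrt s * (\<kappa> * sqrt s ^ k * (2 / sqrt s))"
      using S2 s \<kappa> by (intro mult_left_mono) auto
    also have "\<dots> = 2 * \<kappa> * sqrt s ^ k" using s by simp
    finally show ?thesis using S[of x] S2 by linarith
  qed
  show ?thesis
  proof (cases "\<kappa> * sqrt t ^ k \<le> 1 / 2")
    case True
    have "2 * \<kappa> * sqrt t ^ k \<le> 6 * \<kappa> * sqrt t ^ k" using \<kappa> t by (intro mult_right_mono) auto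
    then have "\<bar>sqrt t * gauss t x - 1\<bar> \<le> 6 * \<kappa> * sqrt t ^ k" using small[OF t True, of x] by linarith
    then show ?thesis by (simp add: \<kappa>_def)
  next
    case False
    define r where "r = root k (1 / (2 * \<kappa>))"
    have r: "r > 0" "\<kappa> * r ^ k = 1 / 2" using k \<kappa> by (auto simp: r_def real_root_pow_pos)
    have "r \<le> sqrt t"
    proof (rule ccontr)
      assume "\<not> r \<le> sqrt t"
      then have "sqrt t ^ k \<le> r ^ k" using t by (intro power_mono) auto
      then have "\<kappa> * sqrt t ^ k \<le> \<kappa> * r ^ k" using \<kappa> by (intro mult_left_mono) auto
      then show False using False r by simp
    qed
    then have "r\<^sup>2 \<le> t" using power_mono[of r "sqrt t" 2] r t by simp
    then have "gauss t x \<le> gauss (r\<^sup>2) x" using r by (intro gauss_antimono) auto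
    also have "\<dots> \<le> 2 / sqrt (r\<^sup>2)" using small[of "r\<^sup>2" x] r by simp
    finally have "sqrt t * gauss t x \<le> sqrt t * (2 / r)" using r t by (intro mult_left_mono) auto
    then have "\<bar>sqrt t * gauss t x - 1\<bar> \<le> 1 + 2 * (sqrt t / r)"
    proof -
      have "0 \<le> sqrt t * gauss t x" using t gauss_nonneg by simp
      moreover have "0 \<le> sqrt t / r" using t r by simp
      moreover have "sqrt t * gauss t x \<le> 2 * (sqrt t / r)"
        using \<open>sqrt t * gauss t x \<le> sqrt t * (2 / r)\<close> by (simp add: mult.commute)
      ultimately show ?thesis by linarith
    qed
    also have ge1: "sqrt t / r \<ge> 1" using \<open>r \<le> sqrt t\<close> r by simp
    then have "1 + 2 * (sqrt t / r) \<le> 3 * (sqrt t / r)" by simp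
    also have "\<dots> \<le> 3 * (sqrt t / r) ^ k" using power_increasing[OF k ge1] by simp
    also have "\<dots> = 6 * \<kappa> * sqrt t ^ k" using r \<kappa> by (simp add: power_divide field_simps)
    finally show ?thesis by (simp add: \<kappa>_def)
  qed
qed

section \<open>Rules for Mellin transforms\<close>

definition mellin_integrable :: "(real \<Rightarrow> real) \<Rightarrow> complex \<Rightarrow> bool" where
  "mellin_integrable R s \<longleftrightarrow>
     integrable lborel (\<lambda>t. of_real (indicator {0<..} t * R t) * of_real t powr (s - 1) :: complex)"

lemma mellin_cong:
  assumes "\<And>t. t > 0 \<Longrightarrow> R t = R' t"
  shows "mellin R s = mellin R' s" "mellin_integrable R s = mellin_integrable R' s"
proof -
  have "(\<lambda>t. of_real (indicator {0<..} t * R t) * of_real t powr (s - 1) :: complex) =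
        (\<lambda>t. of_real (indicator {0<..} t * R' t) * of_real t powr (s - 1))"
    using assms by (auto simp: indicator_def fun_eq_iff)
  then show "mellin R s = mellin R' s" "mellin_integrable R s = mellin_integrable R' s"
    by (simp_all add: mellin_def mellin_integrable_def)
qed

lemma mellin_add:
  assumes "mellin_integrable R s" "mellin_integrable R' s"
  shows "mellin (\<lambda>t. R t + R' t) s = mellin R s + mellin R' s"
    and "mellin_integrable (\<lambda>t. R t + R' t) s"
  using assms
  by (simp_all add: mellin_def mellin_integrable_def distrib_left distrib_right
      flip: Bochner_Integration.integral_add)

lemma mellin_cmult:
  assumes "mellin_integrable R s"
  shows "mellin (\<lambda>t. c * R t) s = of_real c * mellin R s"
    and "mellin_integrable (\<lambda>t. c * R t) s"
  using assms
  by (simp_all add: mellin_def mellin_integrable_def mult.left_commute[of _ "complex_of_real c"]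
      mult.assoc integrable_mult_right)

lemma mellin_times_powr:
  "mellin (\<lambda>t. t powr b * R t) s = mellin R (s + of_real b)"
  "mellin_integrable (\<lambda>t. t powr b * R t) s = mellin_integrable R (s + of_real b)"
proof -
  have eq: "of_real (indicator {0<..} t * (t powr b * R t)) * of_real t powr (s - 1) =
        of_real (indicator {0<..} t * R t) * (of_real t powr (s + of_real b - 1) :: complex)" for t
  proof (cases "t > 0")
    case True
    then have "of_real (t powr b) * of_real t powr (s - 1) = (of_real t powr (s + of_real b - 1) :: complex)"
      by (simp add: powr_of_real powr_add[symmetric] algebra_simps flip: powr_of_real)
    then show ?thesis by (simp add: mult_ac)
  qed auto
  show "mellin (\<lambda>t. t powr b * R t) s = mellin R (s + of_real b)"
    "mellin_integrable (\<lambda>t. t powr b * R t) s = mellin_integrable R (s + of_real b)"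
    unfolding mellin_def mellin_integrable_def eq by simp_all
qed

lemma mellin_scale:
  assumes c: "c > 0"
  shows "mellin (\<lambda>t. R (c * t)) s = of_real c powr (- s) * mellin R s"
    and "mellin_integrable (\<lambda>t. R (c * t)) s = mellin_integrable R s"
proof -
  let ?f = "\<lambda>t. of_real (indicator {0<..} t * R t) * (of_real t powr (s - 1) :: complex)"
  have eq: "?f (0 + c * t) = of_real c powr (s - 1) *
      (of_real (indicator {0<..} t * R (c * t)) * of_real t powr (s - 1))" for t
    using c by (auto simp: indicator_def powr_times_real zero_less_mult_iff)
  have "integrable lborel ?f \<longleftrightarrow> integrable lborel (\<lambda>t. ?f (0 + c * t))"
    using lborel_integrable_real_affine_iff[of c ?f 0] c by simp
  then show "mellin_integrable (\<lambda>t. R (c * t)) s = mellin_integrable R s"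
    unfolding eq mellin_integrable_def
    using c integrable_mult_right[of "1 / of_real c powr (s - 1)" lborel
        "\<lambda>t. of_real c powr (s - 1) * (of_real (indicator {0<..} t * R (c * t)) * of_real t powr (s - 1))"]
    by (auto intro: integrable_mult_right)
  have "mellin R s = c *\<^sub>R (\<integral>t. ?f (0 + c * t) \<partial>lborel)"
    unfolding mellin_def using lborel_integral_real_affine[of c ?f 0] c by simp
  also have "\<dots> = of_real c * (of_real c powr (s - 1) * mellin (\<lambda>t. R (c * t)) s)"
    unfolding eq mellin_def by (simp add: scaleR_conv_of_real)
  also have "\<dots> = of_real c powr s * mellin (\<lambda>t. R (c * t)) s"
    using c by (simp add: powr_diff)
  finally show "mellin (\<lambda>t. R (c * t)) s = of_real c powr (- s) * mellin R s"
    using c by (simp add: powr_minus field_simps)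
qed

lemma mellin_integrable_rapid:
  assumes "rapid R"
  shows "mellin_integrable R s"
  unfolding mellin_integrable_def
proof (rule Bochner_Integration.integrable_bound[OF rapid_integrable[OF assms, of "Re s - 1"]])
  have [measurable]: "R \<in> borel_measurable borel" using assms by (auto simp: rapid_def)
  show "(\<lambda>t. of_real (indicator {0<..} t * R t) * of_real t powr (s - 1) :: complex) \<in> borel_measurable lborel"
    by measurable
  show "AE t in lborel. norm (of_real (indicator {0<..} t * R t) * of_real t powr (s - 1) :: complex)
     \<le> norm (indicator {0<..} t * (\<bar>R t\<bar> * t powr (Re s - 1)))"
    by (auto intro!: AE_I2 simp: indicator_def norm_mult norm_of_real_powr)
qed

lemma mellin_unit_interval:
  assumes s: "Re s > 0"
  shows "mellin (indicator {..1}) s = 1 / s"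
    and "mellin_integrable (indicator {..1}) s"
proof -
  let ?f = "\<lambda>t. complex_of_real t powr (s - 1)"
  have eq: "of_real (indicator {0<..} t * indicator {..1} t) * ?f t = indicator {0..1} t *\<^sub>R ?f t" for t
    by (auto simp: indicator_def)
  have "((\<lambda>t. t powr (Re s - 1)) has_integral 1 / Re s) {0..1}"
    using has_integral_powr_from_0[of "Re s - 1" 1] s by simp
  then have "(\<lambda>t. t powr (Re s - 1)) absolutely_integrable_on {0..1}"
    by (intro nonnegative_absolutely_integrable_1) (auto simp: integrable_on_def)
  then have "integrable lborel (\<lambda>t. indicator {0..1} t *\<^sub>R (t powr (Re s - 1)))"
    unfolding set_integrable_def by (subst (asm) integrable_completion) auto
  then have int: "integrable lborel (\<lambda>t. indicator {0..1} t *\<^sub>R ?f t)"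
  proof (rule Bochner_Integration.integrable_bound)
    show "AE t in lborel. norm (indicator {0..1} t *\<^sub>R ?f t) \<le> norm (indicator {0..1} t *\<^sub>R (t powr (Re s - 1)))"
    proof (intro AE_I2)
      fix t show "norm (indicator {0..1} t *\<^sub>R ?f t) \<le> norm (indicator {0..1} t *\<^sub>R (t powr (Re s - 1)))"
        by (cases "t > 0") (auto simp: indicator_def norm_of_real_powr)
    qed
  qed measurable
  then show "mellin_integrable (indicator {..1}) s"
    unfolding mellin_integrable_def eq .
  \<comment> \<open>The antiderivative extends continuously to \<open>0\<close> because the real part of \<open>s\<close> is positive.\<close>
  have cont: "continuous_on {0..1} (\<lambda>t. complex_of_real t powr s / s)"
  proof (intro continuous_at_imp_continuous_on ballI)
    fix x :: real assume "x \<in> {0..1}"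
    show "isCont (\<lambda>t. complex_of_real t powr s / s) x"
    proof (cases "x = 0")
      case True
      have "((\<lambda>t. \<bar>t\<bar> powr Re s * exp (pi * \<bar>Im s\<bar>)) \<longlongrightarrow> 0 * exp (pi * \<bar>Im s\<bar>)) (at 0)"
        using s by (intro tendsto_intros tendsto_zero_powrI[where b = "Re s"]) (auto intro!: tendsto_eq_intros)
      then have "((\<lambda>t. \<bar>t\<bar> powr Re s * exp (pi * \<bar>Im s\<bar>)) \<longlongrightarrow> 0) (at 0)" by simp
      then have "((\<lambda>t. complex_of_real t powr s) \<longlongrightarrow> 0) (at 0)"
      proof (rule Lim_null_comparison[rotated], intro always_eventually allI)
        fix t :: real
        show "norm (complex_of_real t powr s) \<le> \<bar>t\<bar> powr Re s * exp (pi * \<bar>Im s\<bar>)"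
        proof (cases "t = 0")
          case False
          have "- (Im s * Im (Ln (complex_of_real t))) \<le> \<bar>Im s\<bar> * \<bar>Im (Ln (complex_of_real t))\<bar>"
            by (metis abs_ge_minus_self abs_mult)
          also have "\<dots> \<le> \<bar>Im s\<bar> * pi"
            using mpi_less_Im_Ln[of "of_real t"] Im_Ln_le_pi[of "of_real t"] False
            by (intro mult_left_mono) auto
          finally show ?thesis using False
            by (simp add: powr_def norm_exp_eq_Re algebra_simps flip: exp_add)
        qed simp
      qed
      moreover have "s \<noteq> 0" using s by auto
      ultimately have "((\<lambda>t. complex_of_real t powr s / s) \<longlongrightarrow> 0 / s) (at 0)"
        by (intro tendsto_divide tendsto_const)
      then show ?thesis using True by (simp add: isCont_def)
    next
      case False
      with \<open>x \<in> {0..1}\<close> have "complex_of_real x \<notin> \<real>\<^sub>\<le>\<^sub>0" by auto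
      then show ?thesis using s by (intro continuous_intros) auto
    qed
  qed
  have "(?f has_integral (complex_of_real 1 powr s / s - complex_of_real 0 powr s / s)) {0..1}"
  proof (rule fundamental_theorem_of_calculus_interior[OF _ cont])
    fix x :: real assume "x \<in> {0<..<1}"
    then have "((\<lambda>z. z powr s / s) has_field_derivative ?f x) (at (of_real x))"
      using s by (auto intro!: derivative_eq_intros)
    then show "((\<lambda>t. complex_of_real t powr s / s) has_vector_derivative ?f x) (at x)"
      by (rule has_vector_derivative_real_field)
  qed auto
  then have "integral {0..1} ?f = 1 / s" by (simp add: integral_unique)
  moreover have "mellin (indicator {..1}) s = integral {0..1} ?f"
    unfolding mellin_def eq
    using set_borel_integral_eq_integral(2)[of "{0..1}" ?f] int
    by (simp add: set_integrable_def set_lebesgue_integral_def)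
  ultimately show "mellin (indicator {..1}) s = 1 / s" by simp
qed

lemma mellin_exp:
  assumes s: "Re s > 0"
  shows "mellin (\<lambda>t. exp (- t)) s = Gamma s"
    and "mellin_integrable (\<lambda>t. exp (- t)) s"
proof -
  let ?f = "\<lambda>t. complex_of_real t powr (s - 1) / of_real (exp t)"
  have eq: "of_real (indicator {0<..} t * exp (- t)) * complex_of_real t powr (s - 1) = indicator {0<..} t *\<^sub>R ?f t" for t
    by (auto simp: indicator_def exp_minus field_simps)
  have "?f absolutely_integrable_on {0<..}" by (rule absolutely_integrable_Gamma_integral'[OF s])
  then have int: "integrable lborel (\<lambda>t. indicator {0<..} t *\<^sub>R ?f t)"
    unfolding set_integrable_def by (subst (asm) integrable_completion) auto
  then show "mellin_integrable (\<lambda>t. exp (- t)) s"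
    unfolding mellin_integrable_def eq .
  show "mellin (\<lambda>t. exp (- t)) s = Gamma s"
    unfolding mellin_def eq
    using set_borel_integral_eq_integral(2)[of "{0<..}" ?f] int Gamma_integral_complex'[OF s]
    by (simp add: set_integrable_def set_lebesgue_integral_def integral_unique)
qed

section \<open>Completed Dirichlet series\<close>

text \<open>
  What remains of \<open>T\<close> after its leading terms \<open>C t\<^sup>-\<^sup>p\<close> at \<open>0\<close> and \<open>1\<close> at infinity are removed.
  For theta series it decays rapidly at both ends.
\<close>
definition remainder :: "real \<Rightarrow> real \<Rightarrow> (real \<Rightarrow> real) \<Rightarrow> real \<Rightarrow> real" where
  "remainder C p T t = T t - (if t \<le> 1 then C * t powr (- p) else 1)"

text \<open>
  The meromorphic continuation of the Mellin transform of \<open>T - 1\<close>, in which the two leading terms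
  of \<open>T\<close> are integrated by hand.
\<close>
definition completed :: "real \<Rightarrow> real \<Rightarrow> (real \<Rightarrow> real) \<Rightarrow> complex \<Rightarrow> complex" where
  "completed C p T s = mellin (remainder C p T) s + of_real C / (s - of_real p) - 1 / s"

lemma completed_analytic:
  assumes "rapid (remainder C p T)"
  shows "completed C p T analytic_on - {0, of_real p}"
proof -
  have "mellin (remainder C p T) analytic_on - {0, of_real p}"
    using mellin_holomorphic[OF assms, of UNIV] analytic_on_subset[of _ UNIV]
    by (simp add: analytic_on_open)
  then have "(\<lambda>s. mellin (remainder C p T) s + of_real C / (s - of_real p) - 1 / s) analytic_on - {0, of_real p}"
    by (intro analytic_intros) auto
  then show ?thesis by (simp add: completed_def[abs_def])
qed

lemma completed_meromorphic:
  assumes "rapid (remainder C p T)"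
  shows "completed C p T meromorphic_on UNIV"
proof -
  have "mellin (remainder C p T) meromorphic_on UNIV"
    using mellin_holomorphic[OF assms, of UNIV]
    by (intro analytic_on_imp_meromorphic_on) (simp add: analytic_on_open)
  then have "(\<lambda>s. mellin (remainder C p T) s + of_real C / (s - of_real p) - 1 / s) meromorphic_on UNIV"
    by (intro meromorphic_intros) auto
  then show ?thesis by (simp add: completed_def[abs_def])
qed

lemma completed_eq_mellin:
  assumes R: "rapid (remainder C p T)" and s: "Re s > p" "Re s > 0"
  shows "mellin (\<lambda>t. T t - 1) s = completed C p T s"
    and "mellin_integrable (\<lambda>t. T t - 1) s"
proof -
  let ?I = "indicator {..1} :: real \<Rightarrow> real"
  have eq: "T t - 1 = remainder C p T t + (C * (t powr (- p) * ?I t) + (- 1) * ?I t)" if "t > 0" for t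
    by (auto simp: remainder_def)
  note [simp] = mellin_times_powr[of "- p"] mellin_unit_interval
  have i1: "mellin_integrable (\<lambda>t. t powr (- p) * ?I t) s" using s by simp
  note i2 = mellin_integrable_rapid[OF R, of s] mellin_cmult(2)[OF i1, of C]
    mellin_cmult(2)[OF mellin_unit_interval(2)[OF s(2)], of "-1"]
  note i3 = mellin_add(2)[OF i2(2,3)]
  show "mellin_integrable (\<lambda>t. T t - 1) s"
    using mellin_add(2)[OF i2(1) i3] mellin_cong(2)[OF eq] by simp
  have "mellin (\<lambda>t. T t - 1) s =
      mellin (\<lambda>t. remainder C p T t + (C * (t powr (- p) * ?I t) + (- 1) * ?I t)) s"
    by (rule mellin_cong(1)[OF eq])
  also have "\<dots> = mellin (remainder C p T) s +
     (of_real C * mellin (\<lambda>t. t powr (- p) * ?I t) s + of_real (- 1) * mellin ?I s)"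
    unfolding mellin_add(1)[OF i2(1) i3] mellin_add(1)[OF i2(2,3)]
    mellin_cmult(1)[OF i1] mellin_cmult(1)[OF mellin_unit_interval(2)[OF s(2)]] ..
  also have "\<dots> = completed C p T s" using s by (simp add: completed_def)
  finally show "mellin (\<lambda>t. T t - 1) s = completed C p T s" .
qed

text \<open>
  Fubini's theorem applies because the bounds hold uniformly in the parameter.
\<close>
lemma mellin_average:
  assumes M: "finite_measure M"
    and meas: "(\<lambda>(u, t). R u t) \<in> borel_measurable (M \<Otimes>\<^sub>M borel)"
    and bd: "\<And>a. \<exists>K. \<forall>u\<in>space M. \<forall>t>0. \<bar>R u t\<bar> \<le> K * t powr a"
  shows "integrable M (\<lambda>u. mellin (R u) s)"
    and "(\<integral>u. mellin (R u) s \<partial>M) = mellin (\<lambda>t. \<integral>u. R u t \<partial>M) s"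
proof -
  interpret M: finite_measure M by (rule M)
  interpret P: pair_sigma_finite M lborel by standard
  let ?f = "\<lambda>u t. complex_of_real (indicator {0<..} t * R u t) * of_real t powr (s - 1)"
  define b where "b = Re s - 1"
  obtain K1 where K1: "\<And>u t. u \<in> space M \<Longrightarrow> t > 0 \<Longrightarrow> \<bar>R u t\<bar> \<le> K1 * t powr (- b)"
    using bd by blast
  obtain K2 where K2: "\<And>u t. u \<in> space M \<Longrightarrow> t > 0 \<Longrightarrow> \<bar>R u t\<bar> \<le> K2 * t powr (- b - 2)"
    using bd by blast
  have majorant: "norm (?f u t) \<le> (K1 + K2) * inverse (1 + t\<^sup>2)" if u: "u \<in> space M" and K: "K1 + K2 \<ge> 0" for u t
  proof (cases "t > 0")
    case True
    have "\<bar>R u t\<bar> * t powr b \<le> (K1 + K2) * inverse (1 + t\<^sup>2)"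
      by (rule two_power_bound[OF True K1[OF u True] K2[OF u True]])
    then show ?thesis using True by (simp add: norm_mult norm_of_real_powr b_def)
  qed (use K in auto)
  have K: "K1 + K2 \<ge> 0" if "u \<in> space M" for u
    using K1[OF that, of 1] K2[OF that, of 1] abs_ge_zero[of "R u 1"] by simp
  note maj = integrable_inverse_1_plus_sq[of "K1 + K2"]
  have int: "integrable lborel (?f u)" if "u \<in> space M" for u
  proof (rule Bochner_Integration.integrable_bound[OF maj])
    have [measurable]: "R u \<in> borel_measurable borel"
      using measurable_Pair2[OF meas that] by simp
    show "?f u \<in> borel_measurable lborel" by measurable
  qed (use that majorant K[OF that] in \<open>auto intro!: AE_I2 order.trans[OF _ abs_ge_self]\<close>)
  note [measurable] = meas
  have pair: "integrable (M \<Otimes>\<^sub>M lborel) (\<lambda>(u, t). ?f u t)"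
  proof (rule P.Fubini_integrable)
    show "integrable M (\<lambda>u. \<integral>t. norm (case (u, t) of (u, t) \<Rightarrow> ?f u t) \<partial>lborel)"
    proof (rule M.integrable_const_bound[where B = "\<integral>t. (K1 + K2) * inverse (1 + t\<^sup>2) \<partial>lborel"], intro AE_I2)
      fix u assume u: "u \<in> space M"
      have "(\<integral>t. norm (?f u t) \<partial>lborel) \<le> (\<integral>t. (K1 + K2) * inverse (1 + t\<^sup>2) \<partial>lborel)"
        by (intro integral_mono integrable_norm int maj majorant u K[OF u])
      then show "norm (\<integral>t. norm (case (u, t) of (u, t) \<Rightarrow> ?f u t) \<partial>lborel) \<le> (\<integral>t. (K1 + K2) * inverse (1 + t\<^sup>2) \<partial>lborel)"
        by (simp only: case_prod_conv real_norm_def)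
           (subst abs_of_nonneg, auto intro!: Bochner_Integration.integral_nonneg)
    qed measurable
  qed (use int in auto)
  show "integrable M (\<lambda>u. mellin (R u) s)"
    unfolding mellin_def using P.integrable_fst[OF pair] by simp
  from P.Fubini_integral[OF pair]
  have "(\<integral>u. mellin (R u) s \<partial>M) = (\<integral>t. (\<integral>u. ?f u t \<partial>M) \<partial>lborel)"
    unfolding mellin_def by simp
  also have "\<dots> = mellin (\<lambda>t. \<integral>u. R u t \<partial>M) s"
    unfolding mellin_def by simp
  finally show "(\<integral>u. mellin (R u) s \<partial>M) = mellin (\<lambda>t. \<integral>u. R u t \<partial>M) s" .
qed

section \<open>Theta series of quadratic forms\<close>

text \<open>
  With values in \<open>[0, \<infinity>]\<close>, so that sums and integrals may be exchanged before convergence is known.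
\<close>
definition ntheta :: "('v \<Rightarrow> real) \<Rightarrow> real \<Rightarrow> ennreal" where
  "ntheta q t = (\<integral>\<^sup>+v. ennreal (exp (- (pi * t * q v))) \<partial>count_space UNIV)"

definition theta :: "('v \<Rightarrow> real) \<Rightarrow> real \<Rightarrow> real" where
  "theta q t = (\<integral>v. exp (- (pi * t * q v)) \<partial>count_space UNIV)"

text \<open>
  The quantitative facts about the theta series of a positive definite form \<open>q\<close> of rank \<open>n\<close> with
  zero vector \<open>z\<close> that its continuation rests on: \<open>D\<close> is the square root of the determinant, \<open>c\<close> a
  lower bound for the minimum, and \<open>K\<close> collects the constants in the approximation of the series by
  its leading term.  The constants are parameters so that they can be shared by a family of forms.
\<close>
definition theta_controlled ::
    "nat \<Rightarrow> real \<Rightarrow> real \<Rightarrow> (nat \<Rightarrow> real) \<Rightarrow> 'v \<Rightarrow> ('v \<Rightarrow> real) \<Rightarrow> bool" where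
  "theta_controlled n D c K z q \<longleftrightarrow> q z = 0 \<and> (\<forall>v. v \<noteq> z \<longrightarrow> c \<le> q v) \<and>
     (\<forall>k\<ge>1. \<forall>t\<in>{0<..1}. \<exists>\<theta>\<ge>0. ntheta q t = ennreal \<theta> \<and> \<bar>D * sqrt t ^ n * \<theta> - 1\<bar> \<le> K k * sqrt t ^ k)"

lemma theta_controlledD:
  assumes "theta_controlled n D c K z q"
  shows "q z = 0" "v \<noteq> z \<Longrightarrow> c \<le> q v"
    "k \<ge> 1 \<Longrightarrow> 0 < t \<Longrightarrow> t \<le> 1 \<Longrightarrow> \<exists>\<theta>\<ge>0. ntheta q t = ennreal \<theta> \<and> \<bar>D * sqrt t ^ n * \<theta> - 1\<bar> \<le> K k * sqrt t ^ k"
  using assms by (auto simp: theta_controlled_def)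

lemma ntheta_bij:
  assumes "bij f"
  shows "ntheta (\<lambda>v. q (f v)) t = ntheta q t"
  unfolding ntheta_def
  using nn_integral_bij_count_space[OF assms, of "\<lambda>v. ennreal (exp (- (pi * t * q v)))"] by simp

lemma theta_controlled_bij:
  assumes "theta_controlled n D c K z q" "bij f" "f z' = z"
  shows "theta_controlled n D c K z' (\<lambda>v. q (f v))"
  using assms unfolding theta_controlled_def ntheta_bij[OF assms(2)]
  by (auto dest: bij_is_inj injD)

lemma theta_controlled_unit: "theta_controlled 0 1 c (\<lambda>_. 0) () (\<lambda>_. 0)"
  by (auto simp: theta_controlled_def ntheta_def nn_integral_count_space_finite UNIV_unit
      intro!: exI[of _ 1])

definition approx_const :: "nat \<Rightarrow> real \<Rightarrow> real" where
  "approx_const k \<mu> = 6 * (fact k * exp pi) * sqrt \<mu> ^ k"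

text \<open>
  The relative errors of an outer sum and of an inner sum over a variable with coefficient \<open>\<mu>\<close>
  combine to this constant.
\<close>
definition next_const :: "real \<Rightarrow> (nat \<Rightarrow> real) \<Rightarrow> nat \<Rightarrow> real" where
  "next_const \<mu> K k = K k + approx_const k \<mu> * (1 + K k)"

lemma ntheta_extend:
  assumes "t > 0" "\<mu> > 0"
  shows "ntheta (\<lambda>(v, m). q v + \<mu> * (real_of_int m + x v)\<^sup>2) t =
    (\<integral>\<^sup>+v. ennreal (exp (- (pi * t * q v))) * ennreal (gauss (\<mu> * t) (x v)) \<partial>count_space UNIV)"
proof -
  have "ntheta (\<lambda>(v, m). q v + \<mu> * (real_of_int m + x v)\<^sup>2) t =
     (\<integral>\<^sup>+v. \<integral>\<^sup>+m. ennreal (exp (- (pi * t * (q v + \<mu> * (real_of_int m + x v)\<^sup>2)))) \<partial>count_space UNIV \<partial>count_space UNIV)"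
    unfolding ntheta_def by (subst nn_integral_fst_count_space[symmetric]) simp
  also have "\<dots> = (\<integral>\<^sup>+v. ennreal (exp (- (pi * t * q v))) *
      (\<integral>\<^sup>+m. ennreal (exp (- (pi * (\<mu> * t) * (real_of_int m + x v)\<^sup>2))) \<partial>count_space UNIV) \<partial>count_space UNIV)"
    by (subst nn_integral_cmult[symmetric])
       (simp_all add: ennreal_mult[symmetric] exp_add[symmetric] algebra_simps)
  finally show ?thesis using assms by (simp add: nn_gauss)
qed

text \<open>
  Summing over the last variable first replaces the inner sum, up to a small relative error that is
  uniform in the shift, by its mean.  All terms are positive, so the relative error survives the
  outer summation.
\<close>
lemma theta_controlled_extend:
  assumes q: "theta_controlled n D c K z q" and D: "D \<ge> 0" and \<mu>: "\<mu> > 0" "c \<le> \<mu>" and x: "x z = 0"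
    and c: "c > 0"
  shows "theta_controlled (Suc n) (D * sqrt \<mu>) c (next_const \<mu> K) (z, 0)
           (\<lambda>(v, m). q v + \<mu> * (real_of_int m + x v)\<^sup>2)"
  unfolding theta_controlled_def
proof (intro conjI allI impI ballI)
  fix v :: "'a \<times> int" assume v: "v \<noteq> (z, 0)"
  show "c \<le> (case v of (v, m) \<Rightarrow> q v + \<mu> * (real_of_int m + x v)\<^sup>2)"
  proof (cases "fst v = z")
    case True
    with v have m: "snd v \<noteq> 0" by (cases v) auto
    then have "1 \<le> \<bar>snd v\<bar>" by linarith
    then have "1 \<le> \<bar>real_of_int (snd v)\<bar>" by (metis of_int_1_le_iff of_int_abs)
    then have "1 \<le> (real_of_int (snd v))\<^sup>2" by (metis abs_1 abs_le_square_iff one_power2)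
    then have "c * 1 \<le> \<mu> * (real_of_int (snd v))\<^sup>2" using \<mu> c by (intro mult_mono) auto
    then show ?thesis using True x theta_controlledD(1)[OF q] by (simp add: case_prod_unfold)
  next
    case False
    then have "c \<le> q (fst v)" using theta_controlledD(2)[OF q] by auto
    moreover have "0 \<le> \<mu> * (real_of_int (snd v) + x (fst v))\<^sup>2" using \<mu> by simp
    ultimately show ?thesis by (simp add: case_prod_unfold)
  qed
next
  fix k :: nat and t :: real assume k: "k \<ge> 1" and t: "t \<in> {0<..1}"
  let ?q = "\<lambda>(v, m). q v + \<mu> * (real_of_int m + x v)\<^sup>2"
  define r where "r = sqrt (\<mu> * t)"
  have r: "r > 0" using t \<mu> by (auto simp: r_def)
  define \<epsilon> where "\<epsilon> = approx_const k \<mu> * sqrt t ^ k"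
  have \<epsilon>: "\<epsilon> \<ge> 0" using \<mu> t by (auto simp: \<epsilon>_def approx_const_def)
  obtain \<theta>' where \<theta>': "\<theta>' \<ge> 0" "ntheta q t = ennreal \<theta>'" "\<bar>D * sqrt t ^ n * \<theta>' - 1\<bar> \<le> K k * sqrt t ^ k"
    using theta_controlledD(3)[OF q k] t by auto
  have g: "\<bar>r * gauss (\<mu> * t) y - 1\<bar> \<le> \<epsilon>" for y
    using gauss_approx[of "\<mu> * t" k y] k t \<mu>
    by (simp add: r_def \<epsilon>_def approx_const_def real_sqrt_mult power_mult_distrib mult_ac)
  have g1: "gauss (\<mu> * t) y \<le> (1 + \<epsilon>) / r" and g2: "(1 - \<epsilon>) / r \<le> gauss (\<mu> * t) y" for y
    using g[of y] r unfolding abs_le_iff by (simp_all add: field_simps)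
  have eq: "(\<integral>\<^sup>+v. ennreal (exp (- (pi * t * q v))) * ennreal C \<partial>count_space UNIV) = ennreal (\<theta>' * C)" for C
    using \<theta>' by (subst nn_integral_multc) (auto simp: ntheta_def ennreal_mult')
  have ext: "ntheta ?q t = (\<integral>\<^sup>+v. ennreal (exp (- (pi * t * q v))) * ennreal (gauss (\<mu> * t) (x v)) \<partial>count_space UNIV)"
    using t \<mu> by (intro ntheta_extend) auto
  have up: "ntheta ?q t \<le> ennreal (\<theta>' * ((1 + \<epsilon>) / r))"
    unfolding ext eq[symmetric] by (intro nn_integral_mono mult_left_mono ennreal_leI g1) auto
  have lo: "ennreal (\<theta>' * ((1 - \<epsilon>) / r)) \<le> ntheta ?q t"
    unfolding ext eq[symmetric] by (intro nn_integral_mono mult_left_mono ennreal_leI g2) auto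
  define \<theta> where "\<theta> = enn2real (ntheta ?q t)"
  have \<theta>: "ntheta ?q t = ennreal \<theta>" "\<theta> \<ge> 0"
    using le_less_trans[OF up ennreal_less_top] by (auto simp: \<theta>_def)
  have "\<theta> \<le> \<theta>' * ((1 + \<epsilon>) / r)" using up \<theta> \<theta>' \<epsilon> r by (simp add: ennreal_le_iff)
  then have u: "r * \<theta> \<le> \<theta>' + \<epsilon> * \<theta>'" using r by (simp add: field_simps)
  have "\<theta>' * ((1 - \<epsilon>) / r) \<le> \<theta>" using lo \<theta> by (simp add: ennreal_le_iff)
  then have l: "\<theta>' - \<epsilon> * \<theta>' \<le> r * \<theta>" using r by (simp add: field_simps)
  define A where "A = D * sqrt t ^ n"
  have A: "A \<ge> 0" using D t by (auto simp: A_def)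
  have "A * (r * \<theta>) \<le> A * (\<theta>' + \<epsilon> * \<theta>')" "A * (\<theta>' - \<epsilon> * \<theta>') \<le> A * (r * \<theta>)"
    using A u l by (auto intro!: mult_left_mono)
  then have 1: "\<bar>A * (r * \<theta>) - A * \<theta>'\<bar> \<le> \<epsilon> * (A * \<theta>')"
    by (auto simp: abs_le_iff algebra_simps)
  have 2: "\<bar>A * \<theta>' - 1\<bar> \<le> K k * sqrt t ^ k" using \<theta>' by (simp add: A_def)
  have "sqrt t ^ k \<le> 1" using t by (intro power_le_one) auto
  moreover have "0 \<le> K k * sqrt t ^ k" using order.trans[OF abs_ge_zero 2] .
  then have "0 \<le> K k" using t zero_less_power[of "sqrt t" k] by (simp add: zero_le_mult_iff not_le[symmetric])
  ultimately have "A * \<theta>' \<le> 1 + K k"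
    using 2 mult_left_mono[of "sqrt t ^ k" 1 "K k"] by auto
  then have "\<epsilon> * (A * \<theta>') \<le> \<epsilon> * (1 + K k)" using \<epsilon> by (intro mult_left_mono)
  then have "\<bar>A * (r * \<theta>) - 1\<bar> \<le> \<epsilon> * (1 + K k) + K k * sqrt t ^ k" using 1 2 by linarith
  also have "\<dots> = next_const \<mu> K k * sqrt t ^ k" by (simp add: next_const_def \<epsilon>_def algebra_simps)
  also have "A * (r * \<theta>) = D * sqrt \<mu> * sqrt t ^ Suc n * \<theta>"
    by (simp add: A_def r_def real_sqrt_mult)
  finally show "\<exists>\<theta>\<ge>0. ntheta ?q t = ennreal \<theta> \<and> \<bar>D * sqrt \<mu> * sqrt t ^ Suc n * \<theta> - 1\<bar> \<le> next_const \<mu> K k * sqrt t ^ k"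
    using \<theta> by blast
qed (use x theta_controlledD(1)[OF q] in auto)

lemma theta_controlled_nonneg:
  assumes "theta_controlled n D c K z q" "c > 0"
  shows "q v \<ge> 0"
  using theta_controlledD(1)[OF assms(1)] theta_controlledD(2)[OF assms(1), of v] assms(2)
  by (cases "v = z") auto

lemma theta_controlled_finite:
  assumes q: "theta_controlled n D c K z q" and c: "c > 0" and t: "t > 0"
  shows "ntheta q t < top"
proof -
  have "ntheta q t \<le> ntheta q (min 1 t)"
    unfolding ntheta_def
    using theta_controlled_nonneg[OF q c] by (intro nn_integral_mono ennreal_leI) (auto intro!: mult_right_mono)
  also have "\<dots> < top" using theta_controlledD(3)[OF q, of 1 "min 1 t"] t by auto
  finally show ?thesis .
qed

lemma theta_controlled_integrable:
  assumes q: "theta_controlled n D c K z q" and c: "c > 0" and t: "t > 0"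
  shows "integrable (count_space UNIV) (\<lambda>v. exp (- (pi * t * q v)))"
    and "ntheta q t = ennreal (theta q t)"
proof -
  show int: "integrable (count_space UNIV) (\<lambda>v. exp (- (pi * t * q v)))"
    using theta_controlled_finite[OF assms] by (intro integrableI_nonneg) (auto simp: ntheta_def)
  then show "ntheta q t = ennreal (theta q t)"
    unfolding ntheta_def theta_def by (intro nn_integral_eq_integral) auto
qed

lemma theta_nonneg: "theta q t \<ge> 0"
  unfolding theta_def by (rule Bochner_Integration.integral_nonneg) simp

lemma theta_eq_enn2real:
  assumes "theta_controlled n D c K z q" "c > 0" "t > 0"
  shows "theta q t = enn2real (ntheta q t)"
  using theta_controlled_integrable(2)[OF assms] by (simp add: theta_nonneg)

lemma theta_minus_1:
  assumes q: "theta_controlled n D c K z q" and c: "c > 0" and t: "t > 0"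
  shows "integrable (count_space UNIV) (\<lambda>v. if v = z then 0 else exp (- (pi * t * q v)))"
    and "theta q t - 1 = (\<integral>v. (if v = z then 0 else exp (- (pi * t * q v))) \<partial>count_space UNIV)"
proof -
  have eq: "exp (- (pi * t * q v)) = (if v = z then 0 else exp (- (pi * t * q v))) + indicator {z} v" for v
    using theta_controlledD(1)[OF q] by auto
  show int: "integrable (count_space UNIV) (\<lambda>v. if v = z then 0 else exp (- (pi * t * q v)))"
    by (rule Bochner_Integration.integrable_bound[OF theta_controlled_integrable(1)[OF assms]]) auto
  have "integrable (count_space UNIV) (indicator {z} :: _ \<Rightarrow> real)"
    "(\<integral>v. indicator {z} v \<partial>count_space UNIV) = (1::real)"
    by (simp_all add: integrable_indicator_iff)
  then show "theta q t - 1 = (\<integral>v. (if v = z then 0 else exp (- (pi * t * q v))) \<partial>count_space UNIV)"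
    unfolding theta_def by (subst eq) (simp add: int)
qed

lemma theta_ge_1:
  assumes "theta_controlled n D c K z q" "c > 0" "t > 0"
  shows "theta q t \<ge> 1"
proof -
  have "0 \<le> theta q t - 1"
    unfolding theta_minus_1(2)[OF assms] by (rule Bochner_Integration.integral_nonneg) simp
  then show ?thesis by simp
qed

lemma theta_approx:
  assumes q: "theta_controlled n D c K z q" and c: "c > 0" and k: "k \<ge> 1" and t: "0 < t" "t \<le> 1"
  shows "\<bar>D * sqrt t ^ n * theta q t - 1\<bar> \<le> K k * sqrt t ^ k"
proof -
  obtain \<theta> where "\<theta> \<ge> 0" "ntheta q t = ennreal \<theta>" "\<bar>D * sqrt t ^ n * \<theta> - 1\<bar> \<le> K k * sqrt t ^ k"
    using theta_controlledD(3)[OF q k t] by auto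
  then show ?thesis using theta_eq_enn2real[OF q c t(1)] by simp
qed

lemma theta_minus_1_decay:
  assumes q: "theta_controlled n D c K z q" and c: "c > 0" and D: "D > 0" and t: "t \<ge> 1"
  shows "theta q t - 1 \<le> exp (- (pi * c * (t - 1))) * ((1 + K 1) / D)"
proof -
  have "theta q t - 1 \<le> (\<integral>v. exp (- (pi * c * (t - 1))) * exp (- (pi * 1 * q v)) \<partial>count_space UNIV)"
    unfolding theta_minus_1(2)[OF q c order.strict_trans2[OF zero_less_one t]]
  proof (intro integral_mono)
    fix v
    show "(if v = z then 0 else exp (- (pi * t * q v))) \<le> exp (- (pi * c * (t - 1))) * exp (- (pi * 1 * q v))"
    proof (cases "v = z")
      case False
      then have "pi * (t - 1) * c \<le> pi * (t - 1) * q v"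
        using theta_controlledD(2)[OF q] t by (intro mult_left_mono) auto
      then show ?thesis using False by (simp add: algebra_simps flip: exp_add)
    qed simp
  qed (use theta_minus_1(1)[OF q c] theta_controlled_integrable(1)[OF q c, of 1] t in auto)
  also have "\<dots> = exp (- (pi * c * (t - 1))) * theta q 1" by (simp add: theta_def)
  also have "theta q 1 \<le> (1 + K 1) / D"
    using theta_approx[OF q c, of 1 1] D by (simp add: abs_le_iff field_simps)
  finally show ?thesis by simp
qed

lemma exp_decay_le_powr:
  fixes a b :: real
  assumes b: "b > 0"
  shows "\<exists>C\<ge>0. \<forall>t\<ge>1. exp (- (b * (t - 1))) \<le> C * t powr a"
proof -
  define m where "m = Suc (nat \<lceil>- a\<rceil>)"
  have m: "real m \<ge> - a" "m > 0" unfolding m_def by linarith+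
  have "exp (- (b * (t - 1))) \<le> exp b * (real m / b) ^ m * t powr a" if t: "t \<ge> 1" for t
  proof -
    have "(b * t / real m) ^ m \<le> (1 + b * t / real m) ^ m"
      using b t by (intro power_mono) auto
    also have "\<dots> \<le> exp (b * t)"
      using b t m exp_ge_one_plus_x_over_n_power_n[of m "b * t"] by (simp add: order.trans[of _ 0])
    finally have "exp (- (b * t)) \<le> inverse ((b * t / real m) ^ m)"
      unfolding exp_minus using b t m by (intro le_imp_inverse_le) auto
    also have "\<dots> = (real m / b) ^ m * t powr (- real m)"
      using b t m by (simp add: powr_minus powr_realpow power_divide power_mult_distrib field_simps)
    also have "\<dots> \<le> (real m / b) ^ m * t powr a"
      using b t m by (intro mult_left_mono powr_mono) auto
    finally have "exp b * exp (- (b * t)) \<le> exp b * ((real m / b) ^ m * t powr a)" by simp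
    then show ?thesis by (simp add: algebra_simps flip: exp_add)
  qed
  then show ?thesis using b by (intro exI[of _ "exp b * (real m / b) ^ m"]) auto
qed

lemma sqrt_power_eq_powr: "t > 0 \<Longrightarrow> sqrt t ^ k = t powr (real k / 2)"
proof -
  assume t: "t > 0"
  have "sqrt t ^ k = sqrt t powr real k" using t by (simp add: powr_realpow)
  also have "\<dots> = (t powr (1 / 2)) powr real k" using t by (simp only: powr_half_sqrt less_imp_le)
  also have "\<dots> = t powr (real k / 2)" by (simp only: powr_powr) simp
  finally show ?thesis .
qed

text \<open>The bound depends only on the constants that control the series.\<close>
lemma remainder_theta_bound:
  assumes c: "c > 0" and D: "D > 0"
  shows "\<exists>B. \<forall>q. theta_controlled n D c K (z :: 'v) q \<longrightarrow>
           (\<forall>t>0. \<bar>remainder (1 / D) (real n / 2) (theta q) t\<bar> \<le> B * t powr a)"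
proof -
  define k where "k = Suc (nat \<lceil>2 * a + real n\<rceil>)"
  have k: "k \<ge> 1" "(real k - real n) / 2 \<ge> a"
    using real_nat_ceiling_ge[of "2 * a + real n"] unfolding k_def by auto
  obtain C where C: "C \<ge> 0" "\<And>t. t \<ge> 1 \<Longrightarrow> exp (- (pi * c * (t - 1))) \<le> C * t powr a"
    using exp_decay_le_powr[of "pi * c" a] c by auto
  define B where "B = \<bar>K k\<bar> / D + C * (\<bar>1 + K 1\<bar> / D)"
  have "\<bar>remainder (1 / D) (real n / 2) (theta q) t\<bar> \<le> B * t powr a"
    if q: "theta_controlled n D c K z q" and t: "t > 0" for q :: "'v \<Rightarrow> real" and t
  proof (cases "t \<le> 1")
    case True
    have sn: "sqrt t ^ n = t powr (real n / 2)" "t powr (real n / 2) > 0" using t by (simp_all add: sqrt_power_eq_powr)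
    have "\<bar>D * sqrt t ^ n * theta q t - 1\<bar> \<le> K k * sqrt t ^ k"
      by (rule theta_approx[OF q c k(1) t True])
    then have "\<bar>D * sqrt t ^ n * theta q t - 1\<bar> / (D * sqrt t ^ n) \<le> K k * sqrt t ^ k / (D * sqrt t ^ n)"
      using D t by (intro divide_right_mono) auto
    also have "\<bar>D * sqrt t ^ n * theta q t - 1\<bar> / (D * sqrt t ^ n) = \<bar>(D * sqrt t ^ n * theta q t - 1) / (D * sqrt t ^ n)\<bar>"
      using D t by (simp add: abs_divide abs_mult)
    also have "(D * sqrt t ^ n * theta q t - 1) / (D * sqrt t ^ n) = remainder (1 / D) (real n / 2) (theta q) t"
      using D t True sn by (simp add: remainder_def powr_minus field_simps)
    also have "K k * sqrt t ^ k / (D * sqrt t ^ n) = K k / D * t powr ((real k - real n) / 2)"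
      using t by (simp add: sqrt_power_eq_powr diff_divide_distrib powr_diff)
    also have "\<dots> \<le> \<bar>K k\<bar> / D * t powr ((real k - real n) / 2)"
      using D by (intro mult_right_mono divide_right_mono) auto
    also have "\<dots> \<le> \<bar>K k\<bar> / D * t powr a"
      using D k t True by (intro mult_left_mono powr_mono') auto
    also have "\<dots> \<le> B * t powr a"
      using C D by (intro mult_right_mono) (auto simp: B_def)
    finally show ?thesis .
  next
    case False
    have "\<bar>remainder (1 / D) (real n / 2) (theta q) t\<bar> = theta q t - 1"
      using False theta_ge_1[OF q c t] by (simp add: remainder_def)
    also have "\<dots> \<le> exp (- (pi * c * (t - 1))) * ((1 + K 1) / D)"
      using False by (intro theta_minus_1_decay[OF q c D]) auto
    also have "\<dots> \<le> exp (- (pi * c * (t - 1))) * (\<bar>1 + K 1\<bar> / D)"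
      using D by (intro mult_left_mono divide_right_mono) auto
    also have "\<dots> \<le> (C * t powr a) * (\<bar>1 + K 1\<bar> / D)"
      using False C D by (intro mult_right_mono) auto
    also have "\<dots> \<le> B * t powr a"
      using D by (simp add: B_def algebra_simps)
    finally show ?thesis .
  qed
  then show ?thesis by blast
qed

lemma theta_measurable:
  fixes q :: "'v::countable \<Rightarrow> real"
  shows "theta q \<in> borel_measurable borel"
  unfolding theta_def[abs_def] by (rule measurable_integral_count_space) auto

lemma remainder_measurable:
  assumes [measurable]: "T \<in> borel_measurable borel"
  shows "remainder C p T \<in> borel_measurable borel"
  unfolding remainder_def[abs_def] by measurable

lemma rapid_remainder_theta:
  fixes q :: "'v::countable \<Rightarrow> real"
  assumes "theta_controlled n D c K z q" "c > 0" "D > 0"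
  shows "rapid (remainder (1 / D) (real n / 2) (theta q))"
  unfolding rapid_def
proof (intro conjI allI)
  fix a
  from remainder_theta_bound[OF assms(2,3), of n K z a] assms(1)
  show "\<exists>B. \<forall>t>0. \<bar>remainder (1 / D) (real n / 2) (theta q) t\<bar> \<le> B * t powr a" by metis
qed (rule remainder_measurable[OF theta_measurable])

definition dirichlet :: "('v \<Rightarrow> real) \<Rightarrow> 'v \<Rightarrow> complex \<Rightarrow> complex" where
  "dirichlet q z s = (\<integral>v. (if v = z then 0 else of_real (q v) powr (- s)) \<partial>count_space UNIV)"

text \<open>
  Riemann's computation: integrating the theta series term by term against \<open>t\<^sup>s\<^sup>-\<^sup>1\<close> produces the
  Dirichlet series.
\<close>
lemma dirichlet_eq_mellin:
  fixes q :: "'v::countable \<Rightarrow> real"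
  assumes q: "theta_controlled n D c K z q" and c: "c > 0" and D: "D > 0"
    and s: "Re s > real n / 2" "Re s > 0"
  shows "integrable (count_space UNIV) (\<lambda>v. if v = z then 0 else of_real (q v) powr (- s) :: complex)"
    and "completed (1 / D) (real n / 2) (theta q) s = of_real pi powr (- s) * Gamma s * dirichlet q z s"
proof -
  interpret N: sigma_finite_measure "count_space (UNIV :: 'v set)"
    by (rule sigma_finite_measure_count_space_countable) auto
  interpret P: pair_sigma_finite lborel "count_space (UNIV :: 'v set)" by standard
  define e where "e v t = (if v = z then 0 else exp (- (pi * t * q v)))" for v t
  define F where "F t v = complex_of_real (indicator {0<..} t * e v t) * of_real t powr (s - 1)" for t v
  note comp = completed_eq_mellin[OF rapid_remainder_theta[OF q c D] s]
  have e_int: "integrable (count_space UNIV) (\<lambda>v. e v t)" if "t > 0" for t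
    using theta_minus_1(1)[OF q c that] by (simp add: e_def)
  have e_sum: "theta q t - 1 = (\<integral>v. e v t \<partial>count_space UNIV)" if "t > 0" for t
    using theta_minus_1(2)[OF q c that] by (simp add: e_def)
  have F_int: "integrable (count_space UNIV) (F t)" for t
    unfolding F_def by (cases "t > 0") (auto intro!: integrable_mult_left e_int integrable_of_real)
  have F_sum: "(\<integral>v. F t v \<partial>count_space UNIV) = of_real (indicator {0<..} t * (theta q t - 1)) * of_real t powr (s - 1)" for t
    unfolding F_def by (cases "t > 0") (auto simp: e_int e_sum)
  have F_norm: "(\<integral>v. norm (F t v) \<partial>count_space UNIV) =
      norm (of_real (indicator {0<..} t * (theta q t - 1)) * of_real t powr (s - 1) :: complex)" for t
  proof (cases "t > 0")
    case True
    have "norm (F t v) = e v t * t powr (Re s - 1)" for v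
      using True by (simp add: F_def norm_mult norm_of_real_powr e_def)
    then show ?thesis using True theta_ge_1[OF q c True]
      by (simp add: e_sum[symmetric] norm_mult norm_of_real_powr abs_of_nonneg del: of_real_diff)
  qed (auto simp: F_def)
  have int: "integrable (lborel \<Otimes>\<^sub>M count_space UNIV) (\<lambda>(t, v). F t v)"
  proof (rule P.Fubini_integrable)
    show "(\<lambda>(t, v). F t v) \<in> borel_measurable (lborel \<Otimes>\<^sub>M count_space UNIV)"
      by (rule measurable_pair_count_space) (auto simp: F_def e_def)
    show "integrable lborel (\<lambda>t. \<integral>v. norm (case (t, v) of (t, v) \<Rightarrow> F t v) \<partial>count_space UNIV)"
      unfolding case_prod_conv F_norm
      using comp(2) by (intro integrable_norm) (simp add: mellin_integrable_def)
  qed (use F_int in auto)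
  have F_t: "(\<integral>t. F t v \<partial>lborel) =
     of_real pi powr (- s) * Gamma s * (if v = z then 0 else of_real (q v) powr (- s))" for v
  proof (cases "v = z")
    case False
    then have q0: "q v > 0" using theta_controlledD(2)[OF q] c by force
    have "(\<integral>t. F t v \<partial>lborel) = mellin (\<lambda>t. exp (- (pi * q v * t))) s"
      using False by (simp add: F_def e_def mellin_def mult_ac)
    also have "\<dots> = of_real (pi * q v) powr (- s) * Gamma s"
      using mellin_scale(1)[of "pi * q v" "\<lambda>t. exp (- t)" s] q0 mellin_exp(1)[OF s(2)] by simp
    finally show ?thesis using False q0 by (simp add: powr_times_real)
  qed (simp add: F_def e_def)
  have G0: "of_real pi powr (- s) * Gamma s \<noteq> 0"
    using s by (auto simp: Gamma_eq_zero_iff elim!: nonpos_Ints_cases)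
  have "integrable (count_space UNIV) (\<lambda>v. \<integral>t. F t v \<partial>lborel)"
    using P.integrable_snd[OF int] by simp
  then have "integrable (count_space UNIV) (\<lambda>v. 1 / (of_real pi powr (- s) * Gamma s) *
     (of_real pi powr (- s) * Gamma s * (if v = z then 0 else of_real (q v) powr (- s))))"
    unfolding F_t by (rule integrable_mult_right)
  then show "integrable (count_space UNIV) (\<lambda>v. if v = z then 0 else of_real (q v) powr (- s) :: complex)"
    using G0 by simp
  have "completed (1 / D) (real n / 2) (theta q) s = mellin (\<lambda>t. theta q t - 1) s" using comp(1) ..
  also have "\<dots> = (\<integral>t. (\<integral>v. F t v \<partial>count_space UNIV) \<partial>lborel)"
    unfolding F_sum mellin_def ..
  also have "\<dots> = (\<integral>v. (\<integral>t. F t v \<partial>lborel) \<partial>count_space UNIV)"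
    using P.Fubini_integral[OF int] by simp
  also have "\<dots> = of_real pi powr (- s) * Gamma s * dirichlet q z s"
    unfolding F_t dirichlet_def by simp
  finally show "completed (1 / D) (real n / 2) (theta q) s = of_real pi powr (- s) * Gamma s * dirichlet q z s" .
qed

section \<open>Forms of rank one, two and four\<close>

definition square :: "int \<Rightarrow> real" where
  "square m = (real_of_int m)\<^sup>2"

lemma theta_controlled_rank1:
  assumes "\<mu> > 0" "c \<le> \<mu>" "c > 0"
  shows "theta_controlled 1 (sqrt \<mu>) c (next_const \<mu> (\<lambda>_. 0)) 0 (\<lambda>m. \<mu> * square m)"
proof -
  have "theta_controlled (Suc 0) (1 * sqrt \<mu>) c (next_const \<mu> (\<lambda>_. 0)) ((), 0)
      (\<lambda>(v, m). 0 + \<mu> * (real_of_int m + 0)\<^sup>2)"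
    using assms by (intro theta_controlled_extend theta_controlled_unit) auto
  moreover have "bij (\<lambda>m::int. ((), m))" by (auto intro!: bijI injI)
  ultimately have "theta_controlled (Suc 0) (1 * sqrt \<mu>) c (next_const \<mu> (\<lambda>_. 0)) 0
     (\<lambda>m. (\<lambda>(v, m). 0 + \<mu> * (real_of_int m + 0)\<^sup>2) ((), m))"
    by (rule theta_controlled_bij) auto
  then show ?thesis by (simp add: square_def)
qed

lemma theta_controlled_square: "theta_controlled 1 1 1 (next_const 1 (\<lambda>_. 0)) 0 square"
  using theta_controlled_rank1[of 1 1] by simp

lemma theta_square: "theta square t = gauss t 0"
  by (simp add: theta_def gauss_def square_def)

lemma theta_controlled_rank2:
  assumes "\<mu>1 > 0" "\<mu>2 > 0" "c \<le> \<mu>1" "c \<le> \<mu>2" "c > 0" "x 0 = 0"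
  shows "theta_controlled 2 (sqrt \<mu>1 * sqrt \<mu>2) c (next_const \<mu>2 (next_const \<mu>1 (\<lambda>_. 0))) (0, 0)
     (\<lambda>(b, d). \<mu>1 * square b + \<mu>2 * (real_of_int d + x b)\<^sup>2)"
  using theta_controlled_extend[where x = x, OF theta_controlled_rank1[OF assms(1,3,5)] _ assms(2,4,6,5)] assms
  by (simp add: numeral_2_eq_2)

lemma theta_controlled_rank4:
  assumes "\<mu>1 > 0" "\<mu>2 > 0" "\<mu>3 > 0" "\<mu>4 > 0" "c \<le> \<mu>1" "c \<le> \<mu>2" "c \<le> \<mu>3" "c \<le> \<mu>4" "c > 0"
    and "x1 0 = 0" "x2 (0, 0) = 0" "x3 ((0, 0), 0) = 0"
  shows "theta_controlled 4 (sqrt \<mu>1 * sqrt \<mu>2 * sqrt \<mu>3 * sqrt \<mu>4) c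
     (next_const \<mu>4 (next_const \<mu>3 (next_const \<mu>2 (next_const \<mu>1 (\<lambda>_. 0))))) (((0, 0), 0), 0)
     (\<lambda>(((a, b), d), c). \<mu>1 * square a + \<mu>2 * (real_of_int b + x1 a)\<^sup>2 +
         \<mu>3 * (real_of_int d + x2 (a, b))\<^sup>2 + \<mu>4 * (real_of_int c + x3 ((a, b), d))\<^sup>2)"
proof -
  note tc2 = theta_controlled_rank2[of \<mu>1 \<mu>2 c x1, OF assms(1,2,5,6,9,10)]
  note tc3 = theta_controlled_extend[where x = x2, OF tc2 _ assms(3,7,11,9)]
  note tc4 = theta_controlled_extend[where x = x3, OF tc3 _ assms(4,8,12,9)]
  show ?thesis using tc4 assms by (simp add: case_prod_unfold numeral_eq_Suc mult.assoc)
qed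

section \<open>Averages over the unit cube\<close>

definition unit_avg :: "(real \<Rightarrow> ennreal) \<Rightarrow> ennreal" where
  "unit_avg f = (\<integral>\<^sup>+u. f u * indicator {0..<1} u \<partial>lborel)"

lemma unit_avg_const [simp]: "unit_avg (\<lambda>_. c) = c"
  unfolding unit_avg_def by (subst nn_integral_cmult_indicator) auto

lemma unit_avg_cmult:
  assumes "f \<in> borel_measurable borel"
  shows "unit_avg (\<lambda>u. c * f u) = c * unit_avg f"
  unfolding unit_avg_def mult.assoc using assms by (subst nn_integral_cmult) auto

lemma unit_avg_sum:
  fixes f :: "'c::countable \<Rightarrow> real \<Rightarrow> ennreal"
  assumes "\<And>m. f m \<in> borel_measurable borel"
  shows "(\<integral>\<^sup>+m. unit_avg (f m) \<partial>count_space UNIV) = unit_avg (\<lambda>u. \<integral>\<^sup>+m. f m u \<partial>count_space UNIV)"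
proof -
  have "(\<integral>\<^sup>+m. f m u \<partial>count_space UNIV) * indicator {0..<1} u =
      (\<integral>\<^sup>+m. f m u * indicator {0..<1} u \<partial>count_space UNIV)" for u
    by (rule nn_integral_multc[symmetric]) auto
  moreover have "(\<integral>\<^sup>+m. \<integral>\<^sup>+u. f m u * indicator {0..<1} u \<partial>lborel \<partial>count_space UNIV) =
      (\<integral>\<^sup>+u. \<integral>\<^sup>+m. f m u * indicator {0..<1} u \<partial>count_space UNIV \<partial>lborel)"
    using assms by (intro nn_integral_count_space_nn_integral[symmetric]) auto
  ultimately show ?thesis unfolding unit_avg_def by simp
qed

lemma unit_avg_gauss:
  assumes "t > 0" "a \<noteq> 0"
  shows "unit_avg (\<lambda>u. ennreal (gauss t (of_int a * u + x))) = ennreal (1 / sqrt t)"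
  unfolding unit_avg_def by (rule nn_integral_gauss_mean[OF assms])

definition cube_measure :: "(real \<times> real \<times> real) measure" where
  "cube_measure = restrict_space lborel unit_cube"

lemma unit_cube_sets [measurable]: "unit_cube \<in> sets borel"
  unfolding unit_cube_def by (intro borel_Times) auto

text \<open>
  The order lets the averages be taken one at a time: the second coordinate shifts \<open>c\<close> alone, once
  \<open>c\<close> is gone the third shifts \<open>d\<close> alone, and then the first is left to shift \<open>b\<close>.
\<close>
lemma nn_integral_cube:
  assumes [measurable]: "F \<in> borel_measurable borel"
  shows "(\<integral>\<^sup>+u. F u \<partial>cube_measure) =
    unit_avg (\<lambda>u1. unit_avg (\<lambda>u3. unit_avg (\<lambda>u2. F (u1, u2, u3))))"
proof -
  have "(\<integral>\<^sup>+u. F u \<partial>cube_measure) = (\<integral>\<^sup>+u. F u * indicator unit_cube u \<partial>lborel)"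
    unfolding cube_measure_def by (subst nn_integral_restrict_space) auto
  also have "\<dots> = (\<integral>\<^sup>+u1. \<integral>\<^sup>+p. F (u1, p) * indicator unit_cube (u1, p) \<partial>lborel \<partial>lborel)"
  proof -
    have "(\<lambda>u. F u * indicator unit_cube u) \<in> borel_measurable (lborel \<Otimes>\<^sub>M lborel)"
      unfolding lborel_prod by measurable
    from lborel.nn_integral_fst[OF this] show ?thesis by (simp add: lborel_prod)
  qed
  also have "\<dots> = (\<integral>\<^sup>+u1. (\<integral>\<^sup>+u3. \<integral>\<^sup>+u2. F (u1, u2, u3) * indicator unit_cube (u1, u2, u3) \<partial>lborel \<partial>lborel) \<partial>lborel)"
  proof (rule nn_integral_cong)
    fix u1 :: real
    have "(\<lambda>p. F (u1, p) * indicator unit_cube (u1, p)) \<in> borel_measurable (lborel \<Otimes>\<^sub>M lborel)"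
      by (simp add: lborel_prod)
    from lborel_pair.nn_integral_snd[OF this]
    show "(\<integral>\<^sup>+p. F (u1, p) * indicator unit_cube (u1, p) \<partial>lborel) =
      (\<integral>\<^sup>+u3. \<integral>\<^sup>+u2. F (u1, u2, u3) * indicator unit_cube (u1, u2, u3) \<partial>lborel \<partial>lborel)"
      by (simp add: lborel_prod)
  qed
  also have "\<dots> = unit_avg (\<lambda>u1. unit_avg (\<lambda>u3. unit_avg (\<lambda>u2. F (u1, u2, u3))))"
    unfolding unit_avg_def
  proof (intro nn_integral_cong)
    fix u1 :: real
    have "(\<integral>\<^sup>+u3. \<integral>\<^sup>+u2. F (u1, u2, u3) * indicator unit_cube (u1, u2, u3) \<partial>lborel \<partial>lborel) =
      (\<integral>\<^sup>+u3. (\<integral>\<^sup>+u2. F (u1, u2, u3) * indicator {0..<1} u2 \<partial>lborel) * indicator {0..<1} u3 * indicator {0..<1} u1 \<partial>lborel)"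
      by (intro nn_integral_cong, subst nn_integral_multc[symmetric], measurable,
          subst nn_integral_multc[symmetric], measurable, intro nn_integral_cong)
         (auto simp: unit_cube_def indicator_def)
    then show "(\<integral>\<^sup>+u3. \<integral>\<^sup>+u2. F (u1, u2, u3) * indicator unit_cube (u1, u2, u3) \<partial>lborel \<partial>lborel) =
      (\<integral>\<^sup>+u3. (\<integral>\<^sup>+u2. F (u1, u2, u3) * indicator {0..<1} u2 \<partial>lborel) * indicator {0..<1} u3 \<partial>lborel) * indicator {0..<1} u1"
      by (simp add: nn_integral_multc)
  qed
  finally show ?thesis .
qed

lemma prob_space_cube: "prob_space cube_measure"
proof
  have "emeasure cube_measure (space cube_measure) = (\<integral>\<^sup>+u. 1 \<partial>cube_measure)" by simp
  also have "\<dots> = 1" by (subst nn_integral_cube) auto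
  finally show "emeasure cube_measure (space cube_measure) = 1" .
qed

lemma measurable_cube:
  assumes "F \<in> borel_measurable borel"
  shows "F \<in> borel_measurable cube_measure"
  unfolding cube_measure_def using assms by (intro measurable_restrict_space1) auto

lemma integral_cube:
  fixes F :: "real \<times> real \<times> real \<Rightarrow> complex"
  shows "set_lebesgue_integral lborel unit_cube F = (\<integral>u. F u \<partial>cube_measure)"
  unfolding cube_measure_def set_lebesgue_integral_def by (subst integral_restrict_space) auto

section \<open>The rank four theta series averaged over the unit cube\<close>

locale iwasawa_point =
  fixes y1 y2 n1 n2 n4 n5 :: real
  assumes y1: "y1 > 0" and y2: "y2 > 0"
begin

text \<open>
  The shifts of the variables \<open>b\<close>, \<open>d\<close> and \<open>c\<close> that \<open>\<eta> n\<close> causes.  The first summand is the multiple of the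
  coordinate over which the shift is averaged when \<open>a \<noteq> 0\<close>; the rest is constant in that coordinate.
\<close>
definition X1 :: "real \<times> real \<times> real \<Rightarrow> int \<Rightarrow> real" where
  "X1 = (\<lambda>(u1, u2, u3) a. of_int a * u1 + of_int a * n1)"

definition X2 :: "real \<times> real \<times> real \<Rightarrow> int \<times> int \<Rightarrow> real" where
  "X2 = (\<lambda>(u1, u2, u3) (a, b). of_int a * u3 +
     (of_int a * (n1 * n5 + n4) + (of_int a * u1 + of_int b) * n5))"

definition X3 :: "real \<times> real \<times> real \<Rightarrow> (int \<times> int) \<times> int \<Rightarrow> real" where
  "X3 = (\<lambda>(u1, u2, u3) ((a, b), d). of_int a * u2 +
     (of_int b * u3 - of_int d * u1 + of_int a * n2 + (of_int a * u1 + of_int b) * n4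
       - (of_int a * u3 + of_int d) * n1))"

text \<open>
  The squared length of the row \<open>(a, b, c, d)\<close> times \<open>\<eta> n diag(y1, y2, y1\<^sup>-\<^sup>1, y2\<^sup>-\<^sup>1)\<close>, where \<open>\<eta>\<close> has the
  coordinates \<open>u\<close>.  The variable \<open>c\<close> comes last because its shift involves all the others.
\<close>
definition Q4 :: "real \<times> real \<times> real \<Rightarrow> ((int \<times> int) \<times> int) \<times> int \<Rightarrow> real" where
  "Q4 u = (\<lambda>(((a, b), d), c). y1\<^sup>2 * square a + y2\<^sup>2 * (real_of_int b + X1 u a)\<^sup>2 +
     (1 / y2\<^sup>2) * (real_of_int d + X2 u (a, b))\<^sup>2 + (1 / y1\<^sup>2) * (real_of_int c + X3 u ((a, b), d))\<^sup>2)"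

definition Q2 :: "int \<times> int \<Rightarrow> real" where
  "Q2 = (\<lambda>(b, d). y2\<^sup>2 * square b + (1 / y2\<^sup>2) * (real_of_int d + of_int b * n5)\<^sup>2)"

definition cmin :: real where "cmin = min (min (y1\<^sup>2) (y2\<^sup>2)) (min (1 / y2\<^sup>2) (1 / y1\<^sup>2))"

lemma cmin: "cmin > 0" "cmin \<le> y1\<^sup>2" "cmin \<le> y2\<^sup>2" "cmin \<le> 1 / y2\<^sup>2" "cmin \<le> 1 / y1\<^sup>2"
  using y1 y2 by (auto simp: cmin_def)

definition K4 :: "nat \<Rightarrow> real" where
  "K4 = next_const (1 / y1\<^sup>2) (next_const (1 / y2\<^sup>2) (next_const (y2\<^sup>2) (next_const (y1\<^sup>2) (\<lambda>_. 0))))"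

lemma Q4_controlled: "theta_controlled 4 1 cmin K4 (((0, 0), 0), 0) (Q4 u)"
proof -
  obtain u1 u2 u3 where u: "u = (u1, u2, u3)" by (cases u)
  have "theta_controlled 4 (sqrt (y1\<^sup>2) * sqrt (y2\<^sup>2) * sqrt (1 / y2\<^sup>2) * sqrt (1 / y1\<^sup>2)) cmin K4 (((0, 0), 0), 0) (Q4 u)"
    unfolding K4_def Q4_def using y1 y2 cmin
    by (intro theta_controlled_rank4) (auto simp: X1_def X2_def X3_def u)
  also have "sqrt (y1\<^sup>2) * sqrt (y2\<^sup>2) * sqrt (1 / y2\<^sup>2) * sqrt (1 / y1\<^sup>2) = 1"
    using y1 y2 by (simp add: real_sqrt_divide)
  finally show ?thesis .
qed

lemma Q2_controlled:
  "theta_controlled 2 1 cmin (next_const (1 / y2\<^sup>2) (next_const (y2\<^sup>2) (\<lambda>_. 0))) (0, 0) Q2"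
proof -
  have "theta_controlled 2 (sqrt (y2\<^sup>2) * sqrt (1 / y2\<^sup>2)) cmin (next_const (1 / y2\<^sup>2) (next_const (y2\<^sup>2) (\<lambda>_. 0))) (0, 0) Q2"
    unfolding Q2_def using y2 cmin by (intro theta_controlled_rank2) auto
  also have "sqrt (y2\<^sup>2) * sqrt (1 / y2\<^sup>2) = 1" using y2 by (simp add: real_sqrt_divide)
  finally show ?thesis .
qed

lemma Q4_measurable [measurable]: "(\<lambda>u. Q4 u v) \<in> borel_measurable borel"
proof -
  obtain a b d c where v: "v = (((a, b), d), c)" by (metis surj_pair)
  have "continuous_on UNIV (\<lambda>u. Q4 u v)"
    unfolding Q4_def X1_def X2_def X3_def v case_prod_conv case_prod_unfold
    by (intro continuous_intros)
  then show ?thesis by (rule borel_measurable_continuous_onI)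
qed

end

lemma nn_integral_count_space_split:
  "(\<integral>\<^sup>+v. f v \<partial>count_space UNIV) = f z + (\<integral>\<^sup>+v. (if v = z then 0 else f v) \<partial>count_space UNIV)"
proof -
  have "(\<integral>\<^sup>+v. f v \<partial>count_space UNIV) =
      (\<integral>\<^sup>+v. f z * indicator {z} v + (if v = z then 0 else f v) \<partial>count_space UNIV)"
    by (intro nn_integral_cong) auto
  also have "\<dots> = (\<integral>\<^sup>+v. f z * indicator {z} v \<partial>count_space UNIV) + (\<integral>\<^sup>+v. (if v = z then 0 else f v) \<partial>count_space UNIV)"
    by (rule nn_integral_add) auto
  also have "(\<integral>\<^sup>+v. f z * indicator {z} v \<partial>count_space UNIV) = f z"
    by (subst nn_integral_cmult_indicator) auto
  finally show ?thesis .
qed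

lemma nn_integral_theta_minus_1:
  assumes "theta_controlled n D c K z q" "c > 0" "t > 0"
  shows "(\<integral>\<^sup>+v. (if v = z then 0 else ennreal (exp (- (pi * t * q v)))) \<partial>count_space UNIV) = ennreal (theta q t - 1)"
proof -
  have "(\<integral>\<^sup>+v. (if v = z then 0 else ennreal (exp (- (pi * t * q v)))) \<partial>count_space UNIV) =
     (\<integral>\<^sup>+v. ennreal (if v = z then 0 else exp (- (pi * t * q v))) \<partial>count_space UNIV)"
    by (intro nn_integral_cong) auto
  also have "\<dots> = ennreal (theta q t - 1)"
    unfolding theta_minus_1(2)[OF assms] by (intro nn_integral_eq_integral theta_minus_1(1)[OF assms]) auto
  finally show ?thesis .
qed

context iwasawa_point
begin

lemma ntheta_Q4:
  assumes "t > 0"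
  shows "ntheta (Q4 u) t = (\<integral>\<^sup>+a. \<integral>\<^sup>+b. \<integral>\<^sup>+d. ennreal (exp (- (pi * (y1\<^sup>2 * t) * square a))) *
     (ennreal (exp (- (pi * (y2\<^sup>2 * t) * (real_of_int b + X1 u a)\<^sup>2))) *
     (ennreal (exp (- (pi * (t / y2\<^sup>2) * (real_of_int d + X2 u (a, b))\<^sup>2))) *
      ennreal (gauss (t / y1\<^sup>2) (X3 u ((a, b), d))))) \<partial>count_space UNIV \<partial>count_space UNIV \<partial>count_space UNIV)"
    (is "_ = (\<integral>\<^sup>+a. \<integral>\<^sup>+b. \<integral>\<^sup>+d. ?T a b d \<partial>_ \<partial>_ \<partial>_)")
proof -
  define q where "q = (\<lambda>((a, b), d). y1\<^sup>2 * square a + y2\<^sup>2 * (real_of_int b + X1 u a)\<^sup>2 +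
     (1 / y2\<^sup>2) * (real_of_int d + X2 u (a, b))\<^sup>2)"
  have "Q4 u = (\<lambda>(v, m). q v + (1 / y1\<^sup>2) * (real_of_int m + X3 u v)\<^sup>2)"
    by (auto simp: Q4_def q_def fun_eq_iff)
  then have "ntheta (Q4 u) t =
     (\<integral>\<^sup>+v. ennreal (exp (- (pi * t * q v))) * ennreal (gauss (1 / y1\<^sup>2 * t) (X3 u v)) \<partial>count_space UNIV)"
    using ntheta_extend[of t "1 / y1\<^sup>2" q "X3 u"] assms y1 by simp
  also have "\<dots> = (\<integral>\<^sup>+v. (case v of ((a, b), d) \<Rightarrow> ?T a b d) \<partial>count_space UNIV)"
    by (intro nn_integral_cong)
       (auto simp: q_def ennreal_mult[symmetric] gauss_nonneg exp_add[symmetric] algebra_simps)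
  also have "\<dots> = (\<integral>\<^sup>+a. \<integral>\<^sup>+b. \<integral>\<^sup>+d. ?T a b d \<partial>count_space UNIV \<partial>count_space UNIV \<partial>count_space UNIV)"
    by (subst nn_integral_fst_count_space[symmetric], subst nn_integral_fst_count_space[symmetric]) simp
  finally show ?thesis .
qed

text \<open>
  Rows with \<open>a \<noteq> 0\<close> are averaged in all three coordinates, each integration turning one sum over
  the integers into its mean.  For \<open>a = 0\<close> and \<open>(b, d) \<noteq> 0\<close> only the sum over \<open>c\<close> is shifted, and the
  rows \<open>(0, 0, c, 0)\<close> are fixed by \<open>\<eta>\<close>.  These are the three terms of
  the constant term.
\<close>
lemma nn_integral_cube_theta:
  assumes t: "t > 0"
  shows "(\<integral>\<^sup>+u. ntheta (Q4 u) t \<partial>cube_measure) = ennreal (gauss (t / y1\<^sup>2) 0 +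
     y1 / sqrt t * (theta Q2 t - 1) + y1 / (t * sqrt t) * (gauss (y1\<^sup>2 * t) 0 - 1))"
proof -
  define E1 where "E1 a = ennreal (exp (- (pi * (y1\<^sup>2 * t) * square a)))" for a
  define E2 where "E2 x = ennreal (exp (- (pi * (y2\<^sup>2 * t) * x\<^sup>2)))" for x
  define E3 where "E3 x = ennreal (exp (- (pi * (t / y2\<^sup>2) * x\<^sup>2)))" for x
  define E4 where "E4 x = ennreal (gauss (t / y1\<^sup>2) x)" for x
  have E_meas [measurable]: "E2 \<in> borel_measurable borel" "E3 \<in> borel_measurable borel" "E4 \<in> borel_measurable borel"
    unfolding E2_def E3_def E4_def by measurable
  define \<kappa>2 where "\<kappa>2 = ennreal (1 / sqrt (y2\<^sup>2 * t))"
  define \<kappa>3 where "\<kappa>3 = ennreal (1 / sqrt (t / y2\<^sup>2))"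
  define \<kappa>4 where "\<kappa>4 = ennreal (1 / sqrt (t / y1\<^sup>2))"
  have pos: "y2\<^sup>2 * t > 0" "t / y2\<^sup>2 > 0" "t / y1\<^sup>2 > 0" "y1\<^sup>2 * t > 0" using t y1 y2 by auto
  have avg2: "unit_avg (\<lambda>u. \<integral>\<^sup>+b. E2 (real_of_int b + (of_int a * u + x)) \<partial>count_space UNIV) = \<kappa>2"
    and avg3: "unit_avg (\<lambda>u. \<integral>\<^sup>+d. E3 (real_of_int d + (of_int a * u + x)) \<partial>count_space UNIV) = \<kappa>3"
    and avg4: "unit_avg (\<lambda>u. E4 (of_int a * u + x)) = \<kappa>4"
    if "a \<noteq> 0" for a x
    using unit_avg_gauss[OF pos(1) that, of x] unit_avg_gauss[OF pos(2) that, of x] unit_avg_gauss[OF pos(3) that, of x]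
    unfolding E2_def E3_def E4_def \<kappa>2_def \<kappa>3_def \<kappa>4_def nn_gauss[OF pos(1)] nn_gauss[OF pos(2)]
    by (simp_all only:)
  define T where "T a b d u = E1 a * (E2 (real_of_int b + X1 u a) * (E3 (real_of_int d + X2 u (a, b)) * E4 (X3 u ((a, b), d))))" for a b d u
  have X_meas [measurable]: "(\<lambda>u. X1 u a) \<in> borel_measurable borel" "(\<lambda>u. X2 u (a, b)) \<in> borel_measurable borel"
    "(\<lambda>u. X3 u ((a, b), d)) \<in> borel_measurable borel" for a b d
    unfolding X1_def X2_def X3_def case_prod_unfold
    by (intro borel_measurable_continuous_onI continuous_intros)+
  have T_meas [measurable]: "T a b d \<in> borel_measurable borel" for a b d
    unfolding T_def by measurable
  have T_meas' [measurable]: "T a b d \<in> borel_measurable cube_measure" for a b d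
    by (rule measurable_cube) measurable
  define S where "S a = (\<integral>\<^sup>+b. \<integral>\<^sup>+d. (\<integral>\<^sup>+u. T a b d u \<partial>cube_measure) \<partial>count_space UNIV \<partial>count_space UNIV)" for a
  have "(\<integral>\<^sup>+u. ntheta (Q4 u) t \<partial>cube_measure) =
      (\<integral>\<^sup>+u. \<integral>\<^sup>+a. \<integral>\<^sup>+b. \<integral>\<^sup>+d. T a b d u \<partial>count_space UNIV \<partial>count_space UNIV \<partial>count_space UNIV \<partial>cube_measure)"
    unfolding ntheta_Q4[OF t] T_def E1_def E2_def E3_def E4_def ..
  also have "\<dots> = (\<integral>\<^sup>+a. \<integral>\<^sup>+u. \<integral>\<^sup>+b. \<integral>\<^sup>+d. T a b d u \<partial>count_space UNIV \<partial>count_space UNIV \<partial>cube_measure \<partial>count_space UNIV)"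
    by (intro nn_integral_count_space_nn_integral measurable_nn_integral_count_space T_meas') auto
  also have "\<dots> = (\<integral>\<^sup>+a. \<integral>\<^sup>+b. \<integral>\<^sup>+u. \<integral>\<^sup>+d. T a b d u \<partial>count_space UNIV \<partial>cube_measure \<partial>count_space UNIV \<partial>count_space UNIV)"
    by (intro nn_integral_cong nn_integral_count_space_nn_integral measurable_nn_integral_count_space T_meas') auto
  also have "\<dots> = (\<integral>\<^sup>+a. S a \<partial>count_space UNIV)"
    unfolding S_def
    by (intro nn_integral_cong nn_integral_count_space_nn_integral measurable_nn_integral_count_space T_meas') auto
  also have "\<dots> = S 0 + (\<integral>\<^sup>+a. (if a = 0 then 0 else S a) \<partial>count_space UNIV)"
    by (rule nn_integral_count_space_split)
  finally have total: "(\<integral>\<^sup>+u. ntheta (Q4 u) t \<partial>cube_measure) = \<dots>" .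

  have S_a: "S a = E1 a * (\<kappa>2 * \<kappa>3 * \<kappa>4)" if a: "a \<noteq> 0" for a
  proof -
    define Z where "Z b u1 = of_int a * (n1 * n5 + n4) + (of_int a * u1 + of_int b) * n5" for b :: int and u1
    have Z_meas [measurable]: "Z b \<in> borel_measurable borel" for b unfolding Z_def by measurable
    have "(\<integral>\<^sup>+u. T a b d u \<partial>cube_measure) =
      unit_avg (\<lambda>u1. (E1 a * \<kappa>4 * E2 (real_of_int b + (of_int a * u1 + of_int a * n1))) *
         unit_avg (\<lambda>u3. E3 (real_of_int d + (of_int a * u3 + Z b u1))))" for b d
      unfolding nn_integral_cube[OF T_meas]
      unfolding T_def X1_def X2_def X3_def case_prod_conv Z_def
      by (simp add: unit_avg_cmult avg4[OF a] flip: mult.assoc)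
         (simp add: unit_avg_cmult mult_ac)
    then have "S a = (\<integral>\<^sup>+b. \<integral>\<^sup>+d. unit_avg (\<lambda>u1. (E1 a * \<kappa>4 * E2 (real_of_int b + (of_int a * u1 + of_int a * n1))) *
         unit_avg (\<lambda>u3. E3 (real_of_int d + (of_int a * u3 + Z b u1)))) \<partial>count_space UNIV \<partial>count_space UNIV)"
      by (simp add: S_def)
    also have "\<dots> = (\<integral>\<^sup>+b. unit_avg (\<lambda>u1. \<integral>\<^sup>+d. (E1 a * \<kappa>4 * E2 (real_of_int b + (of_int a * u1 + of_int a * n1))) *
         unit_avg (\<lambda>u3. E3 (real_of_int d + (of_int a * u3 + Z b u1))) \<partial>count_space UNIV) \<partial>count_space UNIV)"
      by (intro nn_integral_cong unit_avg_sum) (simp add: unit_avg_def)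
    also have "\<dots> = (\<integral>\<^sup>+b. unit_avg (\<lambda>u1. (E1 a * \<kappa>4 * \<kappa>3) * E2 (real_of_int b + (of_int a * u1 + of_int a * n1))) \<partial>count_space UNIV)"
      by (intro nn_integral_cong arg_cong[where f = unit_avg] ext)
         (simp add: nn_integral_cmult unit_avg_sum avg3[OF a], simp add: mult_ac)
    also have "\<dots> = (E1 a * \<kappa>4 * \<kappa>3) * \<kappa>2"
      by (simp add: unit_avg_cmult nn_integral_cmult unit_avg_sum avg2[OF a])
    finally show ?thesis by (simp add: mult_ac)
  qed

  have S_0: "S 0 = E4 0 + ennreal (theta Q2 t - 1) * \<kappa>4"
  proof -
    define e where "e p = ennreal (exp (- (pi * t * Q2 p)))" for p
    have e: "E2 (of_int b) * E3 (of_int d + of_int b * n5) = e (b, d)" for b d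
      by (simp add: e_def E2_def E3_def Q2_def square_def ennreal_mult[symmetric] exp_add[symmetric] algebra_simps)
    have T0: "(\<integral>\<^sup>+u. T 0 b d u \<partial>cube_measure) = e (b, d) *
       unit_avg (\<lambda>u1. unit_avg (\<lambda>u3. E4 (of_int b * u3 - of_int d * u1 + (of_int b * n4 - of_int d * n1))))" for b d
    proof -
      have "(\<integral>\<^sup>+u. T 0 b d u \<partial>cube_measure) = unit_avg (\<lambda>u1. unit_avg (\<lambda>u3. e (b, d) *
          E4 (of_int b * u3 - of_int d * u1 + (of_int b * n4 - of_int d * n1))))"
        unfolding nn_integral_cube[OF T_meas]
      unfolding T_def X1_def X2_def X3_def case_prod_conv
        by (simp add: E1_def square_def e[symmetric] mult.assoc diff_add_eq add_diff_eq)
      moreover have "(\<lambda>u1. unit_avg (\<lambda>u3. E4 (of_int b * u3 - of_int d * u1 +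
          (of_int b * n4 - of_int d * n1)))) \<in> borel_measurable borel"
        unfolding unit_avg_def by measurable
      ultimately show ?thesis by (simp add: unit_avg_cmult)
    qed
    have T1: "(\<integral>\<^sup>+u. T 0 b d u \<partial>cube_measure) = e (b, d) * \<kappa>4" if "(b, d) \<noteq> (0, 0)" for b d
    proof (cases "b = 0")
      case False
      have "unit_avg (\<lambda>u3. E4 (of_int b * u3 - of_int d * u1 + (of_int b * n4 - of_int d * n1))) = \<kappa>4" for u1
        using avg4[OF False, of "- of_int d * u1 + (of_int b * n4 - of_int d * n1)"] by (simp add: algebra_simps)
      then show ?thesis by (simp add: T0)
    next
      case True
      with that have "- d \<noteq> 0" by auto
      from avg4[OF this, of "- of_int d * n1"] show ?thesis by (simp add: T0 True)
    qed
    have "S 0 = (\<integral>\<^sup>+p. (case p of (b, d) \<Rightarrow> \<integral>\<^sup>+u. T 0 b d u \<partial>cube_measure) \<partial>count_space UNIV)"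
      unfolding S_def by (subst nn_integral_fst_count_space[symmetric]) simp
    also have "\<dots> = (\<integral>\<^sup>+u. T 0 0 0 u \<partial>cube_measure) +
       (\<integral>\<^sup>+p. (if p = (0, 0) then 0 else case p of (b, d) \<Rightarrow> \<integral>\<^sup>+u. T 0 b d u \<partial>cube_measure) \<partial>count_space UNIV)"
      by (subst nn_integral_count_space_split[of _ "(0, 0)"]) simp
    also have "(\<integral>\<^sup>+u. T 0 0 0 u \<partial>cube_measure) = E4 0"
      by (simp add: T0 e_def Q2_def square_def)
    also have "(\<integral>\<^sup>+p. (if p = (0, 0) then 0 else case p of (b, d) \<Rightarrow> \<integral>\<^sup>+u. T 0 b d u \<partial>cube_measure) \<partial>count_space UNIV)
      = (\<integral>\<^sup>+p. (if p = (0, 0) then 0 else e p) * \<kappa>4 \<partial>count_space UNIV)"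
      by (intro nn_integral_cong) (use T1 in auto)
    also have "\<dots> = ennreal (theta Q2 t - 1) * \<kappa>4"
      unfolding e_def using nn_integral_theta_minus_1[OF Q2_controlled cmin(1) t]
      by (subst nn_integral_multc) auto
    finally show ?thesis .
  qed

  have "(\<integral>\<^sup>+a. (if a = 0 then 0 else S a) \<partial>count_space UNIV) =
      (\<integral>\<^sup>+a. (if a = 0 then 0 else E1 a) * (\<kappa>2 * \<kappa>3 * \<kappa>4) \<partial>count_space UNIV)"
    by (intro nn_integral_cong) (auto simp: S_a)
  also have "\<dots> = ennreal (theta square (y1\<^sup>2 * t) - 1) * (\<kappa>2 * \<kappa>3 * \<kappa>4)"
    unfolding E1_def using nn_integral_theta_minus_1[OF theta_controlled_square _ pos(4)]
    by (subst nn_integral_multc) auto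
  also have "\<kappa>2 * \<kappa>3 * \<kappa>4 = ennreal (y1 / (t * sqrt t))"
    using t y1 y2 by (simp add: \<kappa>2_def \<kappa>3_def \<kappa>4_def ennreal_mult[symmetric] real_sqrt_mult real_sqrt_divide)
  finally have S_rest: "(\<integral>\<^sup>+a. (if a = 0 then 0 else S a) \<partial>count_space UNIV) =
     ennreal (gauss (y1\<^sup>2 * t) 0 - 1) * ennreal (y1 / (t * sqrt t))" by (simp add: theta_square)
  have \<kappa>4: "\<kappa>4 = ennreal (y1 / sqrt t)" using y1 by (simp add: \<kappa>4_def real_sqrt_divide)
  have "theta Q2 t \<ge> 1" by (rule theta_ge_1[OF Q2_controlled cmin(1) t])
  moreover have "gauss (y1\<^sup>2 * t) 0 \<ge> 1"
    using theta_ge_1[OF theta_controlled_square _ pos(4)] by (simp add: theta_square)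
  ultimately show ?thesis
    unfolding total S_0 S_rest \<kappa>4 E4_def using t y1 gauss_nonneg[of "t / y1\<^sup>2" 0]
    by (simp add: ennreal_mult[symmetric] ennreal_plus[symmetric] mult.commute del: ennreal_plus)
qed

end

section \<open>The constant term of the completed series\<close>

text \<open>Up to a change of variable and a factor \<open>2\<close>, the completed zeta function.\<close>
abbreviation \<Xi>1 :: "complex \<Rightarrow> complex" where
  "\<Xi>1 \<equiv> completed 1 (1 / 2) (theta square)"

lemma powr_of_real_powr:
  assumes "y > 0"
  shows "complex_of_real (y powr b) powr z = of_real y powr (of_real b * z)"
  using assms by (simp add: powr_def Ln_of_real ln_powr flip: of_real_mult) (simp add: mult_ac)

lemma rapid_square: "rapid (remainder 1 (1 / 2) (theta square))"
  using rapid_remainder_theta[OF theta_controlled_square] by simp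

context iwasawa_point
begin

definition average :: "real \<Rightarrow> real" where
  "average t = (\<integral>u. theta (Q4 u) t \<partial>cube_measure)"

lemma theta_Q4_measurable: "(\<lambda>(u, t). theta (Q4 u) t) \<in> borel_measurable (cube_measure \<Otimes>\<^sub>M borel)"
proof -
  have [measurable]: "(\<lambda>u. Q4 u v) \<in> borel_measurable cube_measure" for v
    by (rule measurable_cube) measurable
  have "(\<lambda>p. \<integral>v. exp (- (pi * snd p * Q4 (fst p) v)) \<partial>count_space UNIV) \<in> borel_measurable (cube_measure \<Otimes>\<^sub>M borel)"
    by (rule measurable_integral_count_space) measurable
  then show ?thesis by (simp add: theta_def case_prod_unfold)
qed

lemma theta_Q4_measurable1 [measurable]: "(\<lambda>u. theta (Q4 u) t) \<in> borel_measurable cube_measure"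
  using measurable_Pair1[OF theta_Q4_measurable, of t] by simp

lemma average_eq:
  assumes t: "t > 0"
  shows "integrable cube_measure (\<lambda>u. theta (Q4 u) t)"
    and "average t = theta square (1 / y1\<^sup>2 * t) + y1 * (t powr (- 1 / 2) * (theta Q2 t - 1))
       + y1 * (t powr (- 3 / 2) * (theta square (y1\<^sup>2 * t) - 1))"
proof -
  let ?A = "gauss (t / y1\<^sup>2) 0 + y1 / sqrt t * (theta Q2 t - 1) + y1 / (t * sqrt t) * (gauss (y1\<^sup>2 * t) 0 - 1)"
  have nn: "(\<integral>\<^sup>+u. ennreal (theta (Q4 u) t) \<partial>cube_measure) = ennreal ?A"
    using nn_integral_cube_theta[OF t] theta_controlled_integrable(2)[OF Q4_controlled cmin(1) t] by simp
  then show int: "integrable cube_measure (\<lambda>u. theta (Q4 u) t)"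
    by (intro integrableI_nonneg) (auto simp: theta_nonneg)
  have "theta Q2 t \<ge> 1" by (rule theta_ge_1[OF Q2_controlled cmin(1) t])
  moreover have "gauss (y1\<^sup>2 * t) 0 \<ge> 1"
    using theta_ge_1[OF theta_controlled_square, of "y1\<^sup>2 * t"] t y1 by (simp add: theta_square)
  ultimately have "?A \<ge> 0" using t y1 gauss_nonneg[of "t / y1\<^sup>2" 0] by (intro add_nonneg_nonneg mult_nonneg_nonneg) auto
  then have "average t = ?A"
    using nn unfolding average_def by (subst integral_eq_nn_integral) (auto simp: theta_nonneg)
  moreover have "t powr (- 1 / 2) = 1 / sqrt t" using t by (simp add: powr_minus_divide powr_half_sqrt)
  moreover have "t powr (- 3 / 2) = 1 / (t * sqrt t)"
  proof -
    have "t powr (3 / 2) = t powr 1 * t powr (1 / 2)" using powr_add[of t 1 "1 / 2"] by simp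
    then show ?thesis using t by (simp add: powr_minus_divide powr_half_sqrt)
  qed
  ultimately show "average t = theta square (1 / y1\<^sup>2 * t) + y1 * (t powr (- 1 / 2) * (theta Q2 t - 1))
       + y1 * (t powr (- 3 / 2) * (theta square (y1\<^sup>2 * t) - 1))"
    by (simp add: theta_square)
qed

abbreviation "rem4 u \<equiv> remainder 1 2 (theta (Q4 u))"

lemma remainder_bound: "\<exists>K. \<forall>u\<in>A. \<forall>t>0. \<bar>rem4 u t\<bar> \<le> K * t powr a"
proof -
  obtain B where "\<forall>q :: ((int \<times> int) \<times> int) \<times> int \<Rightarrow> real. theta_controlled 4 1 cmin K4 (((0, 0), 0), 0) q \<longrightarrow>
      (\<forall>t>0. \<bar>remainder (1 / 1) (real 4 / 2) (theta q) t\<bar> \<le> B * t powr a)"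
    using remainder_theta_bound[OF cmin(1) zero_less_one] by metis
  then have "\<bar>rem4 u t\<bar> \<le> B * t powr a" if "t > 0" for u t
    using Q4_controlled[of u] that by simp
  then show ?thesis by blast
qed

lemma remainder_Q4_measurable: "(\<lambda>(u, t). rem4 u t) \<in> borel_measurable (cube_measure \<Otimes>\<^sub>M borel)"
proof -
  have [measurable]: "(\<lambda>p. theta (Q4 (fst p)) (snd p)) \<in> borel_measurable (cube_measure \<Otimes>\<^sub>M borel)"
    using theta_Q4_measurable by (simp add: case_prod_unfold)
  show ?thesis unfolding remainder_def case_prod_unfold by measurable
qed

lemma remainder_average:
  assumes "t > 0"
  shows "remainder 1 2 average t = (\<integral>u. rem4 u t \<partial>cube_measure)"
proof -
  interpret prob_space cube_measure by (rule prob_space_cube)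
  show ?thesis using average_eq(1)[OF assms] by (simp add: remainder_def average_def prob_space)
qed

lemma average_measurable: "average \<in> borel_measurable borel"
proof -
  interpret prob_space cube_measure by (rule prob_space_cube)
  have "(\<lambda>(t, u). theta (Q4 u) t) \<in> borel_measurable (borel \<Otimes>\<^sub>M cube_measure)"
    using theta_Q4_measurable by (subst measurable_pair_swap_iff) (simp add: case_prod_unfold)
  then show ?thesis unfolding average_def[abs_def] by (rule borel_measurable_lebesgue_integral)
qed

lemma rapid_remainder_average: "rapid (remainder 1 2 average)"
  unfolding rapid_def
proof (intro conjI allI)
  interpret prob_space cube_measure by (rule prob_space_cube)
  fix a
  obtain K where K: "\<And>u t. t > 0 \<Longrightarrow> \<bar>rem4 u t\<bar> \<le> K * t powr a"
    using remainder_bound[of UNIV a] by auto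
  have "\<bar>remainder 1 2 average t\<bar> \<le> K * t powr a" if t: "t > 0" for t
  proof -
    have int: "integrable cube_measure (\<lambda>u. rem4 u t)"
      using average_eq(1)[OF t] by (simp add: remainder_def)
    have "\<bar>remainder 1 2 average t\<bar> \<le> (\<integral>u. \<bar>rem4 u t\<bar> \<partial>cube_measure)"
      unfolding remainder_average[OF t] by (rule integral_abs_bound)
    also have "\<dots> \<le> (\<integral>u. K * t powr a \<partial>cube_measure)"
      by (rule integral_mono) (use int K[OF t] in auto)
    also have "\<dots> = K * t powr a" by (simp add: prob_space)
    finally show ?thesis .
  qed
  then show "\<exists>K. \<forall>t>0. \<bar>remainder 1 2 average t\<bar> \<le> K * t powr a" by blast
qed (rule remainder_measurable[OF average_measurable])

text \<open>
  The two polar terms do not depend on \<open>u\<close> and the rest is a Mellin transform that converges for every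
  \<open>s\<close>, so the average may be taken inside also where the series itself diverges.
\<close>
lemma completed_average:
  "(\<integral>u. completed 1 2 (theta (Q4 u)) s \<partial>cube_measure) = completed 1 2 average s"
proof -
  interpret prob_space cube_measure by (rule prob_space_cube)
  note avg = mellin_average[OF finite_measure_axioms remainder_Q4_measurable remainder_bound, of s]
  have "(\<integral>u. completed 1 2 (theta (Q4 u)) s \<partial>cube_measure) =
      (\<integral>u. mellin (rem4 u) s + (1 / (s - 2) - 1 / s) \<partial>cube_measure)"
    by (simp add: completed_def add_diff_eq)
  also have "\<dots> = (\<integral>u. mellin (rem4 u) s \<partial>cube_measure) + (1 / (s - 2) - 1 / s)"
    using avg(1) by (simp add: prob_space)
  also have "(\<integral>u. mellin (rem4 u) s \<partial>cube_measure) = mellin (remainder 1 2 average) s"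
    unfolding avg(2) by (rule mellin_cong(1)) (simp add: remainder_average)
  finally show ?thesis by (simp add: completed_def add_diff_eq)
qed

abbreviation "\<Xi>2 \<equiv> completed 1 1 (theta Q2)"

lemma rapid_Q2: "rapid (remainder 1 1 (theta Q2))"
  using rapid_remainder_theta[OF Q2_controlled cmin(1)] by simp

lemma rapid_Q4: "rapid (rem4 u)"
  using rapid_remainder_theta[OF Q4_controlled cmin(1)] by simp

lemma completed_average_eq_halfplane:
  assumes s: "Re s > 2"
  shows "completed 1 2 average s = of_real y1 powr (2 * s) * \<Xi>1 s + of_real y1 * \<Xi>2 (s - 1 / 2)
     + of_real y1 powr (4 - 2 * s) * \<Xi>1 (s - 3 / 2)"
proof -
  let ?T1 = "\<lambda>t. theta square t - 1" and ?T2 = "\<lambda>t. theta Q2 t - 1"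
  have sh: "s + of_real (- 1 / 2) = s - 1 / 2" "s + of_real (- 3 / 2) = s - 3 / 2" by auto
  note c1 = completed_eq_mellin[OF rapid_square, of s]
  note c2 = completed_eq_mellin[OF rapid_Q2, of "s - 1 / 2"]
  note c3 = completed_eq_mellin[OF rapid_square, of "s - 3 / 2"]
  have Re: "Re (s - 1 / 2) > 1" "Re (s - 1 / 2) > 0" "Re (s - 3 / 2) > 1 / 2" "Re (s - 3 / 2) > 0"
    "Re s > 1 / 2" "Re s > 0" using s by auto
  define A where "A = (\<lambda>t. ?T1 (1 / y1\<^sup>2 * t))"
  define B where "B = (\<lambda>t. t powr (- 1 / 2) * ?T2 t)"
  define C where "C = (\<lambda>t. t powr (- 3 / 2) * ?T1 (y1\<^sup>2 * t))"
  have y2: "1 / y1\<^sup>2 > 0" "y1\<^sup>2 > 0" using y1 by auto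
  have A: "mellin A s = of_real (1 / y1\<^sup>2) powr (- s) * \<Xi>1 s" "mellin_integrable A s"
    unfolding A_def using mellin_scale[OF y2(1), of ?T1 s] c1 Re by simp_all
  have B: "mellin B s = \<Xi>2 (s - 1 / 2)" "mellin_integrable B s"
    unfolding B_def mellin_times_powr sh using c2 Re by simp_all
  have C: "mellin C s = of_real (y1\<^sup>2) powr (- (s - 3 / 2)) * \<Xi>1 (s - 3 / 2)" "mellin_integrable C s"
    unfolding C_def mellin_times_powr sh using mellin_scale[OF y2(2), of ?T1 "s - 3 / 2"] c3 Re by simp_all
  note B' = mellin_cmult[OF B(2), of y1] and C' = mellin_cmult[OF C(2), of y1]
  note BC = mellin_add[OF B'(2) C'(2)]
  have "completed 1 2 average s = mellin (\<lambda>t. average t - 1) s"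
    using completed_eq_mellin(1)[OF rapid_remainder_average] s by simp
  also have "\<dots> = mellin (\<lambda>t. A t + (y1 * B t + y1 * C t)) s"
    by (rule mellin_cong(1)) (simp add: average_eq(2) A_def B_def C_def)
  also have "\<dots> = mellin A s + (of_real y1 * mellin B s + of_real y1 * mellin C s)"
    unfolding mellin_add(1)[OF A(2) BC(2)] BC(1) B'(1) C'(1) ..
  also have "\<dots> = of_real (1 / y1\<^sup>2) powr (- s) * \<Xi>1 s + of_real y1 * \<Xi>2 (s - 1 / 2)
     + (of_real y1 * of_real (y1\<^sup>2) powr (- (s - 3 / 2))) * \<Xi>1 (s - 3 / 2)"
    unfolding A(1) B(1) C(1) by simp
  also have "of_real (1 / y1\<^sup>2) powr (- s) = (of_real y1 powr (2 * s) :: complex)"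
    using powr_of_real_powr[OF y1, of "- 2" "- s"] y1 by (simp add: powr_minus_divide powr_numeral)
  also have "of_real y1 * of_real (y1\<^sup>2) powr (- (s - 3 / 2)) = (of_real y1 powr (4 - 2 * s) :: complex)"
  proof -
    have "of_real (y1\<^sup>2) powr (- (s - 3 / 2)) = (of_real y1 powr (3 - 2 * s) :: complex)"
      using powr_of_real_powr[OF y1, of 2 "- (s - 3 / 2)"] y1 by (simp add: powr_numeral algebra_simps)
    then have "of_real y1 * of_real (y1\<^sup>2) powr (- (s - 3 / 2)) = of_real y1 powr 1 * (of_real y1 powr (3 - 2 * s) :: complex)"
      using y1 by simp
    also have "\<dots> = of_real y1 powr (4 - 2 * s)" unfolding powr_add[symmetric] by simp
    finally show ?thesis .
  qed
  finally show ?thesis .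
qed

lemma meromorphic_compose_affine:
  assumes "f meromorphic_on UNIV"
  shows "(\<lambda>s. f (a * s + b)) meromorphic_on UNIV"
  by (rule meromorphic_on_compose[OF assms]) (auto intro!: analytic_intros)

text \<open>
  The rescaled arguments and powers of \<open>t\<close> in the averaged theta series become powers of \<open>y1\<close> and
  shifts of \<open>s\<close> under the Mellin transform.
\<close>
lemma completed_constant_term:
  "\<forall>\<^sub>\<approx>s. (\<integral>u. completed 1 2 (theta (Q4 u)) s \<partial>cube_measure) =
     of_real y1 powr (2 * s) * \<Xi>1 s + of_real y1 * \<Xi>2 (s - 1 / 2)
     + of_real y1 powr (4 - 2 * s) * \<Xi>1 (s - 3 / 2)"
  unfolding completed_average
proof (rule meromorphic_eq_if_eq_on_halfplane[of _ _ 2])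
  have "(\<lambda>s. \<Xi>2 (1 * s + (- 1 / 2))) meromorphic_on UNIV" "(\<lambda>s. \<Xi>1 (1 * s + (- 3 / 2))) meromorphic_on UNIV"
    by (intro meromorphic_compose_affine completed_meromorphic rapid_Q2 rapid_square)+
  moreover have "(\<lambda>s. of_real y1 powr (c + d * s)) meromorphic_on UNIV" for c d :: complex
    using y1 by (intro analytic_on_imp_meromorphic_on analytic_intros) auto
  from this[of 0 2] this[of 4 "- 2"]
  have "(\<lambda>s. of_real y1 powr (2 * s)) meromorphic_on UNIV" "(\<lambda>s. of_real y1 powr (4 - 2 * s)) meromorphic_on UNIV"
    by simp_all
  ultimately show "(\<lambda>s. of_real y1 powr (2 * s) * \<Xi>1 s + of_real y1 * \<Xi>2 (s - 1 / 2)
     + of_real y1 powr (4 - 2 * s) * \<Xi>1 (s - 3 / 2)) meromorphic_on UNIV"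
    by (intro meromorphic_intros completed_meromorphic rapid_square) simp_all
qed (auto intro: completed_meromorphic rapid_remainder_average completed_average_eq_halfplane)

end

section \<open>The zeta function\<close>

definition zeta_series :: "complex \<Rightarrow> complex" where
  "zeta_series s = (\<Sum>n. 1 / of_nat (Suc n) powr s)"

lemma zeta_series_integrable:
  assumes "Re s > 1"
  shows "integrable (count_space UNIV) (\<lambda>n. 1 / of_nat (Suc n) powr s :: complex)"
    and "zeta_series s = (\<integral>n. 1 / of_nat (Suc n) powr s \<partial>count_space UNIV)"
proof -
  have "summable (\<lambda>n. real (Suc n) powr - Re s)"
    using assms by (subst summable_Suc_iff[of "\<lambda>n. real n powr - Re s"]) (simp add: summable_real_powr_iff)
  moreover have "norm (1 / of_nat (Suc n) powr s :: complex) = real (Suc n) powr - Re s" for n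
    using norm_of_real_powr[of "real (Suc n)" s] by (simp add: norm_divide powr_minus_divide)
  ultimately show int: "integrable (count_space UNIV) (\<lambda>n. 1 / of_nat (Suc n) powr s :: complex)"
    unfolding integrable_count_space_nat_iff by simp
  show "zeta_series s = (\<integral>n. 1 / of_nat (Suc n) powr s \<partial>count_space UNIV)"
    unfolding zeta_series_def by (rule integral_count_space_nat[OF int, symmetric])
qed

text \<open>
  When the real part is at least \<open>2\<close>, the terms after the first contribute at most \<open>\<pi>\<^sup>2/6 - 1 < 1\<close>
  in absolute value.
\<close>
lemma zeta_series_nonzero:
  assumes "Re s \<ge> 2"
  shows "zeta_series s \<noteq> 0"
proof
  assume "zeta_series s = 0"
  let ?f = "\<lambda>n. 1 / of_nat (Suc n) powr s :: complex"
  have bd: "norm (?f (Suc n)) \<le> 1 / (real (Suc n) + 1)\<^sup>2" for n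
  proof -
    have "norm (?f (Suc n)) = 1 / real (Suc (Suc n)) powr Re s"
      using norm_of_real_powr[of "real (Suc (Suc n))" s] by (simp add: norm_divide)
    also have "\<dots> \<le> 1 / real (Suc (Suc n)) powr 2"
      using assms by (intro divide_left_mono powr_mono mult_pos_pos) auto
    also have "real (Suc (Suc n)) powr 2 = (real (Suc n) + 1)\<^sup>2" by (simp add: powr_numeral add_ac)
    finally show ?thesis .
  qed
  have "(\<lambda>n. 1 / (real n + 1)\<^sup>2) sums (pi\<^sup>2 / 6)"
    using inverse_squares_sums by (simp add: add.commute)
  then have sq: "(\<lambda>n. 1 / (real (Suc n) + 1)\<^sup>2) sums (pi\<^sup>2 / 6 - 1)"
    by (subst sums_Suc_iff) simp
  have sm: "summable (\<lambda>n. norm (?f (Suc n)))"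
    by (intro summable_comparison_test'[OF sums_summable[OF sq]]) (use bd in auto)
  then have s: "summable ?f" by (subst summable_Suc_iff[symmetric]) (rule summable_norm_cancel)
  have "norm (\<Sum>n. ?f (Suc n)) \<le> (\<Sum>n. norm (?f (Suc n)))" by (rule summable_norm[OF sm])
  also have "\<dots> \<le> (\<Sum>n. 1 / (real (Suc n) + 1)\<^sup>2)"
    by (intro suminf_le bd sm sums_summable[OF sq])
  also have "\<dots> = pi\<^sup>2 / 6 - 1" using sq by (rule sums_unique[symmetric])
  also have "\<dots> < 1"
  proof -
    have "pi\<^sup>2 \<le> (32 / 10)\<^sup>2" using pi_approx(2) pi_gt_zero by (intro power_mono) auto
    then show ?thesis by (simp add: power2_eq_square)
  qed
  finally have "norm (\<Sum>n. ?f (Suc n)) < 1" .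
  moreover have "zeta_series s = ?f 0 + (\<Sum>n. ?f (Suc n))"
    unfolding zeta_series_def using suminf_split_head[OF s] by simp
  then have "(\<Sum>n. ?f (Suc n)) = - 1" using \<open>zeta_series s = 0\<close> by (simp add: add_eq_0_iff)
  ultimately show False by simp
qed

section \<open>Primitive vectors\<close>

text \<open>Every nonzero vector is a positive multiple of a unique primitive vector.\<close>
lemma dirichlet_primitive:
  fixes q :: "'v::countable \<Rightarrow> real"
  assumes bij: "bij_betw (\<lambda>(k, v). mul (Suc k) v) (UNIV \<times> P) (- {z})"
    and hom: "\<And>k v. q (mul k v) = (real k)\<^sup>2 * q v" and pos: "\<And>v. v \<noteq> z \<Longrightarrow> q v > 0"
    and int: "integrable (count_space UNIV) (\<lambda>v. if v = z then 0 else of_real (q v) powr (- s) :: complex)"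
    and s: "Re s > 1 / 2"
  shows "integrable (count_space P) (\<lambda>v. of_real (q v) powr (- s) :: complex)"
    and "dirichlet q z s = zeta_series (2 * s) * (\<integral>v. of_real (q v) powr (- s) \<partial>count_space P)"
proof -
  have P: "countable P" by simp
  interpret A: sigma_finite_measure "count_space P"
    by (rule sigma_finite_measure_count_space_countable[OF P])
  interpret B: sigma_finite_measure "count_space (UNIV :: nat set)"
    by (rule sigma_finite_measure_count_space_countable) auto
  interpret AB: pair_sigma_finite "count_space (UNIV :: nat set)" "count_space P" by standard
  let ?F = "\<lambda>v. of_real (q v) powr (- s) :: complex"
  let ?G = "\<lambda>(k, v). 1 / of_nat (Suc k) powr (2 * s) * ?F v"
  have restr: "(\<lambda>v. if v = z then 0 else ?F v) = (\<lambda>v. indicator (- {z}) v *\<^sub>R ?F v)"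
    by (auto simp: fun_eq_iff)
  have cs: "count_space (- {z}) = restrict_space (count_space UNIV) (- {z})"
    by (simp add: restrict_count_space)
  have int': "integrable (count_space (- {z})) ?F"
    using int unfolding restr by (simp add: cs integrable_restrict_space)
  have G: "?F (case p of (k, v) \<Rightarrow> mul (Suc k) v) = ?G p" if "p \<in> UNIV \<times> P" for p
  proof -
    obtain k v where p: "p = (k, v)" by (cases p)
    have "(\<lambda>(k, v). mul (Suc k) v) (0::nat, v) \<in> - {z}"
      using bij_betwE[OF bij] that by (auto simp: p)
    then have "q v > 0" using pos[of "mul (Suc 0) v"] hom[of "Suc 0" v] by simp
    then have "?F (mul (Suc k) v) = of_real ((real (Suc k)) powr 2) powr (- s) * ?F v"
      unfolding hom by (subst of_real_mult, subst powr_times_real) (auto simp: powr_numeral)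
    also have "of_real ((real (Suc k)) powr 2) powr (- s) = (1 / of_nat (Suc k) powr (2 * s) :: complex)"
      by (subst powr_of_real_powr) (auto simp: powr_minus_divide)
    finally show ?thesis by (simp add: p)
  qed
  have "integrable (count_space (UNIV \<times> P)) (\<lambda>p. ?F (case p of (k, v) \<Rightarrow> mul (Suc k) v))"
    using integrable_bij_count_space[OF bij, of ?F] int' by simp
  then have "integrable (count_space (UNIV \<times> P)) ?G"
    by (subst (asm) Bochner_Integration.integrable_cong[OF refl G]) auto
  then have intG: "integrable (count_space (UNIV :: nat set) \<Otimes>\<^sub>M count_space P) ?G"
    using P by (simp add: pair_measure_countable)
  have "AE k in count_space (UNIV :: nat set). integrable (count_space P) (\<lambda>v. ?G (k, v))"
    by (rule AB.AE_integrable_fst'[OF intG])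
  then have "integrable (count_space P) (\<lambda>v. ?G (0, v))" unfolding AE_count_space by blast
  then show "integrable (count_space P) ?F" by simp
  have "dirichlet q z s = (\<integral>v. ?F v \<partial>count_space (- {z}))"
    unfolding dirichlet_def restr by (simp add: cs integral_restrict_space)
  also have "\<dots> = (\<integral>p. ?F (case p of (k, v) \<Rightarrow> mul (Suc k) v) \<partial>count_space (UNIV \<times> P))"
    by (rule integral_bij_count_space[OF bij, symmetric])
  also have "\<dots> = (\<integral>p. ?G p \<partial>count_space (UNIV \<times> P))"
    by (intro Bochner_Integration.integral_cong refl G) auto
  also have "\<dots> = (\<integral>p. ?G p \<partial>(count_space (UNIV :: nat set) \<Otimes>\<^sub>M count_space P))"
    using P by (simp add: pair_measure_countable)
  also have "\<dots> = (\<integral>k. \<integral>v. ?G (k, v) \<partial>count_space P \<partial>count_space UNIV)"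
    by (rule AB.integral_fst'[OF intG, symmetric])
  also have "\<dots> = zeta_series (2 * s) * (\<integral>v. ?F v \<partial>count_space P)"
  proof -
    have "zeta_series (2 * s) = (\<integral>n. 1 / of_nat (Suc n) powr (2 * s) \<partial>count_space UNIV)"
      by (rule zeta_series_integrable(2)) (use s in simp)
    then show ?thesis
      by (simp only: prod.case integral_mult_right_zero integral_mult_left_zero)
  qed
  finally show "dirichlet q z s = zeta_series (2 * s) * (\<integral>v. ?F v \<partial>count_space P)" .
qed

lemma dirichlet_bij:
  assumes f: "bij f" "f z' = z"
  shows "dirichlet (\<lambda>v. q (f v)) z' s = dirichlet q z s"
    and "integrable (count_space UNIV) (\<lambda>v. if v = z' then 0 else of_real (q (f v)) powr (- s) :: complex)
       \<longleftrightarrow> integrable (count_space UNIV) (\<lambda>v. if v = z then 0 else of_real (q v) powr (- s) :: complex)"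
proof -
  let ?h = "\<lambda>v. if v = z then 0 else of_real (q v) powr (- s) :: complex"
  have eq: "(if v = z' then 0 else of_real (q (f v)) powr (- s)) = ?h (f v)" for v
    using f by (auto dest: bij_is_inj injD)
  show "dirichlet (\<lambda>v. q (f v)) z' s = dirichlet q z s"
    unfolding dirichlet_def eq by (rule integral_bij_count_space[OF f(1)])
  show "integrable (count_space UNIV) (\<lambda>v. if v = z' then 0 else of_real (q (f v)) powr (- s) :: complex)
      \<longleftrightarrow> integrable (count_space UNIV) ?h"
    unfolding eq by (rule integrable_bij_count_space[OF f(1)])
qed

definition primitive :: "int^'n \<Rightarrow> bool" where
  "primitive v \<longleftrightarrow> Gcd (range (($) v)) = 1"

lemma bij_betw_primitive:
  "bij_betw (\<lambda>(k, v :: int^'n). of_nat (Suc k) *s v) (UNIV \<times> Collect primitive) (- {0})"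
proof (rule bij_betwI')
  have scale: "Gcd (range (($) (c *s v))) = \<bar>c\<bar> * Gcd (range (($) v))" for c and v :: "int^'n"
  proof -
    have "range (($) (c *s v)) = (*) c ` range (($) v)" by (auto simp: image_image)
    then show ?thesis by (simp add: Gcd_mult abs_mult)
  qed
  fix p p' :: "nat \<times> (int^'n)" assume "p \<in> UNIV \<times> Collect primitive" "p' \<in> UNIV \<times> Collect primitive"
  then obtain k v k' v' where p: "p = (k, v)" "p' = (k', v')" "primitive v" "primitive v'" by auto
  show "((case p of (k, v) \<Rightarrow> of_nat (Suc k) *s v) = (case p' of (k, v) \<Rightarrow> of_nat (Suc k) *s v)) = (p = p')"
  proof
    assume "(case p of (k, v) \<Rightarrow> of_nat (Suc k) *s v) = (case p' of (k, v) \<Rightarrow> of_nat (Suc k) *s v)"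
    then have eq: "of_nat (Suc k) *s v = of_nat (Suc k') *s v'" by (simp add: p)
    have "Gcd (range (($) (of_nat (Suc k) *s v))) = int (Suc k)"
      "Gcd (range (($) (of_nat (Suc k') *s v'))) = int (Suc k')"
      using p unfolding scale primitive_def by simp_all
    with eq have "k = k'" by simp
    with eq have "v = v'" by (simp add: vec_eq_iff del: of_nat_Suc)
    with \<open>k = k'\<close> show "p = p'" by (simp add: p)
  qed simp
next
  fix p :: "nat \<times> (int^'n)" assume "p \<in> UNIV \<times> Collect primitive"
  then obtain k v where p: "p = (k, v)" "primitive v" by auto
  have "v \<noteq> 0" using p by (auto simp: primitive_def)
  then show "(case p of (k, v) \<Rightarrow> of_nat (Suc k) *s v) \<in> - {0}" by (auto simp: p vec_eq_iff simp del: of_nat_Suc)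
next
  fix v :: "int^'n" assume "v \<in> - {0}"
  then obtain i where i: "v $ i \<noteq> 0" by (auto simp: vec_eq_iff)
  define g where "g = Gcd (range (($) v))"
  have "g \<noteq> 0" using i by (auto simp: g_def)
  moreover have "g \<ge> 0" unfolding g_def by simp
  ultimately have g: "g > 0" by simp
  define w where "w = (\<chi> j. v $ j div g)"
  have v: "v $ j = g * w $ j" for j
    using Gcd_dvd[of "v $ j" "range (($) v)"] by (auto simp: w_def g_def)
  have "range (($) v) = (*) g ` range (($) w)" by (auto simp: image_image v)
  then have "g = g * Gcd (range (($) w))"
    using g unfolding g_def[symmetric] by (metis Gcd_mult abs_of_nonneg abs_mult g_def Gcd_int_greater_eq_0 less_imp_le normalize_int_def)
  then have "primitive w" using g by (simp add: primitive_def)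
  moreover have "v = of_nat (Suc (nat (g - 1))) *s w" using g v by (simp add: vec_eq_iff)
  ultimately show "\<exists>p\<in>UNIV \<times> Collect primitive. v = (case p of (k, v) \<Rightarrow> of_nat (Suc k) *s v)"
    by (intro bexI[of _ "(nat (g - 1), w)"]) auto
qed

lemma dirichlet_square:
  assumes s: "Re s > 1 / 2"
  shows "dirichlet square 0 s = 2 * zeta_series (2 * s)"
proof -
  have bij: "bij_betw (\<lambda>(k, v). int (Suc k) * v) (UNIV \<times> {1, - 1}) (- {0})"
  proof (rule bij_betwI')
    fix p p' :: "nat \<times> int" assume "p \<in> UNIV \<times> {1, - 1}" "p' \<in> UNIV \<times> {1, - 1}"
    then show "((case p of (k, v) \<Rightarrow> int (Suc k) * v) = (case p' of (k, v) \<Rightarrow> int (Suc k) * v)) = (p = p')"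
      by auto
  next
    fix m :: int assume "m \<in> - {0}"
    then have "m = int (Suc (nat (\<bar>m\<bar> - 1))) * sgn m" "sgn m \<in> {1, - 1}" by (auto simp: sgn_if)
    then show "\<exists>p\<in>UNIV \<times> {1, - 1}. m = (case p of (k, v) \<Rightarrow> int (Suc k) * v)"
      by (intro bexI[of _ "(nat (\<bar>m\<bar> - 1), sgn m)"]) auto
  qed auto
  have int: "integrable (count_space UNIV) (\<lambda>v. if v = 0 then 0 else of_real (square v) powr (- s) :: complex)"
    using dirichlet_eq_mellin(1)[OF theta_controlled_square] s by simp
  have "dirichlet square 0 s = zeta_series (2 * s) * (\<integral>v. of_real (square v) powr (- s) \<partial>count_space {1, - 1})"
    by (rule dirichlet_primitive(2)[OF bij _ _ int s]) (auto simp: square_def power_mult_distrib)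
  also have "(\<integral>v. of_real (square v) powr (- s) \<partial>count_space {1, - 1}) = (2 :: complex)"
    by (subst lebesgue_integral_count_space_finite) (auto simp: square_def)
  finally show ?thesis by simp
qed

lemma \<Xi>1_meromorphic: "\<Xi>1 meromorphic_on UNIV"
  and \<Xi>1_analytic: "\<Xi>1 analytic_on - {0, 1 / 2}"
  using completed_meromorphic[of 1 "1 / 2" "theta square"] completed_analytic[of 1 "1 / 2" "theta square"]
    rapid_remainder_theta[OF theta_controlled_square] by simp_all

lemma \<Xi>1_eq:
  assumes "Re s > 1 / 2"
  shows "\<Xi>1 s = of_real pi powr (- s) * Gamma s * (2 * zeta_series (2 * s))"
  using dirichlet_eq_mellin(2)[OF theta_controlled_square, of s] assms by (simp add: dirichlet_square)

lemma Gamma_pi_nonzero: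
  assumes "Re s > 0"
  shows "of_real pi powr (- s) * Gamma s \<noteq> 0"
  using assms by (auto simp: Gamma_eq_zero_iff elim!: nonpos_Ints_cases)

lemma \<Xi>1_nonzero:
  assumes "Re s \<ge> 1"
  shows "\<Xi>1 s \<noteq> 0"
  using assms \<Xi>1_eq[of s] Gamma_pi_nonzero[of s] zeta_series_nonzero[of "2 * s"] by auto

lemma eventually_cosparse_affine:
  fixes a b :: complex
  assumes P: "\<forall>\<^sub>\<approx>s. P s" and a: "a \<noteq> 0"
  shows "\<forall>\<^sub>\<approx>s. P (a * s + b)"
proof (subst eventually_cosparse_open_eq[OF open_UNIV], intro ballI)
  fix s
  have "eventually P (at (a * s + b))"
    using P by (rule eventually_cosparse_imp_eventually_at) auto
  moreover have "filterlim (\<lambda>s. a * s + b) (at (a * s + b)) (at s)"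
    using a by (auto simp: filterlim_at eventually_at_filter intro!: tendsto_eq_intros)
  ultimately show "eventually (\<lambda>s. P (a * s + b)) (at s)"
    by (rule eventually_compose_filterlim)
qed

text \<open>
  Riemann's formula for the completed zeta function, solved for \<open>\<zeta>\<close>.
\<close>
lemma zeta_eq: "\<forall>\<^sub>\<approx>s. zeta s = of_real pi powr (s / 2) * rGamma (s / 2) * \<Xi>1 (s / 2) / 2"
proof -
  define F where "F s = of_real pi powr (s / 2) * rGamma (s / 2) * \<Xi>1 (s / 2) / 2" for s
  have an: "(\<lambda>s. of_real pi powr (s / 2) * rGamma (s / 2) :: complex) analytic_on A" for A
    by (intro analytic_intros) (auto simp: not_less[symmetric])
  have "(\<lambda>s. \<Xi>1 (1 / 2 * s + 0)) meromorphic_on UNIV"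
    by (rule meromorphic_on_compose[OF \<Xi>1_meromorphic]) (auto intro!: analytic_intros)
  then have mer: "F meromorphic_on UNIV"
    unfolding F_def[abs_def]
    by (intro meromorphic_intros analytic_on_imp_meromorphic_on[OF an]) simp_all
  have "(\<lambda>s. \<Xi>1 (s / 2)) analytic_on {s. Re s > 1}"
    by (rule analytic_on_compose_gen[OF _ \<Xi>1_analytic, unfolded o_def]) (auto intro!: analytic_intros)
  then have ana: "F analytic_on {s. Re s > 1}"
    unfolding F_def[abs_def] by (intro analytic_intros an) auto
  have eq: "F s = zeta_series s" if "Re s > 1" for s
  proof -
    have "Gamma (s / 2) \<noteq> 0" using Gamma_pi_nonzero[of "s / 2"] that by auto
    then show ?thesis using that \<Xi>1_eq[of "s / 2"]
      by (simp add: F_def rGamma_inverse_Gamma powr_minus field_simps)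
  qed
  have "zeta = remove_sings F"
    unfolding zeta_def by (rule mero_continuation_eq[OF mer ana]) (simp add: eq zeta_series_def)
  then show ?thesis using eventually_remove_sings_eq[OF mer] by (simp add: F_def)
qed

text \<open>
  Gamma cancels against its reciprocal away from the poles, which leaves the completed theta
  integral.
\<close>
lemma Lambda_eq: "\<forall>\<^sub>\<approx>s. Lambda s = \<Xi>1 (s / 2) / 2"
proof -
  have "(\<lambda>s. rGamma (s / 2)) meromorphic_on UNIV"
    by (intro analytic_on_imp_meromorphic_on analytic_intros) auto
  then have "\<forall>\<^sub>\<approx>s. rGamma (s / 2 :: complex) \<noteq> 0"
  proof (rule meromorphic_nonzero_cosparse[of _ 0])
    show "rGamma (s / 2) \<noteq> 0" if "Re s > 0" for s :: complex
      using that by (auto simp: rGamma_eq_zero_iff elim!: nonpos_Ints_cases)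
  qed
  with zeta_eq show ?thesis
  proof eventually_elim
    case (elim s)
    then show ?case
      by (simp add: Lambda_def Gamma_def powr_minus field_simps)
  qed
qed

lemma Lambda_nonzero: "\<forall>\<^sub>\<approx>s. Lambda s \<noteq> 0"
proof -
  have "\<forall>\<^sub>\<approx>s. \<Xi>1 s \<noteq> 0"
    by (rule meromorphic_nonzero_cosparse[OF \<Xi>1_meromorphic, of 1]) (rule \<Xi>1_nonzero, simp)
  then have "\<forall>\<^sub>\<approx>s. \<Xi>1 (1 / 2 * s + 0) \<noteq> 0" by (rule eventually_cosparse_affine) auto
  with Lambda_eq show ?thesis by eventually_elim auto
qed

section \<open>The symplectic group\<close>

text \<open>
  The symplectic form with Gram matrix \<open>J\<close>.
\<close>
definition omega :: "real^4 \<Rightarrow> real^4 \<Rightarrow> real" where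
  "omega v w = v$1 * w$3 + v$2 * w$4 - v$3 * w$1 - v$4 * w$2"

lemma omega_linear:
  "omega v (w + a *\<^sub>R w') = omega v w + a * omega v w'" "omega (a *\<^sub>R v) (b *\<^sub>R w) = a * b * omega v w"
  by (simp_all add: omega_def algebra_simps)

lemma omega_self: "omega v v = 0"
  by (simp add: omega_def)

lemmas mat4_simps = vec_eq_iff forall_4 matrix_matrix_mult_def transpose_def sum_4 vector_4 mat_def

lemma symp_J_square: "symp_J ** symp_J = - mat 1" "transpose symp_J = - symp_J"
  by (simp_all add: symp_J_def mat4_simps)

lemma matrix_mult_minus:
  "(- A) ** B = - (A ** B)" "A ** (- B) = - (A ** B)" for A B :: "real^4^4"
  by (simp_all add: vec_eq_iff matrix_matrix_mult_def sum_negf)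

lemma Sp4_inverse:
  assumes "transpose g ** symp_J ** g = symp_J"
  shows "(- (symp_J ** transpose g ** symp_J)) ** g = mat 1" "g ** (- (symp_J ** transpose g ** symp_J)) = mat 1"
proof -
  have "(symp_J ** transpose g ** symp_J) ** g = symp_J ** (transpose g ** symp_J ** g)"
    by (simp add: matrix_mul_assoc)
  then show 1: "(- (symp_J ** transpose g ** symp_J)) ** g = mat 1"
    by (simp add: assms symp_J_square matrix_mult_minus)
  then show "g ** (- (symp_J ** transpose g ** symp_J)) = mat 1"
    by (simp add: matrix_left_right_inverse)
qed

lemma Sp4_R_iff: "g \<in> Sp4_R \<longleftrightarrow> transpose g ** symp_J ** g = symp_J"
  using Sp4_inverse[of g] by (auto simp: Sp4_R_def invertible_def)

lemma Sp4_R_transposed: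
  assumes "g \<in> Sp4_R"
  shows "g ** symp_J ** transpose g = symp_J"
proof -
  have "g ** symp_J ** transpose g ** symp_J = - mat 1"
    using Sp4_inverse(2)[of g] assms by (simp add: Sp4_R_iff matrix_mult_minus matrix_mul_assoc) (metis minus_minus)
  then have "g ** symp_J ** transpose g ** (symp_J ** symp_J) = - symp_J"
    by (metis matrix_mul_assoc matrix_mult_minus(1) matrix_mul_lid)
  then show ?thesis by (simp add: symp_J_square matrix_mult_minus)
qed

lemma omega_rows: "omega (g$i) (g$j) = (g ** symp_J ** transpose g)$i$j"
  by (simp add: omega_def symp_J_def matrix_matrix_mult_def transpose_def sum_4 vector_4)

lemma Sp4_R_omega:
  assumes "g \<in> Sp4_R"
  shows "omega (g$i) (g$j) = symp_J$i$j"
  unfolding omega_rows Sp4_R_transposed[OF assms] ..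

lemma Sp4_R_mult:
  assumes "g \<in> Sp4_R" "h \<in> Sp4_R"
  shows "g ** h \<in> Sp4_R"
proof -
  have "transpose (g ** h) ** symp_J ** (g ** h) = transpose h ** (transpose g ** symp_J ** g) ** h"
    by (simp add: matrix_transpose_mul matrix_mul_assoc)
  then show ?thesis using assms by (simp add: Sp4_R_iff)
qed

lemma Sp4_R_transpose: "g \<in> Sp4_R \<Longrightarrow> transpose g \<in> Sp4_R"
  using Sp4_R_transposed[of g] by (simp add: Sp4_R_iff)

lemma Sp4_R_inverse:
  assumes g: "g \<in> Sp4_R"
  shows "- (symp_J ** transpose g ** symp_J) \<in> Sp4_R"
proof -
  have J: "symp_J \<in> Sp4_R" by (simp add: Sp4_R_iff symp_J_square matrix_mult_minus)
  have "symp_J ** transpose g ** symp_J \<in> Sp4_R"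
    by (intro Sp4_R_mult J Sp4_R_transpose g)
  then show ?thesis
    by (simp add: Sp4_R_iff matrix_mult_minus transpose_def) (simp add: vec_eq_iff matrix_matrix_mult_def sum_negf)
qed

lemma Sp4_Z_mult:
  assumes "g \<in> Sp4_Z" "h \<in> Sp4_Z"
  shows "g ** h \<in> Sp4_Z"
proof -
  have "(g ** h)$i$j \<in> \<int>" for i j
    using assms by (simp add: Sp4_Z_def matrix_matrix_mult_def sum_4)
  then show ?thesis using assms Sp4_R_mult by (simp add: Sp4_Z_def)
qed

lemma Sp4_Z_inverse:
  assumes g: "g \<in> Sp4_Z"
  shows "- (symp_J ** transpose g ** symp_J) \<in> Sp4_Z"
proof -
  have "symp_J$i$j \<in> \<int>" for i j
    using exhaust_4[of i] exhaust_4[of j] by (auto simp: symp_J_def vector_4)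
  moreover have "g$i$j \<in> \<int>" for i j using g by (simp add: Sp4_Z_def)
  ultimately have "(- (symp_J ** transpose g ** symp_J))$i$j \<in> \<int>" for i j
    by (simp add: matrix_matrix_mult_def transpose_def sum_4)
  then show ?thesis using g Sp4_R_inverse[of g] by (simp add: Sp4_Z_def)
qed

lemma n_beta_Sp4: "n_beta u1 u2 u3 \<in> Sp4_R"
  by (simp add: Sp4_R_iff n_beta_def symp_J_def mat4_simps algebra_simps)

section \<open>The maximal compact subgroup and Iwasawa coordinates\<close>

lemma matrix_mult_transpose_inner: "(X ** transpose X)$i$j = X$i \<bullet> X$j" for X :: "real^4^4"
  by (simp add: matrix_matrix_mult_def transpose_def inner_vec_def)

lemma K_max_orthogonal:
  assumes "k \<in> K_max"
  shows "k ** transpose k = mat 1" "k \<in> Sp4_R"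
proof -
  obtain A B where k: "k = K_block A B" and U: "(\<chi> i j. Complex (A$i$j) (B$i$j)) \<in> unitary2"
    using assms by (auto simp: K_max_def)
  define U where "U = (\<chi> i j. Complex (A$i$j) (B$i$j))"
  have "(\<chi> i j. cnj (U$j$i)) ** U = mat 1" using U by (simp add: unitary2_def U_def)
  then have "U ** (\<chi> i j. cnj (U$j$i)) = mat 1" by (simp add: matrix_left_right_inverse)
  then have *: "(\<Sum>l\<in>UNIV. U$i$l * cnj (U$j$l)) = (if i = j then 1 else 0)" for i j
    by (simp add: vec_eq_iff matrix_matrix_mult_def mat_def)
  note U11 = *[of 1 1] and U12 = *[of 1 2] and U22 = *[of 2 2]
  show "k ** transpose k = mat 1"
    using U11 U12 U22 unfolding k K_block_def mat4_simps
    by (simp add: U_def sum_2 complex_eq_iff vector_4 algebra_simps)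
  have "k ** symp_J ** transpose k = symp_J"
    using U11 U12 U22 unfolding k K_block_def mat4_simps symp_J_def
    by (simp add: U_def sum_2 complex_eq_iff vector_4 algebra_simps)
  then have "transpose k \<in> Sp4_R" by (simp add: Sp4_R_iff)
  then show "k \<in> Sp4_R" using Sp4_R_transpose[of "transpose k"] by simp
qed

lemma inner_rows_K_max:
  fixes M :: "real^4^4"
  assumes "k \<in> K_max"
  shows "(M ** k)$i \<bullet> (M ** k)$j = M$i \<bullet> M$j"
proof -
  have "(M ** k) ** transpose (M ** k) = M ** (k ** transpose k) ** transpose M"
    by (simp add: matrix_transpose_mul matrix_mul_assoc)
  then show ?thesis
    using matrix_mult_transpose_inner[of "M ** k" i j] matrix_mult_transpose_inner[of M i j]
    by (simp add: K_max_orthogonal[OF assms])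
qed

lemma iwasawa_na:
  "iwasawa_n n1 n2 n4 n5 ** iwasawa_a y1 y2 =
   vector [vector [y1, n1 * y2, n2 / y1, (n1 * n5 + n4) / y2],
           vector [0, y2, n4 / y1, n5 / y2],
           vector [0, 0, 1 / y1, 0],
           vector [0, 0, - n1 / y1, 1 / y2]]"
  by (simp add: iwasawa_n_def iwasawa_a_def mat4_simps divide_inverse)

text \<open>All coordinates can be read off the Gram matrix of the rows, which is unchanged by \<open>K\<close>.\<close>
lemma iwasawa_coords_gram:
  assumes "iwasawa_coords g n1 n2 n4 n5 y1 y2"
  shows "g$3 \<bullet> g$3 = 1 / y1\<^sup>2" "g$3 \<bullet> g$4 = - n1 / y1\<^sup>2" "g$4 \<bullet> g$4 = n1\<^sup>2 / y1\<^sup>2 + 1 / y2\<^sup>2"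
    "g$2 \<bullet> g$3 = n4 / y1\<^sup>2" "g$2 \<bullet> g$4 = - n1 * n4 / y1\<^sup>2 + n5 / y2\<^sup>2"
proof -
  obtain k where k: "k \<in> K_max" and g: "g = iwasawa_n n1 n2 n4 n5 ** iwasawa_a y1 y2 ** k"
    using assms by (auto simp: iwasawa_coords_def)
  show "g$3 \<bullet> g$3 = 1 / y1\<^sup>2" "g$3 \<bullet> g$4 = - n1 / y1\<^sup>2" "g$4 \<bullet> g$4 = n1\<^sup>2 / y1\<^sup>2 + 1 / y2\<^sup>2"
    "g$2 \<bullet> g$3 = n4 / y1\<^sup>2" "g$2 \<bullet> g$4 = - n1 * n4 / y1\<^sup>2 + n5 / y2\<^sup>2"
    unfolding g inner_rows_K_max[OF k] iwasawa_na
    by (simp_all add: inner_vec_def sum_4 vector_4 power2_eq_square)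
qed

lemma iwasawa_coords_unique:
  assumes "iwasawa_coords g n1 n2 n4 n5 y1 y2" "iwasawa_coords g n1' n2' n4' n5' y1' y2'"
  shows "y1 = y1'" "y2 = y2'" "n5 = n5'"
proof -
  have pos: "y1 > 0" "y2 > 0" "y1' > 0" "y2' > 0" using assms by (auto simp: iwasawa_coords_def)
  note G = iwasawa_coords_gram[OF assms(1)] and G' = iwasawa_coords_gram[OF assms(2)]
  have "1 / y1\<^sup>2 = 1 / y1'\<^sup>2" using G(1) G'(1) by simp
  then show 1: "y1 = y1'" using pos by simp
  have 2: "n1 = n1'" using G(2) G'(2) pos by (simp add: 1)
  have "1 / y2\<^sup>2 = 1 / y2'\<^sup>2" using G(3) G'(3) by (simp add: 1 2)
  then show 3: "y2 = y2'" using pos by simp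
  have 4: "n4 = n4'" using G(4) G'(4) pos by (simp add: 1)
  show "n5 = n5'" using G(5) G'(5) pos by (simp add: 1 2 3 4)
qed

lemma iw_eq:
  assumes "iwasawa_coords g n1 n2 n4 n5 y1 y2"
  shows "iw_y1 g = y1" "iw_y2 g = y2" "iw_n5 g = n5"
  unfolding iw_y1_def iw_y2_def iw_n5_def
  using assms iwasawa_coords_unique[OF assms] by (blast intro!: the_equality)+

text \<open>
  The pairings with the last two rows determine the first two entries of the first two rows, and the
  pairing of the first two rows gives the relation \<open>n1 n5 + n4\<close> for the upper right entry.
\<close>
lemma symplectic_triangular:
  assumes b: "b \<in> Sp4_R" and b3: "b$3 = vector [0, 0, 1 / y1, 0]" and b4: "b$4 = vector [0, 0, - n1 / y1, 1 / y2]"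
    and y: "y1 > 0" "y2 > 0"
  shows "\<exists>n2 n4 n5. b = iwasawa_n n1 n2 n4 n5 ** iwasawa_a y1 y2"
proof -
  note om = Sp4_R_omega[OF b, unfolded omega_def symp_J_def]
  have b11: "b$1$1 = y1" and b21: "b$2$1 = 0"
    using om[of 1 3] om[of 2 3] y by (simp_all add: b3 vector_4 field_simps)
  have b12: "b$1$2 = n1 * y2" and b22: "b$2$2 = y2"
    using om[of 1 4] om[of 2 4] y by (simp_all add: b4 vector_4 b11 b21 field_simps)
  have b14: "b$1$4 * y2 = y1 * b$2$3 + n1 * y2 * b$2$4"
    using om[of 1 2] y by (simp add: vector_4 b11 b21 b12 b22 algebra_simps)
  have "b = iwasawa_n n1 (b$1$3 * y1) (b$2$3 * y1) (b$2$4 * y2) ** iwasawa_a y1 y2"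
    unfolding iwasawa_na using y b14
    by (simp add: vec_eq_iff forall_4 vector_4 b3 b4 b11 b21 b12 b22 field_simps)
  then show ?thesis by blast
qed

text \<open>
  Gram-Schmidt applied to the last two rows of \<open>g\<close> gives the last two rows of \<open>k\<close>.  They span an
  isotropic plane because the rows of \<open>g\<close> do, so they are the last two rows of a unique element of
  \<open>K\<close>; the remaining factor is triangular because it is symplectic.
\<close>
lemma iwasawa_exists:
  assumes g: "g \<in> Sp4_R"
  shows "\<exists>n1 n2 n4 n5 y1 y2. iwasawa_coords g n1 n2 n4 n5 y1 y2"
proof -
  note om = Sp4_R_omega[OF g]
  have J: "symp_J$1$3 = 1" "symp_J$2$4 = 1" "symp_J$2$3 = 0" "symp_J$3$4 = 0" by (simp_all add: symp_J_def vector_4)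
  have r3: "g$3 \<noteq> 0" using om[of 1 3] J by (auto simp: omega_def)
  define n1 where "n1 = - (g$3 \<bullet> g$4) / (g$3 \<bullet> g$3)"
  define p where "p = g$4 + n1 *\<^sub>R g$3"
  have "omega (g$2) p = 1" using om[of 2 4] om[of 2 3] J by (simp add: p_def omega_linear)
  then have p: "p \<noteq> 0" by (auto simp: omega_def)
  define y1 where "y1 = 1 / norm (g$3)"
  define y2 where "y2 = 1 / norm p"
  have y: "y1 > 0" "y2 > 0" using r3 p by (auto simp: y1_def y2_def)
  define v where "v = y1 *\<^sub>R g$3"
  define w where "w = y2 *\<^sub>R p"
  have vv: "v \<bullet> v = 1" "w \<bullet> w = 1" using r3 p by (simp_all add: v_def w_def y1_def y2_def power2_norm_eq_inner[symmetric] power2_eq_square)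
  have "g$3 \<bullet> p = 0" using r3 by (simp add: p_def n1_def inner_diff_right)
  then have vw: "v \<bullet> w = 0" by (simp add: v_def w_def)
  have "omega (g$3) p = 0" using om[of 3 4] J by (simp add: p_def omega_linear omega_self)
  then have ow: "omega v w = 0" by (simp add: v_def w_def omega_linear)
  define A :: "real^2^2" where "A = vector [vector [v$3, v$4], vector [w$3, w$4]]"
  define B :: "real^2^2" where "B = vector [vector [- v$1, - v$2], vector [- w$1, - w$2]]"
  define U where "U = (\<chi> i j. Complex (A$i$j) (B$i$j))"
  have "U ** (\<chi> i j. cnj (U$j$i)) = mat 1"
    using vv vw ow
    by (simp add: U_def A_def B_def vec_eq_iff forall_2 matrix_matrix_mult_def sum_2 mat_def vector_2
        complex_eq_iff inner_vec_def sum_4 omega_def algebra_simps)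
  then have "U \<in> unitary2" by (simp add: unitary2_def matrix_left_right_inverse)
  then have k: "K_block A B \<in> K_max" by (auto simp: K_max_def U_def)
  define k where "k = K_block A B"
  have kin: "k \<in> K_max" using k by (simp add: k_def)
  have k3: "k$3 = v" and k4: "k$4 = w"
    by (simp_all add: k_def K_block_def A_def B_def vec_eq_iff forall_4 vector_4 vector_2)
  define b where "b = g ** transpose k"
  have bS: "b \<in> Sp4_R" unfolding b_def
    by (intro Sp4_R_mult g Sp4_R_transpose K_max_orthogonal kin)
  have orth: "k$i \<bullet> k$j = (if i = j then 1 else 0)" for i j
    using K_max_orthogonal(1)[OF kin] by (simp add: mat_def flip: matrix_mult_transpose_inner)
  have bij: "b$i$j = g$i \<bullet> k$j" for i j
    by (simp add: b_def matrix_matrix_mult_def transpose_def inner_vec_def)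
  have g3: "g$3 = (1 / y1) *\<^sub>R k$3" using y by (simp add: k3 v_def)
  have g4: "g$4 = (1 / y2) *\<^sub>R k$4 - (n1 / y1) *\<^sub>R k$3" using y by (simp add: k3 k4 v_def w_def p_def)
  have b3: "b$3 = vector [0, 0, 1 / y1, 0]"
    by (simp add: vec_eq_iff forall_4 vector_4 bij g3 orth)
  have b4: "b$4 = vector [0, 0, - n1 / y1, 1 / y2]"
    by (simp add: vec_eq_iff forall_4 vector_4 bij g4 orth inner_diff_left)
  obtain n2 n4 n5 where "b = iwasawa_n n1 n2 n4 n5 ** iwasawa_a y1 y2"
    using symplectic_triangular[OF bS b3 b4 y] by blast
  moreover have "g = b ** k"
  proof -
    have "transpose k ** k = mat 1"
      using K_max_orthogonal(1)[OF kin] by (simp add: matrix_left_right_inverse)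
    then show ?thesis by (simp add: b_def matrix_mul_assoc[symmetric])
  qed
  ultimately show ?thesis using y kin unfolding iwasawa_coords_def by blast
qed

lemma iw_y1_eq_norm:
  assumes "g \<in> Sp4_R"
  shows "iw_y1 g = 1 / norm (g$3)" "g$3 \<noteq> 0"
proof -
  obtain n1 n2 n4 n5 y1 y2 where c: "iwasawa_coords g n1 n2 n4 n5 y1 y2"
    using iwasawa_exists[OF assms] by blast
  then have y: "y1 > 0" by (simp add: iwasawa_coords_def)
  have "norm (g$3) = 1 / y1"
    using iwasawa_coords_gram(1)[OF c] y by (simp add: norm_eq_sqrt_inner real_sqrt_divide)
  then show "iw_y1 g = 1 / norm (g$3)" "g$3 \<noteq> 0" using iw_eq(1)[OF c] y by auto
qed

section \<open>Cosets and primitive rows\<close>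

text \<open>
  A complete invariant \<open>\<phi>\<close> of the cosets replaces the chosen representatives as summation index.
\<close>
lemma coset_sum_eq_infsum:
  assumes rel: "\<And>x y. x \<in> S \<Longrightarrow> y \<in> S \<Longrightarrow> (\<exists>h\<in>H. y = h ** x) \<longleftrightarrow> \<phi> x = \<phi> y"
    and f: "\<And>x. x \<in> S \<Longrightarrow> f x = F (\<phi> x)"
  shows "coset_sum H S f = infsum F (\<phi> ` S)"
proof -
  let ?R = "{(x, y). x \<in> S \<and> y \<in> S \<and> (\<exists>h\<in>H. y = h ** x)}"
  have img: "?R `` {x} = {y \<in> S. \<phi> y = \<phi> x}" if "x \<in> S" for x
    using that rel by force
  define \<psi> where "\<psi> C = (SOME x. x \<in> C)" for C :: "('a^'b^'b) set"
  have \<psi>: "\<psi> C \<in> S \<and> C = {y \<in> S. \<phi> y = \<phi> (\<psi> C)}" if C: "C \<in> coset_space H S" for C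
  proof -
    obtain x where "x \<in> S" "C = ?R `` {x}"
      using C unfolding coset_space_def by (rule quotientE)
    then have x: "x \<in> S" "C = {y \<in> S. \<phi> y = \<phi> x}" using img by auto
    then have "x \<in> C" by simp
    then have "\<psi> C \<in> C" unfolding \<psi>_def by (rule someI)
    with x show ?thesis by auto
  qed
  have "bij_betw (\<lambda>C. \<phi> (\<psi> C)) (coset_space H S) (\<phi> ` S)"
  proof (rule bij_betw_imageI)
    show "inj_on (\<lambda>C. \<phi> (\<psi> C)) (coset_space H S)"
      by (rule inj_onI) (metis \<psi>)
    have "\<phi> x \<in> (\<lambda>C. \<phi> (\<psi> C)) ` coset_space H S" if x: "x \<in> S" for x
    proof -
      define D where "D = ?R `` {x}"
      have C: "D \<in> coset_space H S"
        using x unfolding coset_space_def D_def by (rule quotientI)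
      have "x \<in> D" using img[OF x] x by (simp add: D_def)
      from subsetD[OF equalityD1[OF conjunct2[OF \<psi>[OF C]]] this]
      have "\<phi> (\<psi> D) = \<phi> x" by simp
      then show ?thesis using C by (metis image_eqI)
    qed
    then show "(\<lambda>C. \<phi> (\<psi> C)) ` coset_space H S = \<phi> ` S" using \<psi> by auto
  qed
  then have "infsum F (\<phi> ` S) = (\<Sum>\<^sub>\<infinity>C\<in>coset_space H S. F (\<phi> (\<psi> C)))"
    by (rule infsum_reindex_bij_betw[symmetric])
  also have "\<dots> = (\<Sum>\<^sub>\<infinity>C\<in>coset_space H S. f (\<psi> C))"
    using \<psi> f by (intro infsum_cong) auto
  finally show ?thesis by (simp add: coset_sum_def \<psi>_def)
qed

lemma infsum_eq_integral:
  fixes f :: "'c \<Rightarrow> complex"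
  assumes "integrable (count_space A) f"
  shows "f summable_on A" "infsum f A = (\<integral>x. f x \<partial>count_space A)"
proof -
  have abs: "Infinite_Set_Sum.abs_summable_on f A" using assms by (simp add: abs_summable_on_def)
  then have "Infinite_Sum.abs_summable_on f A" by (simp only: abs_summable_equivalent)
  then show "f summable_on A" by (rule abs_summable_summable)
  show "infsum f A = (\<integral>x. f x \<partial>count_space A)"
    using infsetsum_infsum[OF abs] by (simp add: infsetsum_def)
qed

text \<open>Each pair \<open>{v, - v}\<close> has two elements, and they contribute equally.\<close>
lemma infsum_up_to_sign:
  fixes f :: "'c::ab_group_add \<Rightarrow> complex"
  assumes P: "\<And>v. v \<in> P \<Longrightarrow> - v \<in> P" "\<And>v. v \<in> P \<Longrightarrow> v \<noteq> - v"
    and F: "\<And>v. v \<in> P \<Longrightarrow> F {v, - v} = f v" and summ: "f summable_on P"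
  shows "infsum F ((\<lambda>v. {v, - v}) ` P) = 1 / 2 * infsum f P"
proof -
  let ?W = "(\<lambda>v. {v, - v}) ` P"
  have bij: "bij_betw snd (Sigma ?W (\<lambda>w. w)) P"
  proof (rule bij_betw_imageI)
    show "inj_on snd (Sigma ?W (\<lambda>w. w))" by (auto simp: inj_on_def)
    have "v \<in> snd ` Sigma ?W (\<lambda>w. w)" if "v \<in> P" for v
      using that by (intro image_eqI[of _ _ "({v, - v}, v)"]) auto
    then show "snd ` Sigma ?W (\<lambda>w. w) = P" using P by auto
  qed
  have sig: "(\<lambda>(w, v). f v) summable_on Sigma ?W (\<lambda>w. w)"
    using summable_on_reindex_bij_betw[OF bij, of f] summ by (simp add: case_prod_unfold)
  have "f (- v) = f v" if "v \<in> P" for v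
    using F[OF that] F[OF P(1)[OF that]] by (simp add: insert_commute)
  then have inner: "infsum f w = 2 * F w" if "w \<in> ?W" for w
    using that P F by auto
  have "infsum f P = infsum (\<lambda>(w, v). f v) (Sigma ?W (\<lambda>w. w))"
    using infsum_reindex_bij_betw[OF bij, of f] by (simp add: case_prod_unfold)
  also have "\<dots> = (\<Sum>\<^sub>\<infinity>w\<in>?W. infsum f w)"
    by (rule infsum_Sigma'_banach[OF sig, symmetric])
  also have "\<dots> = (\<Sum>\<^sub>\<infinity>w\<in>?W. 2 * F w)" by (rule infsum_cong[OF inner])
  also have "\<dots> = 2 * infsum F ?W" by (rule infsum_cmult_right') 
  finally show ?thesis by simp
qed

definition irow :: "real^4^4 \<Rightarrow> int^4" where
  "irow \<gamma> = (\<chi> j. \<lfloor>\<gamma>$3$j\<rfloor>)"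

lemma irow:
  assumes "\<gamma> \<in> Sp4_Z"
  shows "real_of_int (irow \<gamma> $ j) = \<gamma>$3$j"
proof -
  have "\<gamma>$3$j \<in> \<int>" using assms by (simp add: Sp4_Z_def)
  then show ?thesis by (auto simp: irow_def elim: Ints_cases)
qed

lemma primitive_uminus [simp]: "primitive (- v) \<longleftrightarrow> primitive v"
proof -
  have "range (($) (- v)) = uminus ` range (($) v)" by (auto simp: image_image)
  then show ?thesis by (simp add: primitive_def)
qed

lemma primitiveI:
  fixes v :: "int^'n"
  assumes "\<And>d. (\<And>i. d dvd v$i) \<Longrightarrow> d dvd 1"
  shows "primitive v"
proof -
  have "Gcd (range (($) v)) dvd 1" by (rule assms) (auto intro: Gcd_dvd)
  then show ?thesis by (simp add: primitive_def)
qed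

lemma primitiveD:
  assumes "primitive v" "\<And>i. d dvd v$i"
  shows "d dvd 1"
proof -
  have "d dvd Gcd (range (($) v))" using assms(2) by (intro Gcd_greatest) auto
  then show ?thesis using assms(1) by (simp add: primitive_def)
qed

lemma primitive_nonzero: "primitive v \<Longrightarrow> v \<noteq> 0"
  using primitiveD[of v 0] by auto

lemma irow_primitive:
  assumes \<gamma>: "\<gamma> \<in> Sp4_Z"
  shows "primitive (irow \<gamma>)"
proof (rule primitiveI)
  fix d assume d: "\<And>i. d dvd irow \<gamma> $ i"
  define w :: "int^4" where "w = (\<chi> j. \<lfloor>\<gamma>$1$j\<rfloor>)"
  have w: "real_of_int (w$j) = \<gamma>$1$j" for j
  proof -
    have "\<gamma>$1$j \<in> \<int>" using \<gamma> by (simp add: Sp4_Z_def)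
    then show ?thesis by (auto simp: w_def elim: Ints_cases)
  qed
  have "omega (\<gamma>$1) (\<gamma>$3) = 1"
    using Sp4_R_omega[of \<gamma> 1 3] \<gamma> by (simp add: Sp4_Z_def symp_J_def vector_4)
  then have "real_of_int (w$1 * irow \<gamma>$3 + w$2 * irow \<gamma>$4 - w$3 * irow \<gamma>$1 - w$4 * irow \<gamma>$2) = 1"
    by (simp add: omega_def w irow[OF \<gamma>])
  then have "w$1 * irow \<gamma>$3 + w$2 * irow \<gamma>$4 - w$3 * irow \<gamma>$1 - w$4 * irow \<gamma>$2 = 1"
    by linarith
  then show "d dvd 1" using d by (metis dvd_add dvd_diff dvd_mult)
qed

lemma row3_mult: "(h ** x)$3$j = h$3$1 * x$1$j + h$3$2 * x$2$j + h$3$3 * x$3$j + h$3$4 * x$4$j" for x :: "real^4^4"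
  by (simp add: matrix_matrix_mult_def sum_4)

lemma bezout_reduced:
  fixes a c :: int
  shows "\<exists>a' c' p q. a = gcd a c * a' \<and> c = gcd a c * c' \<and> p * a' + q * c' = 1"
proof (cases "gcd a c = 0")
  case True
  \<comment> \<open>The zero vector is a multiple of any primitive vector, here \<open>(0, 1)\<close>.\<close>
  then show ?thesis by (intro exI[of _ 0] exI[of _ 1]) auto
next
  case False
  obtain p q where pq: "p * a + q * c = gcd a c" using bezout_int by blast
  have "gcd a c * (p * (a div gcd a c) + q * (c div gcd a c)) = gcd a c * 1"
    using pq by (simp add: distrib_left mult.left_commute[of "gcd a c"])
  then have "p * (a div gcd a c) + q * (c div gcd a c) = 1" using False by (metis mult_left_cancel)
  then show ?thesis by (intro exI[of _ "a div gcd a c"] exI[of _ "c div gcd a c"] exI[of _ p] exI[of _ q]) auto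
qed

text \<open>
  Two commuting copies of \<open>SL(2, \<int>)\<close> reduce a vector to \<open>(0, 0, gcd(a, c), gcd(b, d))\<close>, and the
  Levi factor \<open>GL(2, \<int>)\<close> reduces this to the third unit vector.
\<close>
lemma primitive_is_irow:
  assumes v: "primitive v"
  shows "\<exists>\<gamma>\<in>Sp4_Z. irow \<gamma> = v"
proof -
  define g1 g2 where "g1 = gcd (v$1) (v$3)" and "g2 = gcd (v$2) (v$4)"
  obtain a c p q where a: "v$1 = g1 * a" "v$3 = g1 * c" "p * a + q * c = 1"
    using bezout_reduced[of "v$1" "v$3"] unfolding g1_def by blast
  obtain b d r s where b: "v$2 = g2 * b" "v$4 = g2 * d" "r * b + s * d = 1"
    using bezout_reduced[of "v$2" "v$4"] unfolding g2_def by blast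
  have "gcd g1 g2 dvd 1"
  proof (rule primitiveD[OF v])
    have "gcd g1 g2 dvd v$1 \<and> gcd g1 g2 dvd v$2 \<and> gcd g1 g2 dvd v$3 \<and> gcd g1 g2 dvd v$4"
      using a b by simp
    then show "gcd g1 g2 dvd v$i" for i using exhaust_4[of i] by auto
  qed
  then have "gcd g1 g2 = 1" by simp
  then obtain x y where xy: "x * g1 + y * g2 = 1" using bezout_int[of g1 g2] by auto
  define M1 :: "real^4^4" where "M1 = vector [vector [of_int x, of_int y, 0, 0], vector [- of_int g2, of_int g1, 0, 0],
     vector [0, 0, of_int g1, of_int g2], vector [0, 0, - of_int y, of_int x]]"
  define M2 :: "real^4^4" where "M2 = vector [vector [of_int q, 0, - of_int p, 0], vector [0, 1, 0, 0],
     vector [of_int a, 0, of_int c, 0], vector [0, 0, 0, 1]]"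
  define M3 :: "real^4^4" where "M3 = vector [vector [1, 0, 0, 0], vector [0, of_int s, 0, - of_int r],
     vector [0, 0, 1, 0], vector [0, of_int b, 0, of_int d]]"
  have re: "real_of_int x * of_int g1 + of_int y * of_int g2 = 1"
    "real_of_int p * of_int a + of_int q * of_int c = 1" "real_of_int r * of_int b + of_int s * of_int d = 1"
    using arg_cong[OF xy, of real_of_int] arg_cong[OF a(3), of real_of_int] arg_cong[OF b(3), of real_of_int] by simp_all
  have M1: "M1 \<in> Sp4_Z"
    using re(1) by (simp add: Sp4_Z_def Sp4_R_iff M1_def symp_J_def mat4_simps algebra_simps)
  have M2: "M2 \<in> Sp4_Z"
    using re(2) by (simp add: Sp4_Z_def Sp4_R_iff M2_def symp_J_def mat4_simps algebra_simps)
  have M3: "M3 \<in> Sp4_Z"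
    using re(3) by (simp add: Sp4_Z_def Sp4_R_iff M3_def symp_J_def mat4_simps algebra_simps)
  let ?\<gamma> = "M1 ** M2 ** M3"
  have \<gamma>: "?\<gamma> \<in> Sp4_Z" by (intro Sp4_Z_mult M1 M2 M3)
  have "?\<gamma>$3$1 = of_int (v$1)" "?\<gamma>$3$2 = of_int (v$2)" "?\<gamma>$3$3 = of_int (v$3)" "?\<gamma>$3$4 = of_int (v$4)"
    unfolding a b by (simp_all add: row3_mult M1_def M2_def M3_def vector_4)
  then have "irow ?\<gamma> = v" by (simp add: irow_def vec_eq_iff forall_4)
  with \<gamma> show ?thesis by blast
qed

text \<open>
  The pairings of the other rows with the third one force the remaining entries to vanish.
\<close>
lemma P_beta_iff:
  assumes h: "h \<in> Sp4_R"
  shows "h \<in> P_beta \<longleftrightarrow> h$3$1 = 0 \<and> h$3$2 = 0 \<and> h$3$4 = 0"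
proof
  assume *: "h$3$1 = 0 \<and> h$3$2 = 0 \<and> h$3$4 = 0"
  note om = Sp4_R_omega[OF h, unfolded omega_def symp_J_def]
  have "h$1$1 * h$3$3 = 1" "h$2$1 * h$3$3 = 0" "h$4$1 * h$3$3 = 0"
    using om[of 1 3] om[of 2 3] om[of 4 3] * by (simp_all add: vector_4)
  then show "h \<in> P_beta" using * h by (auto simp: P_beta_def)
qed (simp add: P_beta_def)

lemma P_beta_coset_iff:
  assumes x: "x \<in> Sp4_Z" and y: "y \<in> Sp4_Z"
  shows "(\<exists>h\<in>P_beta \<inter> Sp4_Z. y = h ** x) \<longleftrightarrow> {irow x, - irow x} = {irow y, - irow y}"
proof
  assume "\<exists>h\<in>P_beta \<inter> Sp4_Z. y = h ** x"
  then obtain h where h: "h \<in> P_beta" "h \<in> Sp4_Z" "y = h ** x" by auto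
  have hR: "h \<in> Sp4_R" using h by (simp add: Sp4_Z_def)
  have h0: "h$3$1 = 0" "h$3$2 = 0" "h$3$4 = 0" using h P_beta_iff[OF hR] by auto
  have "h$1$1 * h$3$3 = 1"
    using Sp4_R_omega[OF hR, of 1 3] h0 by (simp add: omega_def symp_J_def vector_4)
  moreover obtain m m' where "h$1$1 = of_int m" "h$3$3 = of_int m'"
    using h(2) unfolding Sp4_Z_def by (metis (mono_tags, lifting) Ints_cases mem_Collect_eq)
  ultimately have m: "m * m' = 1" "h$3$3 = of_int m'"
    by (simp_all flip: of_int_mult)
  then have "m' = 1 \<or> m' = - 1" by (metis mult.commute zmult_eq_1_iff)
  moreover have "real_of_int (irow y $ j) = of_int m' * of_int (irow x $ j)" for j
    unfolding irow[OF y] irow[OF x] using h0 m by (simp add: h(3) row3_mult)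
  then have "irow y $ j = m' * irow x $ j" for j
    by (metis of_int_eq_iff of_int_mult)
  ultimately have "irow y = irow x \<or> irow y = - irow x" by (auto simp: vec_eq_iff)
  then show "{irow x, - irow x} = {irow y, - irow y}" by auto
next
  assume "{irow x, - irow x} = {irow y, - irow y}"
  then have "irow y = irow x \<or> irow y = - irow x" by (auto simp: doubleton_eq_iff)
  then obtain e :: real where e: "\<And>j. y$3$j = e * x$3$j"
  proof
    assume eq: "irow y = irow x"
    show ?thesis by (rule that[of 1]) (simp add: eq flip: irow[OF x] irow[OF y])
  next
    assume eq: "irow y = - irow x"
    show ?thesis by (rule that[of "- 1"]) (simp add: eq flip: irow[OF x] irow[OF y])
  qed
  define z where "z = - (symp_J ** transpose x ** symp_J)"
  have z: "z \<in> Sp4_Z" "z ** x = mat 1" "x ** z = mat 1"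
    using Sp4_Z_inverse[OF x] Sp4_inverse[of x] x by (simp_all add: z_def Sp4_Z_def Sp4_R_iff)
  have h: "y ** z \<in> Sp4_Z" by (rule Sp4_Z_mult[OF y z(1)])
  have "(y ** z)$3$j = e * (x ** z)$3$j" for j
    by (simp add: row3_mult e matrix_matrix_mult_def sum_4 algebra_simps)
  then have "(y ** z)$3$1 = 0 \<and> (y ** z)$3$2 = 0 \<and> (y ** z)$3$4 = 0"
    unfolding z by (simp add: mat_def)
  then have "y ** z \<in> P_beta" using P_beta_iff[of "y ** z"] h by (simp add: Sp4_Z_def)
  moreover have "y = (y ** z) ** x" by (simp add: z matrix_mul_assoc[symmetric])
  ultimately show "\<exists>h\<in>P_beta \<inter> Sp4_Z. y = h ** x" using h by blast
qed

definition row_form :: "real^4^4 \<Rightarrow> int^4 \<Rightarrow> real" where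
  "row_form h v = (norm ((\<chi> i. real_of_int (v$i)) v* h))\<^sup>2"

lemma row_form_irow:
  assumes "\<gamma> \<in> Sp4_Z"
  shows "row_form h (irow \<gamma>) = (norm ((\<gamma> ** h)$3))\<^sup>2"
proof -
  have "(\<chi> i. real_of_int (irow \<gamma> $ i)) v* h = (\<gamma> ** h)$3"
    by (simp add: vec_eq_iff vector_matrix_mult_def matrix_matrix_mult_def irow[OF assms] mult.commute)
  then show ?thesis by (simp add: row_form_def)
qed

text \<open>
  The first Iwasawa coordinate of \<open>\<gamma> h\<close> is the reciprocal length of its third row, and the third row
  of \<open>\<gamma>\<close> runs through the primitive vectors, each coset giving one pair \<open>v, - v\<close>.
\<close>
lemma E_beta_series:
  assumes h: "h \<in> Sp4_R"
    and int: "integrable (count_space (Collect primitive)) (\<lambda>v. of_real (row_form h v) powr (- (\<nu> / 2 + 1)) :: complex)"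
  shows "coset_sum (P_beta \<inter> Sp4_Z) Sp4_Z (\<lambda>\<gamma>. I_beta (\<gamma> ** h) \<nu>) =
    1 / 2 * (\<integral>v. of_real (row_form h v) powr (- (\<nu> / 2 + 1)) \<partial>count_space (Collect primitive))"
proof -
  let ?f = "\<lambda>v. of_real (row_form h v) powr (- (\<nu> / 2 + 1)) :: complex"
  define F where "F w = ?f (SOME v. v \<in> w)" for w
  have neg: "row_form h (- v) = row_form h v" for v
  proof -
    have "(\<chi> i. real_of_int ((- v)$i)) v* h = - ((\<chi> i. real_of_int (v$i)) v* h)"
      by (simp add: vec_eq_iff vector_matrix_mult_def sum_negf)
    then show ?thesis by (simp add: row_form_def)
  qed
  have F: "F {v, - v} = ?f v" for v
  proof -
    have "(SOME x. x \<in> {v, - v}) \<in> {v, - v}" by (rule someI[of _ v]) simp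
    then show ?thesis by (auto simp: F_def neg)
  qed
  have I: "I_beta (\<gamma> ** h) \<nu> = F {irow \<gamma>, - irow \<gamma>}" if \<gamma>: "\<gamma> \<in> Sp4_Z" for \<gamma>
  proof -
    have \<gamma>h: "\<gamma> ** h \<in> Sp4_R" using Sp4_R_mult[OF _ h] \<gamma> by (simp add: Sp4_Z_def)
    define N where "N = norm ((\<gamma> ** h)$3)"
    have N: "N > 0" using iw_y1_eq_norm(2)[OF \<gamma>h] by (simp add: N_def)
    have "I_beta (\<gamma> ** h) \<nu> = of_real (N powr (- 1)) powr (\<nu> + 2)"
      using N by (simp add: I_beta_def iw_y1_eq_norm(1)[OF \<gamma>h] N_def powr_minus_divide)
    also have "\<dots> = of_real (N powr 2) powr (- (\<nu> / 2 + 1))"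
    proof -
      have "of_real (- 1) * (\<nu> + 2) = of_real 2 * (- (\<nu> / 2 + 1))" by (simp add: algebra_simps)
      then show ?thesis by (simp only: powr_of_real_powr[OF N])
    qed
    also have "N powr 2 = row_form h (irow \<gamma>)" using N by (simp add: row_form_irow[OF \<gamma>] N_def powr_numeral)
    finally show ?thesis by (simp add: F)
  qed
  have img: "(\<lambda>\<gamma>. {irow \<gamma>, - irow \<gamma>}) ` Sp4_Z = (\<lambda>v. {v, - v}) ` Collect primitive"
  proof (intro equalityI subsetI)
    fix w :: "(int^4) set" assume "w \<in> (\<lambda>v. {v, - v}) ` Collect primitive"
    then obtain v where v: "primitive v" "w = {v, - v}" by auto
    obtain \<gamma> where "\<gamma> \<in> Sp4_Z" "irow \<gamma> = v" using primitive_is_irow[OF v(1)] by blast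
    then show "w \<in> (\<lambda>\<gamma>. {irow \<gamma>, - irow \<gamma>}) ` Sp4_Z" using v(2) by blast
  qed (use irow_primitive in auto)
  have "coset_sum (P_beta \<inter> Sp4_Z) Sp4_Z (\<lambda>\<gamma>. I_beta (\<gamma> ** h) \<nu>) = infsum F ((\<lambda>\<gamma>. {irow \<gamma>, - irow \<gamma>}) ` Sp4_Z)"
    by (rule coset_sum_eq_infsum[where \<phi> = "\<lambda>\<gamma>. {irow \<gamma>, - irow \<gamma>}" and F = F, OF P_beta_coset_iff I])
  also have "\<dots> = 1 / 2 * infsum ?f (Collect primitive)"
    unfolding img
  proof (rule infsum_up_to_sign)
    fix v :: "int^4" assume "v \<in> Collect primitive"
    then have "v \<noteq> 0" using primitive_nonzero by auto
    then obtain i where "v$i \<noteq> 0" by (auto simp: vec_eq_iff)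
    then show "v \<noteq> - v" by (auto simp: vec_eq_iff intro!: exI[of _ i])
  qed (use F infsum_eq_integral[OF int] in auto)
  finally show ?thesis using infsum_eq_integral[OF int] by simp
qed

section \<open>The Eisenstein series of \<open>SL(2, \<int>)\<close>\<close>

lemma Gamma_inf2_coset_iff:
  assumes x: "x \<in> SL2_Z" and y: "y \<in> SL2_Z"
  shows "(\<exists>h\<in>Gamma_inf2. y = h ** x) \<longleftrightarrow> x$2 = y$2"
proof
  assume "\<exists>h\<in>Gamma_inf2. y = h ** x"
  then show "x$2 = y$2"
    by (auto simp: Gamma_inf2_def vec_eq_iff forall_2 matrix_matrix_mult_def sum_2 vector_2)
next
  assume eq: "x$2 = y$2"
  have dx: "x$1$1 * x$2$2 - x$1$2 * x$2$1 = 1" using x by (simp add: SL2_Z_def det_2)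
  have dy: "y$1$1 * x$2$2 - y$1$2 * x$2$1 = 1" using y by (simp add: SL2_Z_def det_2 eq)
  \<comment> \<open>The upper right entry of \<open>y x\<^sup>-\<^sup>1\<close>.\<close>
  define k where "k = x$1$1 * y$1$2 - y$1$1 * x$1$2"
  have "y$1$1 = x$1$1 + k * x$2$1" "y$1$2 = x$1$2 + k * x$2$2"
    unfolding k_def using dx dy by algebra+
  then have "y = vector [vector [1, k], vector [0, 1]] ** x"
    by (simp add: vec_eq_iff forall_2 matrix_matrix_mult_def sum_2 vector_2 eq)
  then show "\<exists>h\<in>Gamma_inf2. y = h ** x" by (auto simp: Gamma_inf2_def)
qed

text \<open>
  The quadratic form whose values at the bottom rows of \<open>SL(2, \<int>)\<close> are the reciprocals of the
  imaginary parts in the orbit of \<open>z\<close>.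
\<close>
definition upper_form :: "complex \<Rightarrow> int^2 \<Rightarrow> real" where
  "upper_form z v = (norm (of_int (v$1) * z + of_int (v$2)))\<^sup>2 / Im z"

lemma SL2_rows: "(\<lambda>d. d$2) ` SL2_Z = Collect primitive"
proof (intro equalityI subsetI)
  fix v :: "int^2" assume "v \<in> (\<lambda>d. d$2) ` SL2_Z"
  then obtain d :: "int^2^2" where d: "d$1$1 * d$2$2 - d$1$2 * d$2$1 = 1" "v = d$2" by (auto simp: SL2_Z_def det_2)
  have "primitive v"
  proof (rule primitiveI)
    fix e assume "\<And>i. e dvd v$i"
    then show "e dvd 1" using d by (metis dvd_diff dvd_mult)
  qed
  then show "v \<in> Collect primitive" by simp
next
  fix v :: "int^2" assume "v \<in> Collect primitive"
  then have "gcd (v$1) (v$2) dvd 1"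
  proof (intro primitiveD[of v])
    show "gcd (v$1) (v$2) dvd v$i" for i using exhaust_2[of i] by auto
  qed simp
  then have "gcd (v$1) (v$2) = 1" by simp
  then obtain p q where pq: "p * v$1 + q * v$2 = 1" using bezout_int[of "v$1" "v$2"] by auto
  define d :: "int^2^2" where "d = vector [vector [q, - p], v]"
  have "det d = 1" "d$2 = v" using pq by (simp_all add: d_def det_2 vector_2)
  then show "v \<in> (\<lambda>d. d$2) ` SL2_Z" by (auto simp: SL2_Z_def)
qed

lemma Im_sl2_act:
  assumes d: "d \<in> SL2_Z" and z: "Im z > 0"
  shows "Im (sl2_act d z) = 1 / upper_form z (d$2)" "upper_form z (d$2) > 0"
proof -
  define a b c e where "a = real_of_int (d$1$1)" and "b = real_of_int (d$1$2)"
    and "c = real_of_int (d$2$1)" and "e = real_of_int (d$2$2)"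
  have det: "a * e - b * c = 1"
    using d by (simp add: SL2_Z_def det_2 a_def b_def c_def e_def flip: of_int_mult of_int_diff)
  define w where "w = of_real c * z + of_real e"
  have w: "w \<noteq> 0"
  proof
    assume "w = 0"
    then have "c * Im z = 0" "c * Re z + e = 0" by (auto simp: w_def complex_eq_iff)
    then show False using z det by auto
  qed
  have form: "upper_form z (d$2) = (norm w)\<^sup>2 / Im z" by (simp add: upper_form_def w_def c_def e_def)
  show "upper_form z (d$2) > 0" unfolding form using w z by simp
  have "sl2_act d z = (of_real a * z + of_real b) / w"
    by (simp add: sl2_act_def moebius_def w_def a_def b_def c_def e_def)
  then have "Im (sl2_act d z) = Im ((of_real a * z + of_real b) * cnj w) / (norm w)\<^sup>2"
    by (simp add: complex_div_cnj[of _ w])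
  also have "Im ((of_real a * z + of_real b) * cnj w) = (a * e - b * c) * Im z"
    by (simp add: w_def algebra_simps)
  finally show "Im (sl2_act d z) = 1 / upper_form z (d$2)" by (simp add: det form)
qed

lemma E_SL2_series:
  assumes z: "Im z > 0"
    and int: "integrable (count_space (Collect primitive)) (\<lambda>v. of_real (upper_form z v) powr (- (s + 1 / 2)) :: complex)"
  shows "coset_sum Gamma_inf2 SL2_Z (\<lambda>d. of_real (Im (sl2_act d z)) powr (s + 1 / 2)) =
    (\<integral>v. of_real (upper_form z v) powr (- (s + 1 / 2)) \<partial>count_space (Collect primitive))"
proof -
  let ?f = "\<lambda>v. of_real (upper_form z v) powr (- (s + 1 / 2)) :: complex"
  have I: "of_real (Im (sl2_act d z)) powr (s + 1 / 2) = ?f (d$2)" if d: "d \<in> SL2_Z" for d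
  proof -
    define N where "N = upper_form z (d$2)"
    have N: "N > 0" using Im_sl2_act(2)[OF d z] by (simp add: N_def)
    have "of_real (Im (sl2_act d z)) powr (s + 1 / 2) = of_real (N powr (- 1)) powr (s + 1 / 2)"
      using N by (simp add: Im_sl2_act(1)[OF d z] N_def powr_minus_divide)
    also have "\<dots> = of_real N powr (- (s + 1 / 2))" unfolding powr_of_real_powr[OF N] by simp
    finally show ?thesis by (simp add: N_def)
  qed
  have "coset_sum Gamma_inf2 SL2_Z (\<lambda>d. of_real (Im (sl2_act d z)) powr (s + 1 / 2)) = infsum ?f ((\<lambda>d. d$2) ` SL2_Z)"
    by (rule coset_sum_eq_infsum[where \<phi> = "\<lambda>d. d$2" and F = ?f, OF Gamma_inf2_coset_iff I])
  then show ?thesis using infsum_eq_integral[OF int] by (simp add: SL2_rows)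
qed

section \<open>The Eisenstein series in terms of theta integrals\<close>

lemma row_form_scale: "row_form h (of_nat k *s v) = (real k)\<^sup>2 * row_form h v"
proof -
  have "(\<chi> i. real_of_int ((of_nat k *s v)$i)) v* h = real k *\<^sub>R ((\<chi> i. real_of_int (v$i)) v* h)"
    by (simp add: vec_eq_iff vector_matrix_mult_def sum_distrib_left mult_ac)
  then show ?thesis by (simp add: row_form_def power_mult_distrib)
qed

lemma upper_form_scale: "upper_form z (of_nat k *s v) = (real k)\<^sup>2 * upper_form z v"
proof -
  have "of_int ((of_nat k *s v)$1) * z + of_int ((of_nat k *s v)$2) =
      of_nat k * (of_int (v$1) * z + of_int (v$2))"
    by (simp add: algebra_simps)
  then show ?thesis by (simp add: upper_form_def norm_mult power_mult_distrib)
qed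

lemma norm_vector_matrix_K_max:
  assumes "k \<in> K_max"
  shows "norm (w v* k) = norm w"
proof -
  have "(w v* k) \<bullet> (w v* k) = w \<bullet> (k *v (transpose k *v w))"
    by (simp add: dot_lmul_matrix)
  also have "\<dots> = w \<bullet> w"
    by (simp add: matrix_vector_mul_assoc K_max_orthogonal[OF assms] del: transpose_matrix_vector)
  finally show ?thesis by (simp add: norm_eq_sqrt_inner)
qed

text \<open>
  The order of the variables in the triangular form.
\<close>
definition tup4 :: "int^4 \<Rightarrow> ((int \<times> int) \<times> int) \<times> int" where
  "tup4 v = (((v$1, v$2), v$4), v$3)"

lemma tup4: "bij tup4" "tup4 0 = (((0, 0), 0), 0)"
proof -
  have "tup4 (vector [a, b, c, d]) = (((a, b), d), c)" for a b c d
    by (simp add: tup4_def vector_4)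
  then have "surj tup4" by (metis surjI surj_pair surj_def)
  moreover have "inj tup4" by (auto simp: inj_def tup4_def vec_eq_iff forall_4)
  ultimately show "bij tup4" by (simp add: bij_def)
qed (simp add: tup4_def)

text \<open>The sign accounts for \<open>- n5\<close> being the real part of the point in the upper half-plane.\<close>
definition tup2 :: "int^2 \<Rightarrow> int \<times> int" where
  "tup2 v = (- v$1, v$2)"

lemma tup2: "bij tup2" "tup2 0 = (0, 0)"
proof -
  have "tup2 (vector [- a, b]) = (a, b)" for a b by (simp add: tup2_def vector_2)
  then have "surj tup2" by (metis surjI surj_pair surj_def)
  moreover have "inj tup2" by (auto simp: inj_def tup2_def vec_eq_iff forall_2)
  ultimately show "bij tup2" by (simp add: bij_def)
qed (simp add: tup2_def)

text \<open>
  Passing to primitive vectors divides the Dirichlet series by \<open>\<zeta>(2s)\<close>; completing both turns this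
  into a quotient of theta integrals.
\<close>
lemma primitive_sum_eq_completed:
  fixes f :: "int^'n \<Rightarrow> 'v::countable" and q :: "'v \<Rightarrow> real"
  assumes q: "theta_controlled n D c K z q" and c: "c > 0" and D: "D > 0"
    and f: "bij f" "f 0 = z" and hom: "\<And>k v. q (f (of_nat k *s v)) = (real k)\<^sup>2 * q (f v)"
    and s: "Re s > real n / 2" "Re s \<ge> 1"
  shows "integrable (count_space (Collect primitive)) (\<lambda>v. of_real (q (f v)) powr (- s) :: complex)"
    and "1 / 2 * (\<integral>v. of_real (q (f v)) powr (- s) \<partial>count_space (Collect primitive)) =
      completed (1 / D) (real n / 2) (theta q) s / \<Xi>1 s"
proof -
  have s': "Re s > 0" "Re s > 1 / 2" using s by auto
  note mel = dirichlet_eq_mellin[OF q c D s(1) s'(1)]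
  have int: "integrable (count_space UNIV) (\<lambda>v. if v = 0 then 0 else of_real (q (f v)) powr (- s) :: complex)"
    using mel(1) dirichlet_bij(2)[OF f, of q s] by simp
  have pos: "q (f v) > 0" if "v \<noteq> 0" for v
  proof -
    have "f v \<noteq> z" using f that by (metis bij_is_inj injD)
    then show ?thesis using theta_controlledD(2)[OF q] c by force
  qed
  note prim = dirichlet_primitive[OF bij_betw_primitive, of "\<lambda>v. q (f v)", OF hom pos int s'(2)]
  show "integrable (count_space (Collect primitive)) (\<lambda>v. of_real (q (f v)) powr (- s) :: complex)"
    using prim(1) by simp
  define I where "I = (\<integral>v. of_real (q (f v)) powr (- s) \<partial>count_space (Collect primitive) :: complex)"
  have "dirichlet q z s = zeta_series (2 * s) * I"
    using prim(2) dirichlet_bij(1)[OF f, of q s] by (simp add: I_def)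
  then have "completed (1 / D) (real n / 2) (theta q) s = of_real pi powr (- s) * Gamma s * (zeta_series (2 * s) * I)"
    using mel(2) by simp
  moreover have "\<Xi>1 s = of_real pi powr (- s) * Gamma s * (2 * zeta_series (2 * s))"
    by (rule \<Xi>1_eq[OF s'(2)])
  moreover have "of_real pi powr (- s) * Gamma s \<noteq> 0" by (rule Gamma_pi_nonzero[OF s'(1)])
  moreover have "zeta_series (2 * s) \<noteq> 0" using s by (intro zeta_series_nonzero) simp
  ultimately show "1 / 2 * I = completed (1 / D) (real n / 2) (theta q) s / \<Xi>1 s"
    by (simp add: divide_simps)
qed

lemma analytic_compose_affine:
  fixes a b :: complex
  assumes "f analytic_on B" "\<And>s. s \<in> A \<Longrightarrow> a * s + b \<in> B"
  shows "(\<lambda>s. f (a * s + b)) analytic_on A"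
  by (rule analytic_on_compose_gen[OF _ assms(1), unfolded o_def])
     (use assms(2) in \<open>auto intro!: analytic_intros\<close>)

lemma completed_quotient_analytic:
  assumes R: "rapid (remainder C p T)"
    and A: "\<And>s. s \<in> A \<Longrightarrow> a * s + b \<notin> {0, 1 / 2, of_real p} \<and> \<Xi>1 (a * s + b) \<noteq> 0"
  shows "(\<lambda>s. completed C p T (a * s + b) / \<Xi>1 (a * s + b)) analytic_on A"
  by (intro analytic_on_divide analytic_compose_affine[OF completed_analytic[OF R]]
      analytic_compose_affine[OF \<Xi>1_analytic])
     (use A in auto)

lemma completed_quotient_analytic_halfplane:
  assumes R: "rapid (remainder C p T)" and A: "\<And>s. s \<in> A \<Longrightarrow> Re (a * s + b) > max 1 p"
  shows "(\<lambda>s. completed C p T (a * s + b) / \<Xi>1 (a * s + b)) analytic_on A"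
proof (rule completed_quotient_analytic[OF R])
  have "w \<notin> {0, 1 / 2, of_real p} \<and> \<Xi>1 w \<noteq> 0" if "Re w > max 1 p" for w
  proof -
    have "w \<noteq> v" if "Re v \<le> max 1 p" for v using that \<open>Re w > max 1 p\<close> by auto
    from this[of 0] this[of "1 / 2"] this[of "of_real p"] show ?thesis
      using that \<Xi>1_nonzero[of w] by simp
  qed
  then show "a * s + b \<notin> {0, 1 / 2, of_real p} \<and> \<Xi>1 (a * s + b) \<noteq> 0" if "s \<in> A" for s
    using A[OF that] by blast
qed

lemma completed_quotient_meromorphic:
  assumes R: "rapid (remainder C p T)"
  shows "(\<lambda>s. completed C p T (a * s + b) / \<Xi>1 (a * s + b)) meromorphic_on UNIV"
  by (intro meromorphic_on_divide meromorphic_on_compose[OF completed_meromorphic[OF R]]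
      meromorphic_on_compose[OF \<Xi>1_meromorphic]) (auto intro!: analytic_intros)

context iwasawa_point
begin

abbreviation "base \<equiv> iwasawa_n n1 n2 n4 n5 ** iwasawa_a y1 y2"

lemma row_form_eq_Q4:
  assumes k: "k \<in> K_max"
  shows "row_form (n_beta u1 u2 u3 ** (base ** k)) v = Q4 (u1, u2, u3) (tup4 v)"
proof -
  define w :: "real^4" where "w = (\<chi> i. real_of_int (v$i)) v* n_beta u1 u2 u3"
  have w: "w$1 = v$1" "w$2 = v$1 * u1 + v$2" "w$3 = v$1 * u2 + v$2 * u3 + v$3 - v$4 * u1" "w$4 = v$1 * u3 + v$4"
    by (simp_all add: w_def n_beta_def vector_matrix_mult_def sum_4 vector_4 mult.commute)
  define x where "x = w v* base"
  have x: "x$1 = w$1 * y1" "x$2 = (w$1 * n1 + w$2) * y2" "x$3 = (w$1 * n2 + w$2 * n4 + w$3 - w$4 * n1) / y1"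
    "x$4 = (w$1 * (n1 * n5 + n4) + w$2 * n5 + w$4) / y2"
    unfolding x_def iwasawa_na
    by (simp_all add: vector_matrix_mult_def sum_4 vector_4 algebra_simps add_divide_distrib diff_divide_distrib)
  have "row_form (n_beta u1 u2 u3 ** (base ** k)) v = (norm (x v* k))\<^sup>2"
    by (simp add: row_form_def x_def w_def vector_matrix_mul_assoc matrix_mul_assoc)
  also have "\<dots> = x$1 * x$1 + x$2 * x$2 + x$3 * x$3 + x$4 * x$4"
    by (simp add: norm_vector_matrix_K_max[OF k] power2_norm_eq_inner inner_vec_def sum_4)
  also have "\<dots> = y1\<^sup>2 * (w$1)\<^sup>2 + y2\<^sup>2 * (w$1 * n1 + w$2)\<^sup>2 +
      1 / y2\<^sup>2 * (w$1 * (n1 * n5 + n4) + w$2 * n5 + w$4)\<^sup>2 +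
      1 / y1\<^sup>2 * (w$1 * n2 + w$2 * n4 + w$3 - w$4 * n1)\<^sup>2"
    unfolding x by (simp add: power2_eq_square mult_ac)
  also have "\<dots> = Q4 (u1, u2, u3) (tup4 v)"
  proof -
    have "w$1 * n1 + w$2 = of_int (v$2) + X1 (u1, u2, u3) (v$1)"
      "w$1 * (n1 * n5 + n4) + w$2 * n5 + w$4 = of_int (v$4) + X2 (u1, u2, u3) (v$1, v$2)"
      "w$1 * n2 + w$2 * n4 + w$3 - w$4 * n1 = of_int (v$3) + X3 (u1, u2, u3) ((v$1, v$2), v$4)"
      unfolding w by (simp_all add: X1_def X2_def X3_def algebra_simps)
    then show ?thesis by (simp add: Q4_def tup4_def square_def w(1))
  qed
  finally show ?thesis .
qed

abbreviation "point \<equiv> - of_real n5 + of_real (y2\<^sup>2) * \<i>"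

lemma upper_form_eq_Q2: "upper_form point v = Q2 (tup2 v)"
proof -
  have "(norm (of_int (v$1) * point + of_int (v$2)))\<^sup>2 =
      (real_of_int (v$2) - of_int (v$1) * n5)\<^sup>2 + (of_int (v$1) * y2\<^sup>2)\<^sup>2"
    by (simp add: cmod_power2 add.commute)
  then show ?thesis using y2
    by (simp add: upper_form_def Q2_def tup2_def square_def field_simps power2_eq_square)
qed

lemma E_SL2_point: "\<forall>\<^sub>\<approx>s. E_SL2 point s = \<Xi>2 (s + 1 / 2) / \<Xi>1 (s + 1 / 2)"
proof -
  let ?F = "\<lambda>s. \<Xi>2 (1 * s + 1 / 2) / \<Xi>1 (1 * s + 1 / 2)"
  have mer: "?F meromorphic_on UNIV" by (rule completed_quotient_meromorphic[OF rapid_Q2])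
  have "E_SL2 point = remove_sings ?F"
    unfolding E_SL2_def
  proof (rule mero_continuation_eq[OF mer])
    show "?F analytic_on {s. Re s > 1 / 2}"
      by (rule completed_quotient_analytic_halfplane[OF rapid_Q2]) auto
  next
    fix s assume s: "Re s > 1 / 2"
    have z: "Im point > 0" using y2 by simp
    have hom: "Q2 (tup2 (of_nat k *s v)) = (real k)\<^sup>2 * Q2 (tup2 v)" for k v
      by (simp add: upper_form_scale flip: upper_form_eq_Q2)
    note sum = primitive_sum_eq_completed[OF Q2_controlled cmin(1) zero_less_one tup2 hom, of "s + 1 / 2"]
    have "integrable (count_space (Collect primitive)) (\<lambda>v. of_real (upper_form point v) powr (- (s + 1 / 2)) :: complex)"
      unfolding upper_form_eq_Q2 using sum(1) s by simp
    from E_SL2_series[OF z this]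
    have "1 / 2 * coset_sum Gamma_inf2 SL2_Z (\<lambda>d. of_real (Im (sl2_act d point)) powr (s + 1 / 2)) =
        1 / 2 * (\<integral>v. of_real (Q2 (tup2 v)) powr (- (s + 1 / 2)) \<partial>count_space (Collect primitive))"
      by (simp only: upper_form_eq_Q2)
    also have "\<dots> = ?F s" using sum(2) s by simp
    finally show "?F s = 1 / 2 * coset_sum Gamma_inf2 SL2_Z (\<lambda>d. of_real (Im (sl2_act d point)) powr (s + 1 / 2))" ..
  qed
  then show ?thesis using eventually_remove_sings_eq[OF mer] by simp
qed

lemma E_beta_eq:
  assumes k: "k \<in> K_max"
  shows "E_beta (n_beta u1 u2 u3 ** (base ** k)) =
    remove_sings (\<lambda>\<nu>. completed 1 2 (theta (Q4 (u1, u2, u3))) (1 / 2 * \<nu> + 1) / \<Xi>1 (1 / 2 * \<nu> + 1))"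
    (is "E_beta ?h = remove_sings ?F")
  unfolding E_beta_def
proof (rule mero_continuation_eq)
  show "?F meromorphic_on UNIV" by (rule completed_quotient_meromorphic[OF rapid_Q4])
  show "?F analytic_on {\<nu>. Re \<nu> > 2}"
    by (rule completed_quotient_analytic_halfplane[OF rapid_Q4]) auto
next
  fix \<nu> assume \<nu>: "Re \<nu> > 2"
  have "base ** k \<in> Sp4_R"
  proof -
    have "base \<in> Sp4_R"
      using y1 y2 unfolding iwasawa_na
      by (simp add: Sp4_R_iff symp_J_def mat4_simps field_simps)
    then show ?thesis by (rule Sp4_R_mult[OF _ K_max_orthogonal(2)[OF k]])
  qed
  then have h: "?h \<in> Sp4_R" by (rule Sp4_R_mult[OF n_beta_Sp4])
  have form: "row_form ?h v = Q4 (u1, u2, u3) (tup4 v)" for v by (rule row_form_eq_Q4[OF k])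
  have hom: "Q4 (u1, u2, u3) (tup4 (of_nat m *s v)) = (real m)\<^sup>2 * Q4 (u1, u2, u3) (tup4 v)" for m v
    unfolding form[symmetric] by (rule row_form_scale)
  note sum = primitive_sum_eq_completed[OF Q4_controlled cmin(1) zero_less_one tup4 hom, of "\<nu> / 2 + 1"]
  have "integrable (count_space (Collect primitive)) (\<lambda>v. of_real (row_form ?h v) powr (- (\<nu> / 2 + 1)) :: complex)"
    unfolding form using sum(1) \<nu> by simp
  from E_beta_series[OF h this]
  have "coset_sum (P_beta \<inter> Sp4_Z) Sp4_Z (\<lambda>\<gamma>. I_beta (\<gamma> ** ?h) \<nu>) =
      1 / 2 * (\<integral>v. of_real (Q4 (u1, u2, u3) (tup4 v)) powr (- (\<nu> / 2 + 1)) \<partial>count_space (Collect primitive))"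
    by (simp only: form)
  also have "\<dots> = ?F \<nu>" using sum(2) \<nu> by simp
  finally show "?F \<nu> = coset_sum (P_beta \<inter> Sp4_Z) Sp4_Z (\<lambda>\<gamma>. I_beta (\<gamma> ** ?h) \<nu>)" ..
qed

text \<open>
  The poles of the continued Eisenstein series lie in a set that does not depend on \<open>\<eta>\<close>, so that away
  from it the integral over \<open>\<eta>\<close> can be taken inside the quotient.
\<close>
lemma C_beta_eq:
  assumes k: "k \<in> K_max"
  shows "\<forall>\<^sub>\<approx>\<nu>. C_beta (base ** k) \<nu> =
     (\<integral>u. completed 1 2 (theta (Q4 u)) (1 / 2 * \<nu> + 1) \<partial>cube_measure) / \<Xi>1 (1 / 2 * \<nu> + 1)"
proof -
  have "\<forall>\<^sub>\<approx>s. s \<notin> {0, 1 / 2, 2 :: complex}"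
    by (intro eventually_not_in_cosparse finite_imp_sparse) auto
  moreover have "\<forall>\<^sub>\<approx>s. \<Xi>1 s \<noteq> 0"
    by (rule meromorphic_nonzero_cosparse[OF \<Xi>1_meromorphic, of 1]) (rule \<Xi>1_nonzero, simp)
  ultimately have "\<forall>\<^sub>\<approx>s. s \<notin> {0, 1 / 2, 2} \<and> \<Xi>1 s \<noteq> 0" by (rule eventually_conj)
  then have "\<forall>\<^sub>\<approx>\<nu>. 1 / 2 * \<nu> + 1 \<notin> {0, 1 / 2, 2} \<and> \<Xi>1 (1 / 2 * \<nu> + 1) \<noteq> 0"
    by (rule eventually_cosparse_affine) simp
  then show ?thesis
  proof eventually_elim
    case (elim \<nu>)
    let ?F = "\<lambda>u \<nu>. completed 1 2 (theta (Q4 u)) (1 / 2 * \<nu> + 1) / \<Xi>1 (1 / 2 * \<nu> + 1)"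
    have "E_beta (n_beta u1 u2 u3 ** (base ** k)) \<nu> = ?F (u1, u2, u3) \<nu>" for u1 u2 u3
    proof -
      have "?F (u1, u2, u3) analytic_on {\<nu>}"
        using elim by (intro completed_quotient_analytic[OF rapid_Q4]) auto
      then show ?thesis unfolding E_beta_eq[OF k] by (rule remove_sings_at_analytic)
    qed
    then have "C_beta (base ** k) \<nu> = (\<integral>u. ?F u \<nu> \<partial>cube_measure)"
      unfolding C_beta_def integral_cube by (intro Bochner_Integration.integral_cong) auto
    then show ?case by simp
  qed
qed

text \<open>
  Written with \<open>\<Xi>1\<close> and \<open>\<Xi>2\<close> in place of \<open>\<Lambda>\<close> and the Eisenstein series of \<open>SL(2, \<int>)\<close>, the claim is
  the constant term of the completed series divided by \<open>\<Xi>1(\<nu>/2 + 1)\<close>.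
\<close>
lemma constant_term:
  assumes k: "k \<in> K_max"
  shows "C_beta (base ** k) meromorphic_on UNIV"
    and "\<forall>\<^sub>\<approx>\<nu>. C_beta (base ** k) \<nu> = of_real y1 powr (\<nu> + 2)
        + Lambda (\<nu> + 1) / Lambda (\<nu> + 2) * E_SL2 point (\<nu> / 2) * of_real y1
        + Lambda (\<nu> - 1) / Lambda \<nu> * (Lambda \<nu> / Lambda (\<nu> + 1))
            * (Lambda (\<nu> + 1) / Lambda (\<nu> + 2)) * of_real y1 powr (- \<nu> + 2)"
proof -
  have ev: "\<forall>\<^sub>\<approx>\<nu>. C_beta (base ** k) \<nu> = completed 1 2 average (1 / 2 * \<nu> + 1) / \<Xi>1 (1 / 2 * \<nu> + 1)"
    using C_beta_eq[OF k] by (simp only: completed_average)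
  show "C_beta (base ** k) meromorphic_on UNIV"
    using meromorphic_on_cong'[OF ev refl] completed_quotient_meromorphic[OF rapid_remainder_average] by blast
  have aff: "\<forall>\<^sub>\<approx>\<nu>. P (a * \<nu> + b)" if "\<forall>\<^sub>\<approx>s. P s" "a \<noteq> 0" for P and a b :: complex
    by (rule eventually_cosparse_affine[OF that])
  have ct: "\<forall>\<^sub>\<approx>\<nu>. completed 1 2 average (1 / 2 * \<nu> + 1) =
      of_real y1 powr (2 * (1 / 2 * \<nu> + 1)) * \<Xi>1 (1 / 2 * \<nu> + 1) + of_real y1 * \<Xi>2 (1 / 2 * \<nu> + 1 - 1 / 2)
     + of_real y1 powr (4 - 2 * (1 / 2 * \<nu> + 1)) * \<Xi>1 (1 / 2 * \<nu> + 1 - 3 / 2)"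
    using aff[OF completed_constant_term[unfolded completed_average], of "1 / 2" 1] by simp
  have E: "\<forall>\<^sub>\<approx>\<nu>. E_SL2 point (1 / 2 * \<nu> + 0) = \<Xi>2 (1 / 2 * \<nu> + 0 + 1 / 2) / \<Xi>1 (1 / 2 * \<nu> + 0 + 1 / 2)"
    by (rule aff[OF E_SL2_point]) simp
  have L: "\<forall>\<^sub>\<approx>\<nu>. Lambda (1 * \<nu> + b) = \<Xi>1 ((1 * \<nu> + b) / 2) / 2" for b
    by (rule aff[OF Lambda_eq]) simp
  have L0: "\<forall>\<^sub>\<approx>\<nu>. Lambda (1 * \<nu> + b) \<noteq> 0" for b by (rule aff[OF Lambda_nonzero]) simp
  show "\<forall>\<^sub>\<approx>\<nu>. C_beta (base ** k) \<nu> = of_real y1 powr (\<nu> + 2)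
        + Lambda (\<nu> + 1) / Lambda (\<nu> + 2) * E_SL2 point (\<nu> / 2) * of_real y1
        + Lambda (\<nu> - 1) / Lambda \<nu> * (Lambda \<nu> / Lambda (\<nu> + 1))
            * (Lambda (\<nu> + 1) / Lambda (\<nu> + 2)) * of_real y1 powr (- \<nu> + 2)"
    using ev ct E L[of "- 1"] L[of 1] L[of 2] L0[of 0] L0[of 1] L0[of 2]
  proof eventually_elim
    case (elim \<nu>)
    define a b c d where "a = \<Xi>1 (\<nu> / 2 + 1)" and "b = \<Xi>1 (\<nu> / 2 + 1 / 2)" and "c = \<Xi>1 (\<nu> / 2 - 1 / 2)"
      and "d = \<Xi>2 (\<nu> / 2 + 1 / 2)"
    have arg: "\<nu> / 2 + 1 - 1 / 2 = \<nu> / 2 + 1 / 2" "\<nu> / 2 + 1 - 3 / 2 = \<nu> / 2 - 1 / 2"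
      "(\<nu> - 1) / 2 = \<nu> / 2 - 1 / 2" "(\<nu> + 1) / 2 = \<nu> / 2 + 1 / 2" "(\<nu> + 2) / 2 = \<nu> / 2 + 1"
      "2 * (\<nu> / 2 + 1) = \<nu> + 2" "4 - 2 * (\<nu> / 2 + 1) = - \<nu> + 2"
      by (simp_all add: field_simps)
    have l: "Lambda (\<nu> - 1) = c / 2" "Lambda (\<nu> + 1) = b / 2" "Lambda (\<nu> + 2) = a / 2"
      using elim(4-6) by (simp_all add: a_def b_def c_def arg)
    have nz: "Lambda \<nu> \<noteq> 0" "b \<noteq> 0" "a \<noteq> 0" using elim(7-9) l by auto
    have e: "E_SL2 point (\<nu> / 2) = d / b" using elim(3) by (simp add: d_def b_def)
    have C: "C_beta (base ** k) \<nu> = (of_real y1 powr (\<nu> + 2) * a + of_real y1 * d + of_real y1 powr (- \<nu> + 2) * c) / a"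
      using elim(1,2) by (simp add: a_def c_def d_def arg)
    show ?case unfolding C l e using nz by (simp add: field_simps)
  qed
qed

end

theorem corollary7p8:
  fixes g :: "real^4^4"
  assumes "g \<in> Sp4_R"
  shows "C_beta g meromorphic_on UNIV
    \<and> (\<forall>\<^sub>\<approx>\<nu>. C_beta g \<nu> =
          of_real (iw_y1 g) powr (\<nu> + 2)
        + Lambda (\<nu> + 1) / Lambda (\<nu> + 2)
            * E_SL2 (- of_real (iw_n5 g) + of_real ((iw_y2 g)\<^sup>2) * \<i>) (\<nu> / 2) * of_real (iw_y1 g)
        + Lambda (\<nu> - 1) / Lambda \<nu> * (Lambda \<nu> / Lambda (\<nu> + 1))
            * (Lambda (\<nu> + 1) / Lambda (\<nu> + 2)) * of_real (iw_y1 g) powr (- \<nu> + 2))"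
proof -
  obtain n1 n2 n4 n5 y1 y2 where c: "iwasawa_coords g n1 n2 n4 n5 y1 y2"
    using iwasawa_exists[OF assms] by blast
  then obtain k where k: "k \<in> K_max" and g: "g = iwasawa_n n1 n2 n4 n5 ** iwasawa_a y1 y2 ** k"
    and y: "y1 > 0" "y2 > 0"
    by (auto simp: iwasawa_coords_def)
  interpret iwasawa_point y1 y2 n1 n2 n4 n5 by standard (rule y)+
  show ?thesis
    unfolding iw_eq[OF c] using constant_term[OF k] unfolding g[symmetric] by blast
qed

end
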